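(* Let $\overline{X}=\varprojlim\{X_k,f_k\}$ be a compact connected oriented branched matchbox manifold with a presentation $\{X_k,f_k\}$ as described in the context. Suppose that the presentation satisfies the Simplicity Condition: for each $k\ge 1$ there exists $\kappa(k)\ge k$ such that for every $l\ge\kappa(k)$ and every edge $e\in\mathcal{E}_l$, $f_{k+1}\circ\cdots\circ f_l(e)=X_k$. Then the map $$\iota\colon\left(\varinjlim\mathcal{G}^k,\ \varinjlim\mathcal{G}^k_+\right)\to\left(\mathrm{Br}(\overline{X}),\mathrm{Br}_{\oplus}(\overline{X})\right)$$ sending the class of $[g]\in\mathcal{G}^k$ to $[\phi_g\circ\pi_k]$ is an isomorphism of ordered groups.
   Context: **Branched matchbox manifolds.** A branched matchbox is a space homeomorphic to $U=\bigl((S_1\times(-1,0])\cup(S_2\times[0,1))\bigr)/\sim$, where $S_1,S_2$ are (disjoint) zero-dimensional compact separable metrizable spaces and there is a closed equivalence relation $\approx$ on $S_1\cup S_2$ such that: every element of $S_1$ is $\approx$-equivalent to at least one element of $S_2$ and every element of $S_2$ to at least one element of $S_1$; $(S_1\cup S_2)/{\approx}$ is a zero-dimensional metrizable space in the quotient topology; and $(s,i)\sim(s',j)$ iff either $s\approx s'$ and $i=j=0$, or $s=s'$ and $i=j$. Its projection is $p_U\colon U\to(-1,1)$, $[(z,j)]\mapsto j$. A branched matchbox manifold is a separable metrizable space $Y$ with a collection of charts, i.e. homeomorphisms $h\colon V\to U$ from open subsets $V$ of $Y$ onto branched matchboxes, whose domains cover $Y$ and whose changes of coordinates are continuous. $Y$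 is orientable if it is covered by domains of charts $h_i\colon V_i\to U_i$ (with projections $p_i$) such that for all $i,j$ and every locally one-to-one curve $\gamma\colon[0,1]\to V_i\cap V_j$, $p_i\circ h_i\circ\gamma$ is increasing iff $p_j\circ h_j\circ\gamma$ is increasing; a maximal such collection of charts is an orientation, and $Y$ with a fixed orientation is oriented. A locally one-to-one curve in $Y$ is orientation preserving if $p_i\circ h_i\circ\gamma$ is increasing on each interval that $\gamma$ maps into $V_i$. **Graphs.** A graph is finite, directed and nondegenerate (every vertex has at least one incoming and at least one outgoing edge). A directed edge $e$ is parameterized as $e(t)$, $t\in[0,1]$, with initial vertex $e(0)$ and terminal vertex $e(1)$ (possibly equal). A continuous path $p$ in a directed graph is orientation preserving if $e^{-1}\circ p$ is increasing on every interval that $p$ maps into a directed edge $e$. A continuous map of directed graphs is orientation preserving if it sends orientation preserving paths to orientation preserving paths. **Presentation.** $\overline{X}=\{(x_0,x_1,\dots)\in\prod_{k\ge0} X_k: f_{k+1}(x_{k+1})=x_k\}$, where each $X_k$ is a graph with a fixed vertex set $\mathcal{V}_k$ and set of directed edges $\mathcal{E}_k$, and each $f_k\colon X_k\to X_{k-1}$ is a continuous onto orientation preserving map with $f_k(\mathcal{V}_k)\subset\mathcal{V}_{k-1}$ and $f_k|_{X_k\setminus\mathcal{V}_k}$ locally one-to-one. The edge directions are those induced by the orientation of $\overline{X}$, so the projections $\pi_k\colon\overline{X}\to X_k$ carry orientation preserving curves to orientation preserving curves. **Ordered groups.** A preordered group is a pair $(G,G_+)$ with $G$ abelian and $G_+$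 a submonoid generating $G$; it is an ordered group if $G_+\cap(-G_+)=\{0\}$. **Bruschlinsky group and winding order.** For a compact metric space $Y$, $C(Y,S^1)$ is the group of continuous maps $Y\to S^1$, $R(Y)=\{\exp(2\pi i g): g\in C(Y,\mathbb{R})\}$, and $\mathrm{Br}(Y)=C(Y,S^1)/R(Y)$. For $Y$ an oriented compact branched matchbox manifold or a directed graph, $\mathrm{Br}_{\oplus}(Y)$ is the set of classes $[\phi]$ for which there is $\psi\in R(Y)$ such that $\phi\cdot\psi$ is non-orientation-reversing: for every orientation preserving parameterized curve $\gamma\colon\mathbb{R}\to Y$, $(\phi\cdot\psi)(\gamma(t))$ does not move clockwise on $S^1$ as $t$ increases. This defines the winding order. **Graph groups.** $C(\mathcal{E}_k,\mathbb{Z})$ is the group of functions $\mathcal{E}_k\to\mathbb{Z}$ and $C_+(\mathcal{E}_k,\mathbb{Z})$ the nonnegative ones. For a vertex $p_i$ of $X_k$, the vertex function $v_i\in C(\mathcal{E}_k,\mathbb{Z})$ is $1$ on edges from $p_i$ to another vertex, $-1$ on edges from another vertex to $p_i$, and $0$ on all other edges. $V_k$ is the subgroup generated by the $v_i$. $\mathcal{G}^k=C(\mathcal{E}_k,\mathbb{Z})/V_k$ and $\mathcal{G}^k_+$ is the image of $C_+(\mathcal{E}_k,\mathbb{Z})$. For $g\in C(\mathcal{E}_k,\mathbb{Z})$, $\phi_g\colon X_k\to S^1$ is $\phi_g(e(t))=\exp(2\pi i\,t\,g(e))$. For $e\in\mathcal{E}_{k+1}$, $f_{k+1}(e)$ is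 a path $e_1\cdots e_n$ of edges of $X_k$; set $f^*_{k+1}(g)(e)=\sum_{i}g(e_i)$, which induces $f^*_{k+1}\colon\mathcal{G}^k\to\mathcal{G}^{k+1}$. $\varinjlim\mathcal{G}^k$ is the direct limit along these maps, with positive cone $\varinjlim\mathcal{G}^k_+$ (the standard order). *)

theory Defs
  imports "HOL-Analysis.Analysis" "HOL-Algebra.Product_Groups"
begin

section \<open>Topological preliminaries\<close>

definition quotient_topology :: "'a topology \<Rightarrow> ('a \<times> 'a) set \<Rightarrow> 'a set topology" where
  "quotient_topology X R =
     topology (\<lambda>W. W \<subseteq> topspace X // R \<and> openin X {x \<in> topspace X. R `` {x} \<in> W})"

lemma openin_quotient_topology:
  "openin (quotient_topology X R) W \<longleftrightarrow>
     W \<subseteq> topspace X // R \<and> openin X {x \<in> topspace X. R `` {x} \<in> W}"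
proof -
  have "istopology (\<lambda>W. W \<subseteq> topspace X // R \<and> openin X {x \<in> topspace X. R `` {x} \<in> W})"
    unfolding istopology_def
  proof (intro conjI allI impI)
    fix S T
    assume S: "S \<subseteq> topspace X // R \<and> openin X {x \<in> topspace X. R `` {x} \<in> S}"
      and T: "T \<subseteq> topspace X // R \<and> openin X {x \<in> topspace X. R `` {x} \<in> T}"
    show "S \<inter> T \<subseteq> topspace X // R" using S by blast
    have "{x \<in> topspace X. R `` {x} \<in> S \<inter> T} =
        {x \<in> topspace X. R `` {x} \<in> S} \<inter> {x \<in> topspace X. R `` {x} \<in> T}" by blast
    with S T show "openin X {x \<in> topspace X. R `` {x} \<in> S \<inter> T}"
      by (simp add: openin_Int)
  next
    fix K
    assume K: "\<forall>S\<in>K. S \<subseteq> topspace X // R \<and> openin X {x \<in> topspace X. R `` {x} \<in> S}"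
    show "\<Union>K \<subseteq> topspace X // R" using K by blast
    have "{x \<in> topspace X. R `` {x} \<in> \<Union>K} =
        (\<Union>S\<in>K. {x \<in> topspace X. R `` {x} \<in> S})" by blast
    moreover have "openin X (\<Union>S\<in>K. {x \<in> topspace X. R `` {x} \<in> S})"
      using K by (intro openin_Union) auto
    ultimately show "openin X {x \<in> topspace X. R `` {x} \<in> \<Union>K}" by presburger
  qed
  then show ?thesis
    by (simp add: quotient_topology_def)
qed

lemma topspace_quotient_topology: "topspace (quotient_topology X R) = topspace X // R"
proof -
  have "{x \<in> topspace X. R `` {x} \<in> topspace X // R} = topspace X"
    by (auto simp: quotient_def)
  then have "openin (quotient_topology X R) (topspace X // R)"
    by (simp add: openin_quotient_topology)
  then show ?thesis
    by (metis openin_quotient_topology openin_subset openin_topspace subset_antisym)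
qed

lemma quotient_map_quotient_topology:
  "quotient_map X (quotient_topology X R) (\<lambda>x. R `` {x})"
  by (auto simp: quotient_map_def topspace_quotient_topology openin_quotient_topology quotient_def)

definition locally_one_to_one :: "'a topology \<Rightarrow> ('a \<Rightarrow> 'b) \<Rightarrow> bool" where
  "locally_one_to_one X h \<longleftrightarrow> (\<forall>x \<in> topspace X. \<exists>U. openin X U \<and> x \<in> U \<and> inj_on h U)"

section \<open>Branched matchbox manifolds\<close>

text \<open>The disjoint union of \<open>S\<^sub>1\<close> and \<open>S\<^sub>2\<close> is a single space \<open>mb_space\<close> in which
  \<open>S\<^sub>1 = mb_neg\<close> and \<open>S\<^sub>2 = mb_pos\<close> are complementary clopen sets.  The points of this
  space are mere labels: its topology is unrelated to any topology on the type \<open>'s\<close>.\<close>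

record 's matchbox =
  mb_space :: "'s topology"
  mb_neg :: "'s set"
  mb_pos :: "'s set"
  mb_equiv :: "('s \<times> 's) set"

definition matchbox :: "'s matchbox \<Rightarrow> bool" where
  "matchbox B \<longleftrightarrow>
     openin (mb_space B) (mb_neg B) \<and> openin (mb_space B) (mb_pos B) \<and>
     mb_neg B \<inter> mb_pos B = {} \<and> mb_neg B \<union> mb_pos B = topspace (mb_space B) \<and>
     compact_space (mb_space B) \<and> separable_space (mb_space B) \<and>
     metrizable_space (mb_space B) \<and> mb_space B dim_le 0 \<and>
     equiv (topspace (mb_space B)) (mb_equiv B) \<and>
     closedin (prod_topology (mb_space B) (mb_space B)) (mb_equiv B) \<and>
     (\<forall>s \<in> mb_neg B. \<exists>s' \<in> mb_pos B. (s, s') \<in> mb_equiv B) \<and>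
     (\<forall>s \<in> mb_pos B. \<exists>s' \<in> mb_neg B. (s, s') \<in> mb_equiv B) \<and>
     metrizable_space (quotient_topology (mb_space B) (mb_equiv B)) \<and>
     quotient_topology (mb_space B) (mb_equiv B) dim_le 0"

definition mb_prespace :: "'s matchbox \<Rightarrow> ('s \<times> real) topology" where
  "mb_prespace B = subtopology (prod_topology (mb_space B) euclideanreal)
     (mb_neg B \<times> {-1<..0} \<union> mb_pos B \<times> {0..<1})"

definition mb_glue :: "'s matchbox \<Rightarrow> (('s \<times> real) \<times> ('s \<times> real)) set" where
  "mb_glue B = {((s, i), (s', j)) | s i s' j.
     (s, i) \<in> topspace (mb_prespace B) \<and> (s', j) \<in> topspace (mb_prespace B) \<and>
     ((s, s') \<in> mb_equiv B \<and> i = 0 \<and> j = 0 \<or> s = s' \<and> i = j)}"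

definition mb_topology :: "'s matchbox \<Rightarrow> ('s \<times> real) set topology" where
  "mb_topology B = quotient_topology (mb_prespace B) (mb_glue B)"

text \<open>All points of a class have the same second coordinate.\<close>

definition mb_proj :: "('s \<times> real) set \<Rightarrow> real" where
  "mb_proj A = the_elem (snd ` A)"

record ('y, 's) chart =
  chart_dom :: "'y set"
  chart_box :: "'s matchbox"
  chart_map :: "'y \<Rightarrow> ('s \<times> real) set"

definition is_chart :: "'y topology \<Rightarrow> ('y, 's) chart \<Rightarrow> bool" where
  "is_chart Y c \<longleftrightarrow> openin Y (chart_dom c) \<and> matchbox (chart_box c) \<and>
     homeomorphic_map (subtopology Y (chart_dom c)) (mb_topology (chart_box c)) (chart_map c)"

definition chart_height :: "('y, 's) chart \<Rightarrow> 'y \<Rightarrow> real" where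
  "chart_height c = mb_proj \<circ> chart_map c"

definition matchbox_atlas :: "'y topology \<Rightarrow> ('y, 's) chart set \<Rightarrow> bool" where
  "matchbox_atlas Y \<A> \<longleftrightarrow>
     (\<forall>c \<in> \<A>. is_chart Y c) \<and> (\<Union>c \<in> \<A>. chart_dom c) = topspace Y \<and>
     (\<forall>c \<in> \<A>. \<forall>d \<in> \<A>. continuous_map
        (subtopology (mb_topology (chart_box c)) (chart_map c ` (chart_dom c \<inter> chart_dom d)))
        (mb_topology (chart_box d))
        (chart_map d \<circ> inv_into (chart_dom c) (chart_map c)))"

definition curve_on :: "real set \<Rightarrow> 'y topology \<Rightarrow> (real \<Rightarrow> 'y) \<Rightarrow> bool" where
  "curve_on I Y \<gamma> \<longleftrightarrow> continuous_map (top_of_set I) Y \<gamma> \<and> locally_one_to_one (top_of_set I) \<gamma>"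

text \<open>``Increasing'' is rendered by \<^const>\<open>mono_on\<close>; along a locally one-to-one curve in a
  branched matchbox this is the same as strictly increasing.\<close>

definition oriented_atlas :: "'y topology \<Rightarrow> ('y, 's) chart set \<Rightarrow> bool" where
  "oriented_atlas Y \<A> \<longleftrightarrow> matchbox_atlas Y \<A> \<and>
     (\<forall>c \<in> \<A>. \<forall>d \<in> \<A>. \<forall>\<gamma>.
        curve_on {0..1} (subtopology Y (chart_dom c \<inter> chart_dom d)) \<gamma> \<longrightarrow>
        (mono_on {0..1} (chart_height c \<circ> \<gamma>) \<longleftrightarrow> mono_on {0..1} (chart_height d \<circ> \<gamma>)))"

definition orientation :: "'y topology \<Rightarrow> ('y, 's) chart set \<Rightarrow> bool" where
  "orientation Y \<O> \<longleftrightarrow> oriented_atlas Y \<O> \<and>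
     (\<forall>\<A>. oriented_atlas Y \<A> \<and> \<O> \<subseteq> \<A> \<longrightarrow> \<A> = \<O>)"

definition oriented_branched_matchbox_manifold ::
    "'y topology \<Rightarrow> ('y, 's) chart set \<Rightarrow> bool" where
  "oriented_branched_matchbox_manifold Y \<O> \<longleftrightarrow>
     separable_space Y \<and> metrizable_space Y \<and> orientation Y \<O>"

definition op_curve ::
    "'y topology \<Rightarrow> ('y, 's) chart set \<Rightarrow> real set \<Rightarrow> (real \<Rightarrow> 'y) \<Rightarrow> bool" where
  "op_curve Y \<O> I \<gamma> \<longleftrightarrow> curve_on I Y \<gamma> \<and>
     (\<forall>c \<in> \<O>. \<forall>J \<subseteq> I. is_interval J \<and> \<gamma> ` J \<subseteq> chart_dom c \<longrightarrow> mono_on J (chart_height c \<circ> \<gamma>))"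

section \<open>Directed graphs\<close>

text \<open>The edges are labels; \<open>gparam X e\<close> restricted to \<open>[0,1]\<close> is the parameterized edge.\<close>

record ('a, 'e) graph =
  gspace :: "'a topology"
  gverts :: "'a set"
  gedges :: "'e set"
  gparam :: "'e \<Rightarrow> real \<Rightarrow> 'a"

definition directed_graph :: "('a, 'e) graph \<Rightarrow> bool" where
  "directed_graph X \<longleftrightarrow>
     Hausdorff_space (gspace X) \<and> finite (gverts X) \<and> finite (gedges X) \<and>
     (\<forall>e \<in> gedges X.
        continuous_map (top_of_set {0..1}) (gspace X) (gparam X e) \<and>
        inj_on (gparam X e) {0<..<1} \<and>
        gparam X e 0 \<in> gverts X \<and> gparam X e 1 \<in> gverts X \<and>
        gparam X e ` {0<..<1} \<inter> gverts X = {}) \<and>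
     (\<forall>e \<in> gedges X. \<forall>e' \<in> gedges X. e \<noteq> e' \<longrightarrow>
        gparam X e ` {0<..<1} \<inter> gparam X e' ` {0<..<1} = {}) \<and>
     topspace (gspace X) = gverts X \<union> (\<Union>e \<in> gedges X. gparam X e ` {0..1}) \<and>
     (\<forall>v \<in> gverts X. (\<exists>e \<in> gedges X. gparam X e 1 = v) \<and> (\<exists>e \<in> gedges X. gparam X e 0 = v))"

text \<open>The inverse of a parameterized loop is two-valued at the vertex, so the condition is imposed
  on the intervals mapped into the interior of an edge.  For an edge with distinct end points the
  condition on the closed edge follows by continuity.\<close>

definition graph_op_path :: "('a, 'e) graph \<Rightarrow> real set \<Rightarrow> (real \<Rightarrow> 'a) \<Rightarrow> bool" where
  "graph_op_path X I p \<longleftrightarrow> continuous_map (top_of_set I) (gspace X) p \<and>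
     (\<forall>e \<in> gedges X. \<forall>J \<subseteq> I. is_interval J \<and> p ` J \<subseteq> gparam X e ` {0<..<1} \<longrightarrow>
        mono_on J (inv_into {0<..<1} (gparam X e) \<circ> p))"

definition graph_op_map :: "('a, 'e) graph \<Rightarrow> ('b, 'f) graph \<Rightarrow> ('a \<Rightarrow> 'b) \<Rightarrow> bool" where
  "graph_op_map X Y h \<longleftrightarrow> continuous_map (gspace X) (gspace Y) h \<and>
     (\<forall>I p. is_interval I \<and> graph_op_path X I p \<longrightarrow> graph_op_path Y I (h \<circ> p))"

section \<open>Presentations\<close>

text \<open>\<open>f k\<close> maps \<open>X k\<close> to \<open>X (k - 1)\<close>; the value \<open>f 0\<close> is irrelevant.\<close>

definition presentation :: "(nat \<Rightarrow> ('a, 'e) graph) \<Rightarrow> (nat \<Rightarrow> 'a \<Rightarrow> 'a) \<Rightarrow> bool" where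
  "presentation X f \<longleftrightarrow>
     (\<forall>k. directed_graph (X k)) \<and>
     (\<forall>k. graph_op_map (X (Suc k)) (X k) (f (Suc k)) \<and>
          f (Suc k) ` topspace (gspace (X (Suc k))) = topspace (gspace (X k)) \<and>
          f (Suc k) ` gverts (X (Suc k)) \<subseteq> gverts (X k) \<and>
          locally_one_to_one
            (subtopology (gspace (X (Suc k))) (topspace (gspace (X (Suc k))) - gverts (X (Suc k))))
            (f (Suc k)))"

definition inverse_limit ::
    "(nat \<Rightarrow> ('a, 'e) graph) \<Rightarrow> (nat \<Rightarrow> 'a \<Rightarrow> 'a) \<Rightarrow> (nat \<Rightarrow> 'a) topology" where
  "inverse_limit X f = subtopology (product_topology (\<lambda>k. gspace (X k)) UNIV)
     {x. \<forall>k. f (Suc k) (x (Suc k)) = x k}"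

text \<open>\<open>bonding f k n\<close> is the composite of \<open>f (k + 1), \<dots>, f (k + n)\<close>, from
  \<open>X (k + n)\<close> to \<open>X k\<close>.\<close>

primrec bonding :: "(nat \<Rightarrow> 'a \<Rightarrow> 'a) \<Rightarrow> nat \<Rightarrow> nat \<Rightarrow> 'a \<Rightarrow> 'a" where
  "bonding f k 0 = id"
| "bonding f k (Suc n) = bonding f k n \<circ> f (k + Suc n)"

definition simplicity_condition ::
    "(nat \<Rightarrow> ('a, 'e) graph) \<Rightarrow> (nat \<Rightarrow> 'a \<Rightarrow> 'a) \<Rightarrow> bool" where
  "simplicity_condition X f \<longleftrightarrow> (\<forall>k \<ge> 1. \<exists>\<kappa> \<ge> k. \<forall>l \<ge> \<kappa>. \<forall>e \<in> gedges (X l).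
     bonding f k (l - k) ` (gparam (X l) e ` {0..1}) = topspace (gspace (X k)))"

section \<open>Ordered groups\<close>

definition preordered_group :: "('g, 'm) monoid_scheme \<Rightarrow> 'g set \<Rightarrow> bool" where
  "preordered_group G P \<longleftrightarrow> comm_group G \<and> submonoid P G \<and> generate G P = carrier G"

definition ordered_group :: "('g, 'm) monoid_scheme \<Rightarrow> 'g set \<Rightarrow> bool" where
  "ordered_group G P \<longleftrightarrow> preordered_group G P \<and> P \<inter> (\<lambda>x. inv\<^bsub>G\<^esub> x) ` P = {\<one>\<^bsub>G\<^esub>}"

definition ordered_group_iso ::
    "('g, 'm) monoid_scheme \<Rightarrow> 'g set \<Rightarrow> ('h, 'n) monoid_scheme \<Rightarrow> 'h set \<Rightarrow> ('g \<Rightarrow> 'h) \<Rightarrow> bool" where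
  "ordered_group_iso G P H Q h \<longleftrightarrow>
     ordered_group G P \<and> ordered_group H Q \<and> h \<in> iso G H \<and> h ` P = Q"

section \<open>Direct limits of sequences of groups\<close>

text \<open>\<open>t k\<close> maps \<open>G k\<close> to \<open>G (k + 1)\<close>, and \<open>transition t k n\<close> maps \<open>G k\<close> to \<open>G (k + n)\<close>.\<close>

primrec transition :: "(nat \<Rightarrow> 'g \<Rightarrow> 'g) \<Rightarrow> nat \<Rightarrow> nat \<Rightarrow> 'g \<Rightarrow> 'g" where
  "transition t k 0 = id"
| "transition t k (Suc n) = t (k + n) \<circ> transition t k n"

definition dirlim_rel ::
    "(nat \<Rightarrow> 'g monoid) \<Rightarrow> (nat \<Rightarrow> 'g \<Rightarrow> 'g) \<Rightarrow> ((nat \<times> 'g) \<times> (nat \<times> 'g)) set" where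
  "dirlim_rel G t = {((k, x), (l, y)) | k x l y. x \<in> carrier (G k) \<and> y \<in> carrier (G l) \<and>
     (\<exists>m \<ge> max k l. transition t k (m - k) x = transition t l (m - l) y)}"

definition dirlim_class ::
    "(nat \<Rightarrow> 'g monoid) \<Rightarrow> (nat \<Rightarrow> 'g \<Rightarrow> 'g) \<Rightarrow> nat \<Rightarrow> 'g \<Rightarrow> (nat \<times> 'g) set" where
  "dirlim_class G t k x = dirlim_rel G t `` {(k, x)}"

text \<open>The union in the product is over representatives, all of which give the same class.\<close>

definition dirlim ::
    "(nat \<Rightarrow> 'g monoid) \<Rightarrow> (nat \<Rightarrow> 'g \<Rightarrow> 'g) \<Rightarrow> (nat \<times> 'g) set monoid" where
  "dirlim G t =
     \<lparr>carrier = {dirlim_class G t k x | k x. x \<in> carrier (G k)},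
      monoid.mult = (\<lambda>A B. \<Union>(k, x) \<in> A. \<Union>(l, y) \<in> B.
        dirlim_class G t (max k l)
          (transition t k (max k l - k) x \<otimes>\<^bsub>G (max k l)\<^esub> transition t l (max k l - l) y)),
      one = dirlim_class G t 0 \<one>\<^bsub>G 0\<^esub>\<rparr>"

definition dirlim_pos :: "(nat \<Rightarrow> 'g monoid) \<Rightarrow> (nat \<Rightarrow> 'g \<Rightarrow> 'g) \<Rightarrow> (nat \<Rightarrow> 'g set) \<Rightarrow>
    (nat \<times> 'g) set set" where
  "dirlim_pos G t P = {dirlim_class G t k x | k x. x \<in> P k}"

section \<open>Graph groups\<close>

definition edge_fun_group :: "('a, 'e) graph \<Rightarrow> ('e \<Rightarrow> int) monoid" where
  "edge_fun_group X = product_group (gedges X) (\<lambda>_. integer_group)"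

definition edge_fun_pos :: "('a, 'e) graph \<Rightarrow> ('e \<Rightarrow> int) set" where
  "edge_fun_pos X = {g \<in> carrier (edge_fun_group X). \<forall>e \<in> gedges X. 0 \<le> g e}"

definition vertex_fun :: "('a, 'e) graph \<Rightarrow> 'a \<Rightarrow> 'e \<Rightarrow> int" where
  "vertex_fun X v = (\<lambda>e \<in> gedges X.
     if gparam X e 0 = v \<and> gparam X e 1 \<noteq> v then 1
     else if gparam X e 1 = v \<and> gparam X e 0 \<noteq> v then -1
     else 0)"

definition vertex_subgroup :: "('a, 'e) graph \<Rightarrow> ('e \<Rightarrow> int) set" where
  "vertex_subgroup X = generate (edge_fun_group X) (vertex_fun X ` gverts X)"

definition graph_group :: "('a, 'e) graph \<Rightarrow> ('e \<Rightarrow> int) set monoid" where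
  "graph_group X = edge_fun_group X Mod vertex_subgroup X"

definition graph_class :: "('a, 'e) graph \<Rightarrow> ('e \<Rightarrow> int) \<Rightarrow> ('e \<Rightarrow> int) set" where
  "graph_class X g = vertex_subgroup X #>\<^bsub>edge_fun_group X\<^esub> g"

definition graph_group_pos :: "('a, 'e) graph \<Rightarrow> ('e \<Rightarrow> int) set set" where
  "graph_group_pos X = graph_class X ` edge_fun_pos X"

definition traverses :: "('a, 'e) graph \<Rightarrow> (real \<Rightarrow> 'a) \<Rightarrow> 'e list \<Rightarrow> bool" where
  "traverses X p es \<longleftrightarrow> set es \<subseteq> gedges X \<and>
     (\<exists>ts :: nat \<Rightarrow> real. ts 0 = 0 \<and> ts (length es) = 1 \<and>
        (\<forall>i < length es. ts i < ts (Suc i) \<and>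
           (\<exists>\<tau>. continuous_on {ts i..ts (Suc i)} \<tau> \<and> strict_mono_on {ts i..ts (Suc i)} \<tau> \<and>
                \<tau> (ts i) = 0 \<and> \<tau> (ts (Suc i)) = 1 \<and>
                (\<forall>s \<in> {ts i..ts (Suc i)}. p s = gparam X (es ! i) (\<tau> s)))))"

definition edge_word :: "('a, 'e) graph \<Rightarrow> (real \<Rightarrow> 'a) \<Rightarrow> 'e list" where
  "edge_word X p = (THE es. traverses X p es)"

text \<open>For \<open>h\<close> from \<open>Y\<close> to \<open>X\<close>.\<close>

definition pull_fun ::
    "('b, 'f) graph \<Rightarrow> ('a, 'e) graph \<Rightarrow> ('b \<Rightarrow> 'a) \<Rightarrow> ('e \<Rightarrow> int) \<Rightarrow> ('f \<Rightarrow> int)" where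
  "pull_fun Y X h g = (\<lambda>e \<in> gedges Y. sum_list (map g (edge_word X (h \<circ> gparam Y e))))"

text \<open>The coset of the images of all representatives of a class.\<close>

definition pull_class ::
    "('b, 'f) graph \<Rightarrow> ('a, 'e) graph \<Rightarrow> ('b \<Rightarrow> 'a) \<Rightarrow> ('e \<Rightarrow> int) set \<Rightarrow> ('f \<Rightarrow> int) set" where
  "pull_class Y X h A = (\<Union>g \<in> A. graph_class Y (pull_fun Y X h g))"

abbreviation limit_group ::
    "(nat \<Rightarrow> ('a, 'e) graph) \<Rightarrow> (nat \<Rightarrow> 'a \<Rightarrow> 'a) \<Rightarrow> (nat \<times> ('e \<Rightarrow> int) set) set monoid" where
  "limit_group X f \<equiv>
     dirlim (\<lambda>k. graph_group (X k)) (\<lambda>k. pull_class (X (Suc k)) (X k) (f (Suc k)))"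

abbreviation limit_group_pos ::
    "(nat \<Rightarrow> ('a, 'e) graph) \<Rightarrow> (nat \<Rightarrow> 'a \<Rightarrow> 'a) \<Rightarrow> (nat \<times> ('e \<Rightarrow> int) set) set set" where
  "limit_group_pos X f \<equiv>
     dirlim_pos (\<lambda>k. graph_group (X k)) (\<lambda>k. pull_class (X (Suc k)) (X k) (f (Suc k)))
       (\<lambda>k. graph_group_pos (X k))"

abbreviation limit_class ::
    "(nat \<Rightarrow> ('a, 'e) graph) \<Rightarrow> (nat \<Rightarrow> 'a \<Rightarrow> 'a) \<Rightarrow> nat \<Rightarrow> ('e \<Rightarrow> int) set \<Rightarrow>
      (nat \<times> ('e \<Rightarrow> int) set) set" where
  "limit_class X f \<equiv>
     dirlim_class (\<lambda>k. graph_group (X k)) (\<lambda>k. pull_class (X (Suc k)) (X k) (f (Suc k)))"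

definition edge_circle_map :: "('a, 'e) graph \<Rightarrow> ('e \<Rightarrow> int) \<Rightarrow> 'a \<Rightarrow> complex" where
  "edge_circle_map X g x =
     (THE z. \<exists>e \<in> gedges X. \<exists>t \<in> {0..1}. x = gparam X e t \<and> z = cis (2 * pi * t * of_int (g e)))"

section \<open>The Bruschlinsky group and the winding order\<close>

definition circle_maps :: "'y topology \<Rightarrow> ('y \<Rightarrow> complex) monoid" where
  "circle_maps Y =
     \<lparr>carrier = {\<phi> \<in> extensional (topspace Y). continuous_map Y (top_of_set (sphere 0 1)) \<phi>},
      monoid.mult = (\<lambda>\<phi> \<psi>. \<lambda>y \<in> topspace Y. \<phi> y * \<psi> y),
      one = (\<lambda>y \<in> topspace Y. 1)\<rparr>"

definition exp_maps :: "'y topology \<Rightarrow> ('y \<Rightarrow> complex) set" where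
  "exp_maps Y = {\<lambda>y \<in> topspace Y. cis (2 * pi * g y) | g. continuous_map Y euclideanreal g}"

definition Br :: "'y topology \<Rightarrow> ('y \<Rightarrow> complex) set monoid" where
  "Br Y = circle_maps Y Mod exp_maps Y"

definition Br_class :: "'y topology \<Rightarrow> ('y \<Rightarrow> complex) \<Rightarrow> ('y \<Rightarrow> complex) set" where
  "Br_class Y \<phi> = exp_maps Y #>\<^bsub>circle_maps Y\<^esub> (restrict \<phi> (topspace Y))"

definition never_clockwise :: "(real \<Rightarrow> complex) \<Rightarrow> bool" where
  "never_clockwise c \<longleftrightarrow>
     (\<exists>\<theta> :: real \<Rightarrow> real. continuous_on UNIV \<theta> \<and> mono \<theta> \<and> (\<forall>t. c t = cis (\<theta> t)))"

definition non_orientation_reversing ::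
    "'y topology \<Rightarrow> ('y, 's) chart set \<Rightarrow> ('y \<Rightarrow> complex) \<Rightarrow> bool" where
  "non_orientation_reversing Y \<O> \<phi> \<longleftrightarrow> (\<forall>\<gamma>. op_curve Y \<O> UNIV \<gamma> \<longrightarrow> never_clockwise (\<phi> \<circ> \<gamma>))"

definition Br_pos :: "'y topology \<Rightarrow> ('y, 's) chart set \<Rightarrow> ('y \<Rightarrow> complex) set set" where
  "Br_pos Y \<O> = {Br_class Y \<phi> | \<phi>. \<phi> \<in> carrier (circle_maps Y) \<and>
     (\<exists>\<psi> \<in> exp_maps Y. non_orientation_reversing Y \<O> (\<phi> \<otimes>\<^bsub>circle_maps Y\<^esub> \<psi>))}"

end

theory Submission
  imports Defs "HOL-Library.Real_Mod"
begin

text \<open>On a graph \<open>X\<close>, lifting a circle map along the edges writes it as \<open>\<phi>\<^sub>g\<close> times an exponential for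
  an edge cochain \<open>g\<close>, and \<open>\<phi>\<^sub>g\<close> itself is an exponential exactly if \<open>g\<close> is a coboundary of a vertex
  potential; so \<open>\<G>\<^sup>k\<close> is the Bruschlinsky group of \<open>X\<^sub>k\<close>.  Continuity of this functor along the
  inverse limit gives the group isomorphism: circle maps on the limit extend to the product (Tietze)
  and descend to a finite level up to an exponential, and a logarithm that oscillates by less than
  \<open>1\<close> on the fibres of a projection is, after an integral correction, constant on them.

  For the order, an edge of \<open>X\<^sub>m\<close> lifts to a curve in the limit.  In a chart its height is locally
  strictly monotone off the branching level, and it cannot decrease, because the reversed curve
  would then project to an orientation preserving path running backwards in the edge.  Let \<open>\<phi>\<close> be
  nonconstant and non-orientation-reversing.  By simplicity the lift of every edge at a high level
  projects onto a fixed \<open>X\<^sub>k\<close>, so \<open>\<phi>\<close> turns along it by at least a fixed \<open>r > 0\<close>.  Writing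
  \<open>\<phi> = (\<phi>\<^sub>g \<circ> \<pi>\<^sub>m) exp (2 \<pi> i u)\<close> with \<open>u\<close> oscillating by less than \<open>r/2\<close> on fibres, this
  yields \<open>g(e) + u(e(1)) - u(e(0)) > 0\<close> for all \<open>e\<close>, and passing to integer parts of \<open>u\<close>
  turns \<open>g\<close> into a nonnegative cochain of the same class.\<close>

section \<open>Lifting circle-valued maps\<close>

text \<open>Two obstacles shape the proof. Orientation preservation says nothing about the instants
  a path spends at vertices, which may form a complicated closed set. But the lifted angle is an
  integer there, while a decreasing function crosses uncountably many levels; so monotonicity has to
  be tested only off a countable set of levels. Chart heights are treated alike, with the single
  exceptional level \<open>0\<close>. The second obstacle is that \<open>pull_fun\<close> reads off
  edge words given by a definite description, whereas the argument runs on circle maps. A lift of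
  the circle map of the constant cochain \<open>1\<close> is a clock that shows an integer exactly
  at the vertices. It yields existence and uniqueness of the word, and \<open>pull_fun\<close>
  becomes the increment along an edge of a lift of the composed circle map. Simplicity enters a
  second time for antisymmetry: a nonnegative coboundary vanishes. That the winding order makes the
  Bruschlinsky group an ordered group is not checked directly but carried over by the group
  isomorphism.\<close>

definition circ :: "real \<Rightarrow> complex" where
  "circ t = cis (2 * pi * t)"

lemma circ_0 [simp]: "circ 0 = 1"
  by (simp add: circ_def)

lemma norm_circ [simp]: "norm (circ t) = 1"
  by (simp add: circ_def)

lemma circ_nonzero [simp]: "circ t \<noteq> 0"
  by (simp add: circ_def)

lemma circ_add: "circ (s + t) = circ s * circ t"
  by (simp add: circ_def cis_mult distrib_left)

lemma circ_diff: "circ (s - t) = circ s / circ t"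
  by (simp add: circ_def cis_divide right_diff_distrib)

lemma circ_of_int [simp]: "circ (of_int n) = 1"
  by (simp add: circ_def)

lemma circ_eq_1_iff: "circ t = 1 \<longleftrightarrow> t \<in> \<int>"
proof -
  have "circ t = 1 \<longleftrightarrow> (\<exists>n. 2 * pi * t = of_int n * (2 * pi))"
    by (simp add: circ_def cis_eq_1_iff)
  also have "\<dots> \<longleftrightarrow> (\<exists>n. t = of_int n)"
    by (simp add: mult.commute)
  finally show ?thesis
    by (auto simp: Ints_def)
qed

lemma circ_eq_iff: "circ s = circ t \<longleftrightarrow> s - t \<in> \<int>"
  using circ_eq_1_iff[of "s - t"] by (simp add: circ_diff)

lemma continuous_on_circ [continuous_intros]: "continuous_on S h \<Longrightarrow> continuous_on S (\<lambda>x. circ (h x))"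
  unfolding circ_def by (intro continuous_intros)

text \<open>Chord against arc: the chord is \<open>2 * \<bar>sin (pi * (s - t))\<bar>\<close>. It
  turns a lower bound for the distance of two values into a lower bound for the angle between
  them.\<close>

lemma norm_circ_diff_le: "norm (circ s - circ t) \<le> 2 * pi * \<bar>s - t\<bar>"
proof -
  have "circ s - circ t = circ t * (circ (s - t) - 1)"
    by (simp add: circ_diff right_diff_distrib)
  then have "norm (circ s - circ t) = norm (circ (s - t) - 1)"
    by (simp add: norm_mult)
  also have "\<dots> = 2 * \<bar>sin (pi * (s - t))\<bar>"
    using dist_exp_i_1[of "2 * pi * (s - t)"] by (simp add: circ_def cis_conv_exp)
  also have "\<dots> \<le> 2 * \<bar>pi * (s - t)\<bar>"
    using abs_sin_x_le_abs_x by (intro mult_left_mono) auto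
  finally show ?thesis
    by (simp add: abs_mult)
qed

lemma circ_surj: 
  assumes "norm z = 1" shows "\<exists>t. circ t = z"
proof -
  have "cis (Arg z) = z"
    using assms by (metis cis_Arg div_by_1 norm_eq_zero of_real_1 sgn_eq zero_neq_one)
  then have "circ (Arg z / (2 * pi)) = z"
    by (simp add: circ_def)
  then show ?thesis ..
qed

text \<open>An interval is contractible, so a nonvanishing function on it has a continuous
  logarithm; modulus \<open>1\<close> makes that logarithm purely imaginary.\<close>

lemma circle_lift_exists:
  fixes S :: "real set"
  assumes "is_interval S" "continuous_on S c" "\<And>t. t \<in> S \<Longrightarrow> norm (c t) = 1"
  obtains \<theta> where "continuous_on S \<theta>" "\<And>t. t \<in> S \<Longrightarrow> c t = circ (\<theta> t)"
proof -
  have "contractible S"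
    using assms(1) convex_imp_contractible is_interval_convex by blast
  moreover have "c t \<noteq> 0" if "t \<in> S" for t
    using assms(3)[OF that] by auto
  ultimately obtain g where g: "continuous_on S g" "\<And>t. t \<in> S \<Longrightarrow> c t = exp (g t)"
    using continuous_logarithm_on_contractible assms(2) by metis
  show thesis
  proof
    show "continuous_on S (\<lambda>t. Im (g t) / (2 * pi))"
      using g by (intro continuous_intros) auto
    fix t assume t: "t \<in> S"
    have "Re (g t) = 0"
      using assms(3)[OF t] g(2)[OF t] by (simp add: norm_exp_eq_Re)
    then show "c t = circ (Im (g t) / (2 * pi))"
      using g(2)[OF t] by (simp add: circ_def exp_eq_polar)
  qed
qed

text \<open>Distinct integers are at least \<open>1\<close> apart, so the range is discrete.\<close>

lemma continuous_Ints_constant: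
  fixes h :: "'a::topological_space \<Rightarrow> real"
  assumes "connected S" "continuous_on S h" "\<And>x. x \<in> S \<Longrightarrow> h x \<in> \<int>" "x \<in> S" "y \<in> S"
  shows "h x = h y"
proof -
  have "h constant_on S"
  proof (rule continuous_discrete_range_constant[OF assms(1,2)])
    fix x assume x: "x \<in> S"
    have "1 \<le> norm (h y - h x)" if "y \<in> S" "h y \<noteq> h x" for y
    proof -
      have "h y - h x \<in> \<int>" "h y - h x \<noteq> 0"
        using that x assms(3) by auto
      then show ?thesis
        by (simp add: Ints_nonzero_abs_ge1)
    qed
    then show "\<exists>e>0. \<forall>y. y \<in> S \<and> h y \<noteq> h x \<longrightarrow> e \<le> norm (h y - h x)"
      by (intro exI[of _ 1]) auto
  qed
  then show ?thesis
    using assms(4,5) by (auto simp: constant_on_def)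
qed

text \<open>Two lifts differ by a continuous integer-valued function. Increments are therefore
  independent of the lift, and this is how all winding numbers below are computed.\<close>

lemma circle_lift_unique:
  fixes \<theta> \<theta>' :: "'a::topological_space \<Rightarrow> real"
  assumes "connected S" "continuous_on S \<theta>" "continuous_on S \<theta>'"
    and "\<And>t. t \<in> S \<Longrightarrow> circ (\<theta> t) = circ (\<theta>' t)" "s \<in> S" "t \<in> S"
  shows "\<theta> t - \<theta> s = \<theta>' t - \<theta>' s"
proof -
  have "\<theta> s - \<theta>' s = \<theta> t - \<theta>' t"
    by (rule continuous_Ints_constant[where S = S])
       (use assms in \<open>auto simp: circ_eq_iff intro!: continuous_intros\<close>)
  then show ?thesis by simp
qed

section \<open>Directed graphs\<close>

locale digraph =
  fixes X :: "('a, 'e) graph"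
  assumes graph: "directed_graph X"
begin

lemma finite_verts: "finite (gverts X)"
  and finite_edges: "finite (gedges X)"
  and Hausdorff: "Hausdorff_space (gspace X)"
  using graph by (auto simp: directed_graph_def)

lemma param_continuous: "e \<in> gedges X \<Longrightarrow> continuous_map (top_of_set {0..1}) (gspace X) (gparam X e)"
  using graph by (auto simp: directed_graph_def)

lemma param_inj: "e \<in> gedges X \<Longrightarrow> inj_on (gparam X e) {0<..<1}"
  using graph by (auto simp: directed_graph_def)

lemma param_ends:
  "e \<in> gedges X \<Longrightarrow> gparam X e 0 \<in> gverts X" "e \<in> gedges X \<Longrightarrow> gparam X e 1 \<in> gverts X"
  using graph by (auto simp: directed_graph_def)

lemma param_in_verts_iff:
  assumes "e \<in> gedges X" "t \<in> {0..1}"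
  shows "gparam X e t \<in> gverts X \<longleftrightarrow> t = 0 \<or> t = 1"
proof -
  have "gparam X e ` {0<..<1} \<inter> gverts X = {}"
    using graph assms by (auto simp: directed_graph_def)
  then have "gparam X e t \<notin> gverts X" if "t \<in> {0<..<1}"
    using that by blast
  then show ?thesis
    using assms param_ends by fastforce
qed

lemma param_in_topspace:
  assumes "e \<in> gedges X" "t \<in> {0..1}"
  shows "gparam X e t \<in> topspace (gspace X)"
  using param_continuous[OF assms(1)] assms(2) by (auto simp: continuous_map_def)

lemma edge_into:
  assumes "v \<in> gverts X" obtains e where "e \<in> gedges X" "gparam X e 1 = v"
  using graph assms by (auto simp: directed_graph_def)

lemma edge_out_of:
  assumes "v \<in> gverts X" obtains e where "e \<in> gedges X" "gparam X e 0 = v"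
  using graph assms by (auto simp: directed_graph_def)

lemma verts_subset: "gverts X \<subseteq> topspace (gspace X)"
  using graph by (auto simp: directed_graph_def)

text \<open>Nondegeneracy puts every vertex at the end of some edge, so the parameterized edges
  alone cover the graph.\<close>

lemma topspace_cases:
  assumes "x \<in> topspace (gspace X)"
  obtains e t where "e \<in> gedges X" "t \<in> {0..1}" "x = gparam X e t"
proof -
  have "x \<in> gverts X \<union> (\<Union>e \<in> gedges X. gparam X e ` {0..1})"
    using graph assms by (auto simp: directed_graph_def)
  then consider "x \<in> gverts X" | e t where "e \<in> gedges X" "t \<in> {0..1}" "x = gparam X e t"
    by blast
  then show thesis
  proof cases
    case 1
    then obtain e where "e \<in> gedges X" "gparam X e 1 = x"
      by (rule edge_into)
    then show thesis
      using that[of e 1] by simp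
  qed (rule that)
qed

lemma topspace_eq_edges: "topspace (gspace X) = (\<Union>e \<in> gedges X. gparam X e ` {0..1})"
proof (intro equalityI subsetI)
  fix x assume "x \<in> topspace (gspace X)"
  then obtain e t where "e \<in> gedges X" "t \<in> {0..1}" "x = gparam X e t"
    by (rule topspace_cases)
  then show "x \<in> (\<Union>e \<in> gedges X. gparam X e ` {0..1})"
    by blast
qed (use param_in_topspace in blast)

lemma non_vertex_cases:
  assumes "x \<in> topspace (gspace X)" "x \<notin> gverts X"
  obtains e t where "e \<in> gedges X" "t \<in> {0<..<1}" "x = gparam X e t"
proof -
  obtain e t where *: "e \<in> gedges X" "t \<in> {0..1}" "x = gparam X e t"
    using topspace_cases assms by metis
  then have "t \<noteq> 0" "t \<noteq> 1"
    using assms param_ends by blast+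
  then have "t \<in> {0<..<1}"
    using *(2) by simp
  then show thesis
    using * that by blast
qed

lemma param_eqD:
  assumes "e \<in> gedges X" "e' \<in> gedges X" "s \<in> {0..1}" "t \<in> {0..1}" "gparam X e s = gparam X e' t"
  shows "e = e' \<and> s = t \<or> s \<in> {0, 1} \<and> t \<in> {0, 1}"
proof (cases "gparam X e s \<in> gverts X")
  case True
  then show ?thesis
    using param_in_verts_iff[OF assms(1,3)] param_in_verts_iff[OF assms(2,4)] assms(5) by auto
next
  case False
  have "s \<noteq> 0" "s \<noteq> 1" "t \<noteq> 0" "t \<noteq> 1"
    using False param_in_verts_iff[OF assms(1,3)] param_in_verts_iff[OF assms(2,4)] assms(5) by auto
  then have st: "s \<in> {0<..<1}" "t \<in> {0<..<1}"
    using assms(3,4) by auto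
  have "e = e'"
  proof (rule ccontr)
    assume "e \<noteq> e'"
    then have "gparam X e ` {0<..<1} \<inter> gparam X e' ` {0<..<1} = {}"
      using graph assms by (auto simp: directed_graph_def)
    then show False
      using st assms(5) by (metis IntI empty_iff image_eqI)
  qed
  then show ?thesis
    using st assms param_inj by (meson inj_onD)
qed

lemma interior_eqD:
  assumes "e \<in> gedges X" "e' \<in> gedges X" "s \<in> {0<..<1}" "t \<in> {0..1}" "gparam X e s = gparam X e' t"
  shows "e = e'" "s = t"
  using param_eqD[of e e' s t] assms by auto

lemma image_interior_edge:
  assumes "e \<in> gedges X" "x \<notin> gverts X"
  shows "x \<in> gparam X e ` {0<..<1} \<longleftrightarrow> x \<in> gparam X e ` {0..1}"
proof
  assume "x \<in> gparam X e ` {0..1}"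
  then obtain t where t: "t \<in> {0..1}" "x = gparam X e t"
    by blast
  then have "t \<noteq> 0" "t \<noteq> 1"
    using assms param_in_verts_iff[OF assms(1) t(1)] by auto
  then have "t \<in> {0<..<1}"
    using t(1) by simp
  then show "x \<in> gparam X e ` {0<..<1}"
    using t(2) by blast
qed auto

lemma edge_image_closed:
  assumes "e \<in> gedges X" "closed C" "C \<subseteq> {0..1}"
  shows "closedin (gspace X) (gparam X e ` C)"
proof -
  have "compactin (top_of_set {0..1}) C"
    using assms(2,3) by (metis bounded_closed_interval bounded_subset compact_eq_bounded_closed
        compactin_euclidean_iff compactin_subtopology)
  then have "compactin (gspace X) (gparam X e ` C)"
    using image_compactin param_continuous assms(1) by blast
  then show ?thesis
    using Hausdorff compactin_imp_closedin by blast
qed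

text \<open>A graph carries the quotient topology of its finitely many closed edges: the preimage of
  a closed set is a finite union of edge images of closed sets, each of them compact in a Hausdorff
  space.\<close>

lemma continuous_map_edgesI:
  assumes "\<And>e. e \<in> gedges X \<Longrightarrow> continuous_map (top_of_set {0..1}) Z (\<lambda>t. h (gparam X e t))"
  shows "continuous_map (gspace X) Z h"
  unfolding continuous_map_closedin
proof (intro conjI funcsetI allI impI)
  fix x assume "x \<in> topspace (gspace X)"
  then obtain e t where *: "e \<in> gedges X" "t \<in> {0..1}" "x = gparam X e t"
    by (rule topspace_cases)
  show "h x \<in> topspace Z"
    using continuous_map_image_subset_topspace[OF assms[OF *(1)]] *(2,3) by auto
next
  fix C assume C: "closedin Z C"
  let ?T = "\<lambda>e. {t \<in> {0..1}. h (gparam X e t) \<in> C}"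
  have "closed (?T e)" if "e \<in> gedges X" for e
  proof -
    have "closedin (top_of_set {0..1}) (?T e)"
      using closedin_continuous_map_preimage[OF assms[OF that] C] by simp
    then show ?thesis
      by (simp add: closedin_closed_eq)
  qed
  then have "closedin (gspace X) (\<Union>e \<in> gedges X. gparam X e ` ?T e)"
    using finite_edges by (intro closedin_Union) (auto intro: edge_image_closed)
  moreover have "{x \<in> topspace (gspace X). h x \<in> C} = (\<Union>e \<in> gedges X. gparam X e ` ?T e)"
    unfolding topspace_eq_edges by blast
  ultimately show "closedin (gspace X) {x \<in> topspace (gspace X). h x \<in> C}"
    by simp
qed

text \<open>By \<open>param_eqD\<close> a point has several descriptions only at a vertex, and there
  \<open>c\<close> forces all of them to give one value.\<close>

lemma glue_edges:
  assumes "\<And>e. e \<in> gedges X \<Longrightarrow> F e 0 = c (gparam X e 0)"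
    and "\<And>e. e \<in> gedges X \<Longrightarrow> F e 1 = c (gparam X e 1)"
  obtains h where "\<And>e t. e \<in> gedges X \<Longrightarrow> t \<in> {0..1} \<Longrightarrow> h (gparam X e t) = F e (t::real)"
proof
  let ?P = "\<lambda>x p. fst p \<in> gedges X \<and> snd p \<in> {0..1} \<and> x = gparam X (fst p) (snd p)"
  let ?h = "\<lambda>x. let p = SOME p. ?P x p in F (fst p) (snd p)"
  fix e :: 'e and t :: real assume et: "e \<in> gedges X" "t \<in> {0..1}"
  define p where "p = (SOME p. ?P (gparam X e t) p)"
  have p: "?P (gparam X e t) p"
    unfolding p_def by (rule someI[of _ "(e, t)"]) (use et in simp)
  have "e = fst p \<and> t = snd p \<or> t \<in> {0, 1} \<and> snd p \<in> {0, 1}"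
    using param_eqD[of e "fst p" t "snd p"] et p by blast
  then have "F (fst p) (snd p) = F e t"
    using et p assms by auto
  then show "?h (gparam X e t) = F e t"
    by (simp add: p_def Let_def)
qed

lemma compact: "compact_space (gspace X)"
proof -
  have "compactin (gspace X) (\<Union>e \<in> gedges X. gparam X e ` {0..1})"
    using finite_edges param_continuous
    by (intro compactin_Union)
       (auto intro!: image_compactin[of "top_of_set {0..1}"] simp: compactin_subtopology)
  then show ?thesis
    by (simp add: compact_space_def topspace_eq_edges)
qed

text \<open>The complement consists of the finite vertex set and the finitely many other closed
  edges.\<close>

lemma openin_open_edge:
  assumes e: "e \<in> gedges X"
  shows "openin (gspace X) (gparam X e ` {0<..<1})"
proof -
  let ?C = "gverts X \<union> (\<Union>e' \<in> gedges X - {e}. gparam X e' ` {0..1})"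
  have "closedin (gspace X) (gverts X)"
    using Hausdorff finite_verts verts_subset
    by (meson Hausdorff_imp_t1_space t1_space_closedin_finite)
  moreover have "closedin (gspace X) (\<Union>e' \<in> gedges X - {e}. gparam X e' ` {0..1})"
    using finite_edges by (intro closedin_Union) (auto intro: edge_image_closed)
  ultimately have "closedin (gspace X) ?C"
    by blast
  moreover have "gparam X e ` {0<..<1} = topspace (gspace X) - ?C"
  proof (intro equalityI subsetI)
    fix x assume "x \<in> gparam X e ` {0<..<1}"
    then obtain t where t: "t \<in> {0<..<1}" "x = gparam X e t" by auto
    then have "t \<in> {0..1}" "t \<noteq> 0" "t \<noteq> 1" by simp_all
    then have "x \<in> topspace (gspace X)" "x \<notin> gverts X"
      unfolding t(2) by (simp_all only: e param_in_topspace param_in_verts_iff simp_thms)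
    moreover have "x \<notin> gparam X e' ` {0..1}" if "e' \<in> gedges X" "e' \<noteq> e" for e'
    proof
      assume "x \<in> gparam X e' ` {0..1}"
      then obtain s where "s \<in> {0..1}" "gparam X e t = gparam X e' s"
        using t(2) by auto
      then show False
        using interior_eqD(1)[OF e that(1) t(1)] that(2) by blast
    qed
    ultimately show "x \<in> topspace (gspace X) - ?C"
      by blast
  next
    fix x assume x: "x \<in> topspace (gspace X) - ?C"
    then have "x \<in> topspace (gspace X)" "x \<notin> gverts X"
      by auto
    then obtain e' t where *: "e' \<in> gedges X" "t \<in> {0<..<1}" "x = gparam X e' t"
      by (rule non_vertex_cases)
    moreover have "t \<in> {0..1}"
      using *(2) by simp
    ultimately have "x \<in> gparam X e' ` {0..1}"
      by blast
    then have "e' = e"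
      using x *(1) by blast
    then show "x \<in> gparam X e ` {0<..<1}"
      using * by blast
  qed
  ultimately show ?thesis
    by (metis openin_diff openin_topspace)
qed

lemma inv_param:
  "e \<in> gedges X \<Longrightarrow> t \<in> {0<..<1} \<Longrightarrow> inv_into {0<..<1} (gparam X e) (gparam X e t) = t"
  by (simp add: inv_into_f_f param_inj)

text \<open>For a point of the open edge, having its parameter in \<open>C\<close> is the same as
  lying on the edge image of \<open>C \<inter> {0..1}\<close>, which is closed.\<close>

lemma inv_param_continuous:
  assumes e: "e \<in> gedges X" and q: "continuous_map (top_of_set J) (gspace X) q"
    and qJ: "q ` J \<subseteq> gparam X e ` {0<..<1}"
  shows "continuous_on J (inv_into {0<..<1} (gparam X e) \<circ> q)"
proof -
  have "closedin (top_of_set J) {t \<in> J. (inv_into {0<..<1} (gparam X e) \<circ> q) t \<in> C}" if "closed C" for C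
  proof -
    have "closedin (gspace X) (gparam X e ` (C \<inter> {0..1}))"
      using edge_image_closed[OF e, of "C \<inter> {0..1}"] that by (simp add: closed_Int)
    then have "closedin (top_of_set J) {t \<in> J. q t \<in> gparam X e ` (C \<inter> {0..1})}"
      using closedin_continuous_map_preimage[OF q] by simp
    moreover have iff: "q t \<in> gparam X e ` (C \<inter> {0..1}) \<longleftrightarrow> (inv_into {0<..<1} (gparam X e) \<circ> q) t \<in> C"
      if t: "t \<in> J" for t
    proof -
      obtain s where s: "s \<in> {0<..<1}" "q t = gparam X e s"
        using qJ t by blast
      have "q t \<in> gparam X e ` (C \<inter> {0..1}) \<longleftrightarrow> s \<in> C"
      proof
        assume "q t \<in> gparam X e ` (C \<inter> {0..1})"
        then obtain r where "r \<in> C" "r \<in> {0..1}" "gparam X e s = gparam X e r"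
          using s by auto
        then show "s \<in> C"
          using interior_eqD(2)[OF e e s(1)] by blast
      qed (use s in auto)
      then show ?thesis
        using s e by (simp add: inv_param)
    qed
    have "{t \<in> J. q t \<in> gparam X e ` (C \<inter> {0..1})} =
        {t \<in> J. (inv_into {0<..<1} (gparam X e) \<circ> q) t \<in> C}"
      using iff by blast
    ultimately show ?thesis
      by simp
  qed
  then have "continuous_map (top_of_set J) euclidean (inv_into {0<..<1} (gparam X e) \<circ> q)"
    unfolding continuous_map_closedin by simp
  then show ?thesis by simp
qed

text \<open>Off the vertices an open edge and its closed edge have the same points, so the set of
  times spent in it is clopen.\<close>

lemma connected_avoiding_verts:
  assumes "connected J" "J \<noteq> {}" "continuous_map (top_of_set J) (gspace X) q" "q ` J \<inter> gverts X = {}"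
  obtains e where "e \<in> gedges X" "q ` J \<subseteq> gparam X e ` {0<..<1}"
proof -
  obtain t0 where t0: "t0 \<in> J" using assms by blast
  have qtop: "q t \<in> topspace (gspace X)" if "t \<in> J" for t
    using assms(3) that by (auto simp: continuous_map_def)
  then obtain e s where e: "e \<in> gedges X" "s \<in> {0<..<1}" "q t0 = gparam X e s"
    using non_vertex_cases t0 assms(4) by (metis IntI empty_iff image_eqI)
  let ?A = "{t \<in> J. q t \<in> gparam X e ` {0<..<1}}"
  have "q t \<in> gparam X e ` {0<..<1} \<longleftrightarrow> q t \<in> gparam X e ` {0..1}" if "t \<in> J" for t
    using that assms(4) e(1) image_interior_edge[of e "q t"] by blast
  then have "?A = {t \<in> J. q t \<in> gparam X e ` {0..1}}"
    by blast
  moreover have "closedin (top_of_set J) {t \<in> J. q t \<in> gparam X e ` {0..1}}"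
    using closedin_continuous_map_preimage[OF assms(3) edge_image_closed[OF e(1)]] by simp
  moreover have "openin (top_of_set J) ?A"
    using openin_continuous_map_preimage[OF assms(3) openin_open_edge[OF e(1)]] by simp
  ultimately have "?A = {} \<or> ?A = J"
    using assms(1) unfolding connected_clopen by presburger
  then have "?A = J"
    using t0 e by auto
  then have "q ` J \<subseteq> gparam X e ` {0<..<1}"
    by blast
  then show thesis
    using that e(1) by blast
qed

text \<open>Finite sets are closed in a Hausdorff space, so a finite range cuts \<open>J\<close>
  into clopen pieces. This excludes that a locally injective path moves while its lift stands
  still.\<close>

lemma finite_range_constant:
  assumes "connected J" "continuous_map (top_of_set J) (gspace X) q" "finite (q ` J)" "s \<in> J" "t \<in> J"
  shows "q s = q t"
proof -
  have clo: "closedin (top_of_set J) {r \<in> J. q r \<in> A}" if "A \<subseteq> q ` J" for A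
  proof -
    have "A \<subseteq> topspace (gspace X)"
      using that assms(2) by (auto simp: continuous_map_def)
    then have "closedin (gspace X) A"
      using Hausdorff finite_subset[OF that assms(3)]
      by (meson Hausdorff_imp_t1_space t1_space_closedin_finite)
    then show ?thesis
      using closedin_continuous_map_preimage[OF assms(2)] by simp
  qed
  have "{r \<in> J. q r = q s} = J - {r \<in> J. q r \<in> q ` J - {q s}}"
    by blast
  then have "openin (top_of_set J) {r \<in> J. q r = q s}"
    using clo[of "q ` J - {q s}"] by (simp add: openin_diff)
  moreover have "closedin (top_of_set J) {r \<in> J. q r = q s}"
    using clo[of "{q s}"] assms(4) by simp
  ultimately have "{r \<in> J. q r = q s} = {} \<or> {r \<in> J. q r = q s} = J"
    using assms(1) unfolding connected_clopen by presburger
  then have "{r \<in> J. q r = q s} = J"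
    using assms(4) by blast
  then have "t \<in> {r \<in> J. q r = q s}"
    using assms(5) by simp
  then show ?thesis
    by simp
qed

text \<open>The edge and the parameter of a point are ambiguous only at vertices, where integrality
  of \<open>g\<close> gives the value \<open>1\<close> for each choice; so the definite description
  is meaningful.\<close>

lemma edge_circle_map_param:
  assumes "e \<in> gedges X" "t \<in> {0..1}"
  shows "edge_circle_map X g (gparam X e t) = circ (t * of_int (g e))"
  unfolding edge_circle_map_def
proof (rule the_equality)
  show "\<exists>e' \<in> gedges X. \<exists>t' \<in> {0..1}. gparam X e t = gparam X e' t' \<and>
      circ (t * of_int (g e)) = cis (2 * pi * t' * of_int (g e'))"
    using assms by (intro bexI[of _ e] bexI[of _ t]) (auto simp: circ_def mult.assoc)
  fix z assume "\<exists>e' \<in> gedges X. \<exists>t' \<in> {0..1}. gparam X e t = gparam X e' t' \<and>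
      z = cis (2 * pi * t' * of_int (g e'))"
  then obtain e' t' where *: "e' \<in> gedges X" "t' \<in> {0..1}" "gparam X e t = gparam X e' t'"
      "z = circ (t' * of_int (g e'))"
    unfolding circ_def mult.assoc by blast
  then show "z = circ (t * of_int (g e))"
    using param_eqD[OF assms(1) *(1) assms(2) *(2,3)] by (elim disjE) auto
qed

lemma edge_circle_map_vertex:
  assumes "v \<in> gverts X" shows "edge_circle_map X g v = 1"
proof -
  obtain e where "e \<in> gedges X" "gparam X e 1 = v"
    using assms by (rule edge_into)
  then show ?thesis
    using edge_circle_map_param[of e 1 g] by simp
qed

lemma norm_edge_circle_map:
  assumes "x \<in> topspace (gspace X)" shows "norm (edge_circle_map X g x) = 1"
proof -
  obtain e t where "e \<in> gedges X" "t \<in> {0..1}" "x = gparam X e t"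
    using assms by (rule topspace_cases)
  then show ?thesis
    by (simp add: edge_circle_map_param)
qed

lemma edge_circle_map_continuous: "continuous_map (gspace X) euclidean (edge_circle_map X g)"
proof (rule continuous_map_edgesI)
  fix e assume "e \<in> gedges X"
  then have "continuous_on {0..1} (\<lambda>t. edge_circle_map X g (gparam X e t)) \<longleftrightarrow>
      continuous_on {0..1} (\<lambda>t. circ (t * of_int (g e)))"
    by (intro continuous_on_cong refl) (simp add: edge_circle_map_param)
  moreover have "continuous_on {0..1} (\<lambda>t. circ (t * of_int (g e)))"
    by (intro continuous_intros)
  ultimately show "continuous_map (top_of_set {0..1}) euclidean (\<lambda>t. edge_circle_map X g (gparam X e t))"
    by simp
qed

lemma edge_circle_map_add:
  assumes "x \<in> topspace (gspace X)" "\<And>e. e \<in> gedges X \<Longrightarrow> k e = g e + h e"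
  shows "edge_circle_map X k x = edge_circle_map X g x * edge_circle_map X h x"
proof -
  obtain e t where "e \<in> gedges X" "t \<in> {0..1}" "x = gparam X e t"
    using assms(1) by (rule topspace_cases)
  then show ?thesis
    by (simp add: edge_circle_map_param assms(2) circ_add distrib_left)
qed

end

section \<open>Orientation preserving paths\<close>

text \<open>If \<open>\<theta>\<close> decreased, it would take some value outside \<open>N\<close> for a last time, which the local
  hypothesis forbids.\<close>

lemma mono_on_if_locally_nondecreasing:
  fixes \<theta> :: "real \<Rightarrow> real"
  assumes "countable N" "is_interval I" "continuous_on I \<theta>"
    and loc: "\<And>r. r \<in> I \<Longrightarrow> \<theta> r \<notin> N \<Longrightarrow> \<exists>d>0. \<forall>u \<in> I. r \<le> u \<and> u < r + d \<longrightarrow> \<theta> r \<le> \<theta> u"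
  shows "mono_on I \<theta>"
proof (rule ccontr)
  assume "\<not> mono_on I \<theta>"
  then obtain s t where st: "s \<in> I" "t \<in> I" "s \<le> t" "\<theta> t < \<theta> s"
    by (auto simp: mono_on_def not_le)
  have sub: "{s..t} \<subseteq> I"
    using assms(2) st by (meson atLeastAtMost_iff mem_is_interval_1_I subsetI)
  have "\<not> {\<theta> t<..<\<theta> s} \<subseteq> N"
    using assms(1) st(4) uncountable_open_interval countable_subset by blast
  then obtain c where c: "\<theta> t < c" "c < \<theta> s" "c \<notin> N"
    using greaterThanLessThan_iff by blast
  define S where "S = {r \<in> {s..t}. c \<le> \<theta> r}"
  have "closed S"
    unfolding S_def using continuous_on_subset[OF assms(3) sub]
    by (intro continuous_on_closed_Collect_le continuous_intros) auto
  moreover have "bounded S"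
    by (rule bounded_subset[of "{s..t}"]) (auto simp: S_def)
  ultimately have "compact S"
    by (simp add: compact_eq_bounded_closed)
  moreover have "s \<in> S"
    using st c by (simp add: S_def)
  ultimately obtain r where r: "r \<in> S" "\<And>u. u \<in> S \<Longrightarrow> u \<le> r"
    using compact_attains_sup[of S] by blast
  then have rst: "s \<le> r" "r < t" "c \<le> \<theta> r" "r \<in> I"
    using c sub unfolding S_def by (auto simp: less_le)
  have "continuous_on {r..t} \<theta>"
    using assms(3) by (rule continuous_on_subset) (use rst sub in auto)
  then obtain u where u: "r \<le> u" "u \<le> t" "\<theta> u = c"
    using IVT2'[of \<theta> t c r] c rst by auto
  then have "u \<le> r"
    by (intro r(2)) (use rst in \<open>auto simp: S_def\<close>)
  then have "\<theta> r = c"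
    using u by simp
  then obtain d where d: "d > 0" "\<And>u. u \<in> I \<Longrightarrow> r \<le> u \<Longrightarrow> u < r + d \<Longrightarrow> \<theta> r \<le> \<theta> u"
    using loc[OF rst(4)] c by blast
  define u where "u = min t (r + d / 2)"
  have u: "r < u" "u \<le> t" "u < r + d"
    using d rst by (auto simp: u_def min_def)
  then have "u \<in> I"
    using sub rst by auto
  then have "c \<le> \<theta> u"
    using d(2)[of u] u \<open>\<theta> r = c\<close> by simp
  then have "u \<in> S"
    using u rst by (simp add: S_def)
  then show False
    using r(2) u by force
qed

context digraph
begin

lemma path_stays_in_open_edge:
  fixes I :: "real set"
  assumes q: "continuous_map (top_of_set I) (gspace X) q" and r: "r \<in> I" "q r \<notin> gverts X"
  obtains e d where "e \<in> gedges X" "d > 0"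
    "\<And>u. u \<in> I \<Longrightarrow> \<bar>u - r\<bar> < d \<Longrightarrow> q u \<in> gparam X e ` {0<..<1}"
proof -
  have "q r \<in> topspace (gspace X)"
    using q r by (auto simp: continuous_map_def)
  then obtain e s where e: "e \<in> gedges X" "s \<in> {0<..<1}" "q r = gparam X e s"
    using r(2) by (rule non_vertex_cases)
  have "openin (top_of_set I) {u \<in> I. q u \<in> gparam X e ` {0<..<1}}"
    using openin_continuous_map_preimage[OF q openin_open_edge[OF e(1)]] by simp
  then obtain d where d: "d > 0" "\<And>u. u \<in> I \<Longrightarrow> dist u r < d \<Longrightarrow> u \<in> {u \<in> I. q u \<in> gparam X e ` {0<..<1}}"
    using e r(1) unfolding openin_euclidean_subtopology_iff by (metis (mono_tags, lifting) image_eqI mem_Collect_eq)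
  show thesis
    using that[OF e(1) d(1)] d(2) by (simp add: dist_real_def)
qed

text \<open>At a vertex the lift is an integer. Off the countably many integer levels the path is
  inside an open edge, where its parameter increases and the lift is \<open>g e \<ge> 0\<close>
  times that parameter up to a constant. So no control at the vertices is required.\<close>

lemma op_path_lift_mono:
  assumes g: "\<And>e. e \<in> gedges X \<Longrightarrow> 0 \<le> g e"
    and I: "is_interval I" and q: "graph_op_path X I q"
    and \<theta>: "continuous_on I \<theta>" "\<And>t. t \<in> I \<Longrightarrow> edge_circle_map X g (q t) = circ (\<theta> t)"
  shows "mono_on I \<theta>"
proof (rule mono_on_if_locally_nondecreasing[OF _ I \<theta>(1)])
  show "countable (\<int> :: real set)"
    by (simp add: Ints_def)
  fix r assume r: "r \<in> I" "\<theta> r \<notin> \<int>"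
  then have "q r \<notin> gverts X"
    using \<theta>(2)[OF r(1)] edge_circle_map_vertex[of "q r" g] by (auto simp: circ_eq_1_iff)
  moreover have qc: "continuous_map (top_of_set I) (gspace X) q"
    using q by (simp add: graph_op_path_def)
  ultimately obtain e d where e: "e \<in> gedges X" "d > 0"
      "\<And>u. u \<in> I \<Longrightarrow> \<bar>u - r\<bar> < d \<Longrightarrow> q u \<in> gparam X e ` {0<..<1}"
    using r(1) path_stays_in_open_edge by metis
  have "\<theta> r \<le> \<theta> u" if u: "u \<in> I" "r \<le> u" "u < r + d" for u
  proof -
    define J where "J = {r..u}"
    define \<tau> where "\<tau> = inv_into {0<..<1} (gparam X e) \<circ> q"
    have JI: "J \<subseteq> I"
      unfolding J_def using I r(1) u(1) by (meson atLeastAtMost_iff mem_is_interval_1_I subsetI)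
    have qJ: "q ` J \<subseteq> gparam X e ` {0<..<1}"
      using e(3) JI u by (auto simp: J_def)
    have "mono_on J \<tau>"
      using q e(1) JI qJ unfolding graph_op_path_def \<tau>_def J_def by (meson is_interval_cc)
    then have "\<tau> r \<le> \<tau> u"
      using u by (auto simp: mono_on_def J_def)
    moreover have "\<theta> u - \<theta> r = \<tau> u * of_int (g e) - \<tau> r * of_int (g e)"
    proof (rule circle_lift_unique)
      show "connected J"
        by (simp add: J_def)
      show "continuous_on J \<theta>"
        using \<theta>(1) JI by (rule continuous_on_subset)
      have "continuous_on J \<tau>"
        unfolding \<tau>_def using e(1) qc qJ JI
        by (intro inv_param_continuous) (auto intro: continuous_map_from_subtopology_mono)
      then show "continuous_on J (\<lambda>t. \<tau> t * of_int (g e))"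
        by (intro continuous_intros)
      fix t assume t: "t \<in> J"
      then obtain s where s: "s \<in> {0<..<1}" "q t = gparam X e s"
        using qJ by blast
      then have "\<tau> t = s"
        by (simp add: \<tau>_def inv_param e(1))
      then show "circ (\<theta> t) = circ (\<tau> t * of_int (g e))"
        using \<theta>(2)[of t] t JI s e(1) edge_circle_map_param[of e s g] by auto
    qed (use u in \<open>auto simp: J_def\<close>)
    ultimately show ?thesis
      using g[OF e(1)] by (metis diff_ge_0_iff_ge mult_right_mono of_int_0_le_iff)
  qed
  then show "\<exists>d>0. \<forall>u \<in> I. r \<le> u \<and> u < r + d \<longrightarrow> \<theta> r \<le> \<theta> u"
    using e(2) by blast
qed

lemma path_lift_exists:
  fixes I :: "real set"
  assumes "is_interval I" "continuous_map (top_of_set I) (gspace X) q"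
  obtains \<theta> where "continuous_on I \<theta>" "\<And>t. t \<in> I \<Longrightarrow> edge_circle_map X g (q t) = circ (\<theta> t)"
proof -
  have cont: "continuous_on I (edge_circle_map X g \<circ> q)"
    using continuous_map_compose[OF assms(2) edge_circle_map_continuous] by simp
  have nrm: "norm ((edge_circle_map X g \<circ> q) t) = 1" if "t \<in> I" for t
  proof -
    have "q t \<in> topspace (gspace X)"
      using continuous_map_image_subset_topspace[OF assms(2)] that by auto
    then show ?thesis
      by (simp add: norm_edge_circle_map)
  qed
  from circle_lift_exists[OF assms(1) cont nrm] obtain \<theta> where
    \<theta>: "continuous_on I \<theta>" "\<And>t. t \<in> I \<Longrightarrow> (edge_circle_map X g \<circ> q) t = circ (\<theta> t)"
    by metis
  show thesis
    by (rule that[OF \<theta>(1)]) (use \<theta>(2) in simp)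
qed

text \<open>On one traversed edge \<open>\<theta>\<close> and \<open>\<tau>\<close> times
  \<open>g e\<close> lift the same circle-valued function, so their increments agree.\<close>

lemma traverses_lift_piece:
  fixes a b :: real
  assumes piece: "continuous_on {a..b} \<tau>" "\<tau> a = 0" "\<tau> b = 1" "mono_on {a..b} \<tau>"
      "\<And>s. s \<in> {a..b} \<Longrightarrow> p s = gparam X e (\<tau> s)"
    and e: "e \<in> gedges X" and "a \<le> b"
    and \<theta>: "continuous_on {a..b} \<theta>" "\<And>s. s \<in> {a..b} \<Longrightarrow> edge_circle_map X g (p s) = circ (\<theta> s)"
    and s: "s \<in> {a..b}"
  shows "\<theta> s - \<theta> a = \<tau> s * of_int (g e)"
proof -
  have "\<theta> s - \<theta> a = \<tau> s * of_int (g e) - \<tau> a * of_int (g e)"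
  proof (rule circle_lift_unique)
    fix t assume t: "t \<in> {a..b}"
    have "\<tau> a \<le> \<tau> t" "\<tau> t \<le> \<tau> b"
      using t \<open>a \<le> b\<close> mono_onD[OF piece(4), of a t] mono_onD[OF piece(4), of t b] by simp_all
    then show "circ (\<theta> t) = circ (\<tau> t * of_int (g e))"
      using \<theta>(2)[OF t] piece(5)[OF t] e by (simp add: edge_circle_map_param piece(2,3))
  next
    show "continuous_on {a..b} (\<lambda>t. \<tau> t * of_int (g e))"
      using piece(1) by (intro continuous_intros)
  qed (use \<open>a \<le> b\<close> s \<theta>(1) in simp_all)
  then show ?thesis
    using piece(2) by simp
qed

lemma increasing_steps_le:
  fixes ts :: "nat \<Rightarrow> real"
  assumes "\<And>i. i < n \<Longrightarrow> ts i < ts (Suc i)" "i \<le> j" "j \<le> n"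
  shows "ts i \<le> ts j"
  using assms(2,3)
proof (induction j rule: dec_induct)
  case (step k)
  then show ?case
    using assms(1)[of k] by simp
qed simp

lemma traversesE:
  assumes "traverses X p es"
  obtains ts :: "nat \<Rightarrow> real" where "set es \<subseteq> gedges X" "ts 0 = 0" "ts (length es) = 1"
    "\<And>i. i < length es \<Longrightarrow> ts i < ts (Suc i)"
    "\<And>i. i \<le> length es \<Longrightarrow> ts i \<in> {0..1}"
    "\<And>i. i < length es \<Longrightarrow> \<exists>\<tau>. continuous_on {ts i..ts (Suc i)} \<tau> \<and>
       strict_mono_on {ts i..ts (Suc i)} \<tau> \<and> \<tau> (ts i) = 0 \<and> \<tau> (ts (Suc i)) = 1 \<and>
       (\<forall>s \<in> {ts i..ts (Suc i)}. p s = gparam X (es ! i) (\<tau> s))"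
proof -
  obtain ts :: "nat \<Rightarrow> real" where ts: "ts 0 = 0" "ts (length es) = 1"
      "\<And>i. i < length es \<Longrightarrow> ts i < ts (Suc i)"
    and ex: "\<And>i. i < length es \<Longrightarrow> \<exists>\<tau>. continuous_on {ts i..ts (Suc i)} \<tau> \<and>
           strict_mono_on {ts i..ts (Suc i)} \<tau> \<and> \<tau> (ts i) = 0 \<and> \<tau> (ts (Suc i)) = 1 \<and>
                (\<forall>s \<in> {ts i..ts (Suc i)}. p s = gparam X (es ! i) (\<tau> s))"
    and es: "set es \<subseteq> gedges X"
    using assms(1) unfolding traverses_def by blast
  have "ts i \<in> {0..1}" if "i \<le> length es" for i
    using increasing_steps_le[of "length es" ts 0 i] increasing_steps_le[of "length es" ts i "length es"] ts(3)
      ts(1,2) that by simp_all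
  then show thesis
    using that[OF es ts _ ex] by blast
qed

text \<open>Each piece contributes the value of \<open>g\<close> on its edge, and the increments
  telescope: the sum over an edge word is a winding number.\<close>

lemma traverses_lift:
  assumes "traverses X p es"
    and \<theta>: "continuous_on {0..1} \<theta>" "\<And>s. s \<in> {0..1} \<Longrightarrow> edge_circle_map X g (p s) = circ (\<theta> s)"
  shows "\<theta> 1 - \<theta> 0 = of_int (sum_list (map g es))"
proof -
  obtain ts where es: "set es \<subseteq> gedges X" and ts: "ts 0 = 0" "ts (length es) = 1"
      "\<And>i. i < length es \<Longrightarrow> ts i < ts (Suc i)"
      "\<And>i. i \<le> length es \<Longrightarrow> ts i \<in> {0..1}"
    and ex: "\<And>i. i < length es \<Longrightarrow> \<exists>\<tau>. continuous_on {ts i..ts (Suc i)} \<tau> \<and>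
       strict_mono_on {ts i..ts (Suc i)} \<tau> \<and> \<tau> (ts i) = 0 \<and> \<tau> (ts (Suc i)) = 1 \<and>
       (\<forall>s \<in> {ts i..ts (Suc i)}. p s = gparam X (es ! i) (\<tau> s))"
    using traversesE[OF assms(1)] by blast
  have step: "\<theta> (ts (Suc i)) - \<theta> (ts i) = of_int (g (es ! i))" if i: "i < length es" for i
  proof -
    obtain \<tau> where \<tau>: "continuous_on {ts i..ts (Suc i)} \<tau>" "strict_mono_on {ts i..ts (Suc i)} \<tau>"
        "\<tau> (ts i) = 0" "\<tau> (ts (Suc i)) = 1"
        "\<And>s. s \<in> {ts i..ts (Suc i)} \<Longrightarrow> p s = gparam X (es ! i) (\<tau> s)"
      using ex[OF i] by blast
    have sub: "{ts i..ts (Suc i)} \<subseteq> {0..1}"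
      using ts(4)[of i] ts(4)[of "Suc i"] i by auto
    have "\<theta> (ts (Suc i)) - \<theta> (ts i) = \<tau> (ts (Suc i)) * of_int (g (es ! i))"
    proof (rule traverses_lift_piece[OF \<tau>(1,3,4) _ \<tau>(5)])
      show "mono_on {ts i..ts (Suc i)} \<tau>"
        using \<tau>(2) by (rule strict_mono_on_imp_mono_on)
      show "continuous_on {ts i..ts (Suc i)} \<theta>"
        using \<theta>(1) sub by (rule continuous_on_subset)
      show "es ! i \<in> gedges X"
        using es i by auto
    qed (use ts(3)[OF i] \<theta>(2) sub in auto)
    then show ?thesis
      using \<tau>(4) by simp
  qed
  have "\<theta> 1 - \<theta> 0 = (\<Sum>i<length es. \<theta> (ts (Suc i)) - \<theta> (ts i))"
    using ts(1,2) sum_lessThan_telescope[of "\<lambda>i. \<theta> (ts i)" "length es"] by simp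
  also have "\<dots> = of_int (\<Sum>i<length es. g (es ! i))"
    using step by simp
  also have "(\<Sum>i<length es. g (es ! i)) = sum_list (map g es)"
    by (simp add: sum_list_sum_nth atLeast0LessThan)
  finally show ?thesis .
qed

end

lemma openin_real_near:
  fixes S :: "real set"
  assumes "openin (top_of_set S) U" "t \<in> U"
  obtains d where "d > 0" "\<forall>u \<in> S. \<bar>u - t\<bar> < d \<longrightarrow> u \<in> U"
proof -
  have "\<exists>d>0. \<forall>u \<in> S. dist u t < d \<longrightarrow> u \<in> U"
    using assms unfolding openin_euclidean_subtopology_iff by blast
  then show thesis
    using that by (auto simp: dist_real_def)
qed

section \<open>Existence and uniqueness of the edge word of a path\<close>

context digraph
begin

text \<open>The lift for the constant cochain \<open>1\<close> is the clock along the path. If it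
  stopped on an interval, every point of the path there would be a vertex or have one fixed edge
  parameter. That leaves finitely many points, so the path would be constant there, against local
  injectivity.\<close>

lemma unit_lift:
  assumes q: "graph_op_path X {0..1} q" and ends: "q 0 \<in> gverts X" "q 1 \<in> gverts X"
    and loc: "\<And>t. t \<in> {0<..<1} \<Longrightarrow> \<exists>d>0. inj_on q {u \<in> {0<..<1}. \<bar>u - t\<bar> < d}"
  obtains \<theta> :: "real \<Rightarrow> real" where "continuous_on {0..1} \<theta>" "strict_mono_on {0..1} \<theta>" "\<theta> 0 = 0" "\<theta> 1 \<in> \<int>"
    "\<And>t. t \<in> {0..1} \<Longrightarrow> edge_circle_map X (\<lambda>_. 1) (q t) = circ (\<theta> t)"
proof -
  have qc: "continuous_map (top_of_set {0..1}) (gspace X) q"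
    using q by (simp add: graph_op_path_def)
  obtain \<theta>0 where \<theta>0: "continuous_on {0..1} \<theta>0"
      "\<And>t. t \<in> {0..1} \<Longrightarrow> edge_circle_map X (\<lambda>_. 1) (q t) = circ (\<theta>0 t)"
    by (rule path_lift_exists[OF _ qc]) (auto simp: is_interval_cc)
  \<comment> \<open>The subtracted value is an integer because \<open>q 0\<close> is a vertex, so
    the shifted function is still a lift.\<close>
  define \<theta> where "\<theta> t = \<theta>0 t - \<theta>0 0" for t
  have "circ (\<theta>0 0) = 1"
    using \<theta>0(2)[of 0] edge_circle_map_vertex[OF ends(1)] by simp
  then have lift: "edge_circle_map X (\<lambda>_. 1) (q t) = circ (\<theta> t)" if "t \<in> {0..1}" for t
    using \<theta>0(2)[OF that] by (simp add: \<theta>_def circ_diff)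
  have cont: "continuous_on {0..1} \<theta>"
    unfolding \<theta>_def using \<theta>0(1) by (intro continuous_intros)
  have mono: "mono_on {0..1} \<theta>"
    by (rule op_path_lift_mono[OF _ _ q cont lift]) (auto simp: is_interval_cc)
  have "strict_mono_on {0..1} \<theta>"
  proof (rule ccontr)
    assume "\<not> strict_mono_on {0..1} \<theta>"
    then obtain s t where st: "s \<in> {0..1}" "t \<in> {0..1}" "s < t" "\<theta> t \<le> \<theta> s"
      by (auto simp: strict_mono_on_def monotone_on_def not_less)
    have const: "\<theta> r = \<theta> s" if "r \<in> {s..t}" for r
    proof -
      have "r \<in> {0..1}" using that st by auto
      then have "\<theta> s \<le> \<theta> r" "\<theta> r \<le> \<theta> t"
        using that st mono_onD[OF mono, of s r] mono_onD[OF mono, of r t] by simp_all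
      then show ?thesis using st by simp
    qed
    have sub: "{s..t} \<subseteq> {0..1}"
      using st by auto
    have qst: "continuous_map (top_of_set {s..t}) (gspace X) q"
      using qc sub by (rule continuous_map_from_subtopology_mono)
    have "q r \<in> gverts X \<union> (\<lambda>e. gparam X e (frac (\<theta> s))) ` gedges X" if r: "r \<in> {s..t}" for r
    proof (cases "q r \<in> gverts X")
      case False
      have "q r \<in> topspace (gspace X)"
        using continuous_map_image_subset_topspace[OF qst] r by auto
      then obtain e \<tau> where e: "e \<in> gedges X" "\<tau> \<in> {0<..<1}" "q r = gparam X e \<tau>"
        using False by (rule non_vertex_cases)
      have "circ (\<theta> s) = circ \<tau>"
        using lift[of r] r sub const[OF r] e edge_circle_map_param[of e \<tau> "\<lambda>_. 1"] by auto
      then have "frac (\<theta> s) = \<tau>"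
        using e(2) by (simp add: frac_unique_iff circ_eq_iff)
      then show ?thesis
        using e by simp
    qed simp
    then have "q ` {s..t} \<subseteq> gverts X \<union> (\<lambda>e. gparam X e (frac (\<theta> s))) ` gedges X"
      by blast
    then have fin: "finite (q ` {s..t})"
      by (rule finite_subset) (use finite_verts finite_edges in simp)
    \<comment> \<open>Local injectivity is available at interior times only; the midpoint is one
      even if \<open>s = 0\<close> or \<open>t = 1\<close>.\<close>
    define m where "m = (s + t) / 2"
    have m: "s < m" "m < t" "m \<in> {0<..<1}"
      using st by (auto simp: m_def)
    obtain d where d: "d > 0" "inj_on q {u \<in> {0<..<1}. \<bar>u - m\<bar> < d}"
      using loc[OF m(3)] by blast
    define m' where "m' = min ((m + t) / 2) (m + d / 2)"
    have m': "m < m'" "m' < t" "m' < m + d" 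
      using m d(1) by (auto simp: m'_def min_def)
    then have "m' \<in> {0<..<1}"
      using m st by auto
    moreover have "q m = q m'"
      using m m' by (intro finite_range_constant[OF _ qst fin]) auto
    ultimately show False
      using inj_onD[OF d(2), of m m'] m m' d(1) by auto
  qed
  moreover have "\<theta> 1 \<in> \<int>"
    using lift[of 1] edge_circle_map_vertex[OF ends(2)] by (simp add: circ_eq_1_iff[symmetric])
  moreover have "\<theta> 0 = 0"
    by (simp add: \<theta>_def)
  ultimately show thesis
    using that[OF cont _ _ _ lift] by blast
qed

text \<open>The path is cut at the times \<open>ts i\<close> at which the clock shows
  \<open>i\<close>. Between two cuts the clock is not integral, so the path avoids the vertices and
  stays in one open edge, with \<open>\<theta> s - i\<close> as its parameter.\<close>

lemma traverses_exists:
  assumes q: "graph_op_path X {0..1} q"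
    and \<theta>: "continuous_on {0..1} \<theta>" "strict_mono_on {0..1} \<theta>" "\<theta> 0 = 0" "\<theta> 1 \<in> \<int>"
    "\<And>t. t \<in> {0..1} \<Longrightarrow> edge_circle_map X (\<lambda>_. 1) (q t) = circ (\<theta> t)"
  shows "\<exists>es. traverses X q es"
proof -
  have qc: "continuous_map (top_of_set {0..1}) (gspace X) q"
    using q by (simp add: graph_op_path_def)
  have less: "s < t \<longleftrightarrow> \<theta> s < \<theta> t" if "s \<in> {0..1}" "t \<in> {0..1}" for s t
    using strict_mono_on_less[OF \<theta>(2)] that by blast
  then have eq: "s = t \<longleftrightarrow> \<theta> s = \<theta> t" if "s \<in> {0..1}" "t \<in> {0..1}" for s t
    using that by (metis less_irrefl linorder_neqE_linordered_idom)
  have "0 < \<theta> 1"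
    using less[of 0 1] \<theta>(3) by simp
  obtain k where k: "\<theta> 1 = of_int k"
    using \<theta>(4) by (elim Ints_cases)
  define n where "n = nat k"
  have n: "\<theta> 1 = real n"
    using k \<open>0 < \<theta> 1\<close> by (simp add: n_def)
  have "\<exists>t. t \<in> {0..1} \<and> \<theta> t = real i" if "i \<le> n" for i
    using IVT'[of \<theta> 0 "real i" 1] \<theta>(1,3) n that by auto
  then obtain ts where ts: "\<And>i. i \<le> n \<Longrightarrow> ts i \<in> {0..1}" "\<And>i. i \<le> n \<Longrightarrow> \<theta> (ts i) = real i"
    by metis
  have ts0: "ts 0 = 0"
    using eq[of "ts 0" 0] ts[of 0] \<theta>(3) by simp
  have tsn: "ts n = 1"
    using eq[of "ts n" 1] ts[of n] n by simp
  have step: "ts i < ts (Suc i)" if "i < n" for i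
    using less[of "ts i" "ts (Suc i)"] ts[of i] ts[of "Suc i"] that by simp
  have "\<exists>e \<in> gedges X. \<forall>s \<in> {ts i..ts (Suc i)}. q s = gparam X e (\<theta> s - i)" if i: "i < n" for i
  proof -
    let ?J = "{ts i<..<ts (Suc i)}" and ?C = "{ts i..ts (Suc i)}"
    have C: "?C \<subseteq> {0..1}"
      using ts(1)[of i] ts(1)[of "Suc i"] i by auto
    have \<theta>J: "real i < \<theta> s" "\<theta> s < real i + 1" if "s \<in> ?J" for s
    proof -
      have "s \<in> {0..1}"
        using that C by (auto simp: subset_eq)
      then show "real i < \<theta> s" "\<theta> s < real i + 1"
        using that less[of "ts i" s] less[of s "ts (Suc i)"] ts[of i] ts[of "Suc i"] i by simp_all
    qed
    have \<theta>C: "\<theta> s - real i \<in> {0..1}" if "s \<in> ?C" for s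
    proof -
      have "s \<in> {0..1}"
        using that C by (auto simp: subset_eq)
      then show ?thesis
        using that less[of s "ts i"] less[of "ts (Suc i)" s] ts[of i] ts[of "Suc i"] i by auto
    qed
    have qC: "continuous_map (top_of_set ?C) (gspace X) q"
      using qc C by (rule continuous_map_from_subtopology_mono)
    have qJ: "continuous_map (top_of_set ?J) (gspace X) q"
      using qC by (rule continuous_map_from_subtopology_mono) auto
    have "q s \<notin> gverts X" if s: "s \<in> ?J" for s
    proof
      assume "q s \<in> gverts X"
      then have "\<theta> s \<in> \<int>"
        using \<theta>(5)[of s] C s edge_circle_map_vertex[of "q s" "\<lambda>_. 1"] by (auto simp: circ_eq_1_iff)
      then obtain m where "\<theta> s = of_int m"
        by (elim Ints_cases)
      then have "of_int (int i) < (of_int m :: real)" "of_int m < (of_int (int i + 1) :: real)"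
        using \<theta>J[OF s] by simp_all
      then show False
        unfolding of_int_less_iff by simp
    qed
    then have "q ` ?J \<inter> gverts X = {}"
      by blast
    then obtain e where e: "e \<in> gedges X" "q ` ?J \<subseteq> gparam X e ` {0<..<1}"
      using connected_avoiding_verts[OF _ _ qJ] step[OF i] by auto
    have J: "q s = gparam X e (\<theta> s - i)" if s: "s \<in> ?J" for s
    proof -
      obtain \<sigma> where \<sigma>: "\<sigma> \<in> {0<..<1}" "q s = gparam X e \<sigma>"
        using e(2) s by blast
      have "circ \<sigma> = circ (\<theta> s)"
        using \<theta>(5)[of s] \<sigma> C s e(1) edge_circle_map_param[of e \<sigma> "\<lambda>_. 1"] by auto
      then have "\<sigma> - \<theta> s \<in> \<int>"
        by (simp add: circ_eq_iff)
      \<comment> \<open>With \<open>\<sigma>\<close> between \<open>0\<close> and \<open>1\<close>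
        and \<open>\<theta> s\<close> between \<open>i\<close> and \<open>i + 1\<close>, the only
        possible integral difference is \<open>- i\<close>.\<close>
      then obtain m where "\<sigma> - \<theta> s = of_int m"
        by (elim Ints_cases)
      moreover have "m = - int i"
        using calculation \<theta>J[OF s] \<sigma>(1) by auto
      ultimately have "\<sigma> = \<theta> s - i"
        by simp
      then show ?thesis
        using \<sigma> by simp
    qed
    \<comment> \<open>Two continuous maps into a Hausdorff space agree on a closed set, so the
      formula extends from the open interval to its closure.\<close>
    have "continuous_map (top_of_set ?C) (top_of_set {0..1}) (\<lambda>s. \<theta> s - i)"
      unfolding continuous_map_in_subtopology
      using continuous_on_subset[OF \<theta>(1) C] \<theta>C by (auto intro!: continuous_intros)
    from continuous_map_compose[OF this param_continuous[OF e(1)]]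
    have "continuous_map (top_of_set ?C) (gspace X) (\<lambda>s. gparam X e (\<theta> s - i))"
      by (simp add: o_def)
    then have "closedin (top_of_set ?C) {s \<in> ?C. q s = gparam X e (\<theta> s - i)}"
      using closedin_continuous_maps_eq[OF Hausdorff qC] by simp
    then have "closed {s \<in> ?C. q s = gparam X e (\<theta> s - i)}"
      by (simp add: closedin_closed_eq)
    moreover have "?J \<subseteq> {s \<in> ?C. q s = gparam X e (\<theta> s - i)}"
      using J by auto
    ultimately have "closure ?J \<subseteq> {s \<in> ?C. q s = gparam X e (\<theta> s - i)}"
      by (rule closure_minimal[rotated])
    then show ?thesis
      using step[OF i] e(1) by (auto simp: subset_eq)
  qed
  then obtain E where E: "\<And>i. i < n \<Longrightarrow> E i \<in> gedges X"
      "\<And>i s. i < n \<Longrightarrow> s \<in> {ts i..ts (Suc i)} \<Longrightarrow> q s = gparam X (E i) (\<theta> s - i)"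
    by metis
  have "\<exists>\<tau>. continuous_on {ts i..ts (Suc i)} \<tau> \<and> strict_mono_on {ts i..ts (Suc i)} \<tau> \<and>
         \<tau> (ts i) = 0 \<and> \<tau> (ts (Suc i)) = 1 \<and>
         (\<forall>s \<in> {ts i..ts (Suc i)}. q s = gparam X (map E [0..<n] ! i) (\<tau> s))" if i: "i < n" for i
  proof (intro exI[of _ "\<lambda>s. \<theta> s - i"] conjI ballI)
    have C: "{ts i..ts (Suc i)} \<subseteq> {0..1}"
      using ts(1)[of i] ts(1)[of "Suc i"] i by auto
    then show "continuous_on {ts i..ts (Suc i)} (\<lambda>s. \<theta> s - i)"
      using continuous_on_subset[OF \<theta>(1)] by (intro continuous_intros) auto
    show "strict_mono_on {ts i..ts (Suc i)} (\<lambda>s. \<theta> s - i)"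
      using \<theta>(2) C by (auto simp: monotone_on_def subset_eq)
  qed (use i ts(2)[of i] ts(2)[of "Suc i"] E(2)[OF i] in auto)
  then have "traverses X q (map E [0..<n])"
    unfolding traverses_def using E(1) ts0 tsn step by (intro conjI exI[of _ ts]) auto
  then show ?thesis ..
qed

text \<open>Every traversal must break exactly where the clock shows an integer, since each piece
  advances it by \<open>1\<close>.\<close>

lemma traverses_breaks:
  assumes "traverses X q es" and "continuous_on {0..1} \<theta>" "\<theta> 0 = 0"
    and \<theta>: "\<And>t. t \<in> {0..1} \<Longrightarrow> edge_circle_map X (\<lambda>_. 1) (q t) = circ (\<theta> t)"
  obtains ts :: "nat \<Rightarrow> real" where "\<And>i. i \<le> length es \<Longrightarrow> ts i \<in> {0..1} \<and> \<theta> (ts i) = i"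
    "\<And>i. i < length es \<Longrightarrow> ts i < ts (Suc i)"
    "\<And>i s. i < length es \<Longrightarrow> s \<in> {ts i<..<ts (Suc i)} \<Longrightarrow> q s \<in> gparam X (es ! i) ` {0<..<1}"
proof -
  obtain ts where es: "set es \<subseteq> gedges X" and ts: "ts 0 = 0" "ts (length es) = 1"
    "\<And>i. i < length es \<Longrightarrow> ts i < ts (Suc i)"
    "\<And>i. i \<le> length es \<Longrightarrow> ts i \<in> {0..1}"
    "\<And>i. i < length es \<Longrightarrow> \<exists>\<tau>. continuous_on {ts i..ts (Suc i)} \<tau> \<and>
       strict_mono_on {ts i..ts (Suc i)} \<tau> \<and> \<tau> (ts i) = 0 \<and> \<tau> (ts (Suc i)) = 1 \<and>
       (\<forall>s \<in> {ts i..ts (Suc i)}. q s = gparam X (es ! i) (\<tau> s))"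
    using traversesE[OF assms(1)] by blast
  have sub: "{ts i..ts (Suc i)} \<subseteq> {0..1}" if "i < length es" for i
    using ts(4)[of i] ts(4)[of "Suc i"] that by auto
  show thesis
  proof (rule that)
    fix i s assume i: "i < length es" and s: "s \<in> {ts i<..<ts (Suc i)}"
    obtain \<tau> where \<tau>: "strict_mono_on {ts i..ts (Suc i)} \<tau>" "\<tau> (ts i) = 0" "\<tau> (ts (Suc i)) = 1"
        "\<And>s. s \<in> {ts i..ts (Suc i)} \<Longrightarrow> q s = gparam X (es ! i) (\<tau> s)"
      using ts(5)[OF i] by blast
    have "0 < \<tau> s" "\<tau> s < 1"
      using strict_mono_onD[OF \<tau>(1), of "ts i" s] strict_mono_onD[OF \<tau>(1), of s "ts (Suc i)"] s \<tau>(2,3)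
      by auto
    then show "q s \<in> gparam X (es ! i) ` {0<..<1}"
      using \<tau>(4)[of s] s by auto
  next
    fix i assume "i \<le> length es"
    then show "ts i \<in> {0..1} \<and> \<theta> (ts i) = real i"
    proof (induction i)
      case 0
      then show ?case using ts(1,4) assms(3) by simp
    next
      case (Suc i)
      then have i: "i < length es" by simp
      obtain \<tau> where \<tau>: "continuous_on {ts i..ts (Suc i)} \<tau>" "strict_mono_on {ts i..ts (Suc i)} \<tau>"
          "\<tau> (ts i) = 0" "\<tau> (ts (Suc i)) = 1"
          "\<And>s. s \<in> {ts i..ts (Suc i)} \<Longrightarrow> q s = gparam X (es ! i) (\<tau> s)"
        using ts(5)[OF i] by blast
      have "\<theta> (ts (Suc i)) - \<theta> (ts i) = \<tau> (ts (Suc i)) * of_int 1"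
      proof (rule traverses_lift_piece[OF \<tau>(1,3,4) _ \<tau>(5)])
        show "mono_on {ts i..ts (Suc i)} \<tau>"
          using \<tau>(2) by (rule strict_mono_on_imp_mono_on)
        show "continuous_on {ts i..ts (Suc i)} \<theta>"
          using assms(2) sub[OF i] by (rule continuous_on_subset)
        show "es ! i \<in> gedges X"
          using es i by auto
        show "edge_circle_map X (\<lambda>_. 1) (q s) = circ (\<theta> s)" if "s \<in> {ts i..ts (Suc i)}" for s
          using \<theta>[of s] sub[OF i] that by blast
      qed (use ts(3)[OF i] in auto)
      then show ?case
        using Suc \<tau>(4) ts(4)[of "Suc i"] by simp
    qed
  qed (use ts(3) in auto)
qed

text \<open>The strictly increasing clock fixes the number of pieces and all break times. A point in
  the middle of a piece lies in the interior of only one edge, which fixes the letters.\<close>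

lemma traverses_unique:
  assumes \<theta>: "continuous_on {0..1} \<theta>" "strict_mono_on {0..1} \<theta>" "\<theta> 0 = 0"
    "\<And>t. t \<in> {0..1} \<Longrightarrow> edge_circle_map X (\<lambda>_. 1) (q t) = circ (\<theta> t)"
    and es: "traverses X q es" and es': "traverses X q es'"
  shows "es = es'"
proof -
  have "\<theta> 1 = length es" "\<theta> 1 = length es'"
    using traverses_lift[OF es \<theta>(1,4)] traverses_lift[OF es' \<theta>(1,4)] \<theta>(3)
    by (simp_all add: sum_list_triv)
  then have len: "length es = length es'"
    by simp
  obtain ts :: "nat \<Rightarrow> real" where ts: "\<And>i. i \<le> length es \<Longrightarrow> ts i \<in> {0..1} \<and> \<theta> (ts i) = i"
    "\<And>i. i < length es \<Longrightarrow> ts i < ts (Suc i)"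
    "\<And>i s. i < length es \<Longrightarrow> s \<in> {ts i<..<ts (Suc i)} \<Longrightarrow> q s \<in> gparam X (es ! i) ` {0<..<1}"
    using traverses_breaks[OF es \<theta>(1,3,4)] by blast
  obtain ts' :: "nat \<Rightarrow> real" where ts': "\<And>i. i \<le> length es' \<Longrightarrow> ts' i \<in> {0..1} \<and> \<theta> (ts' i) = i"
    "\<And>i. i < length es' \<Longrightarrow> ts' i < ts' (Suc i)"
    "\<And>i s. i < length es' \<Longrightarrow> s \<in> {ts' i<..<ts' (Suc i)} \<Longrightarrow> q s \<in> gparam X (es' ! i) ` {0<..<1}"
    using traverses_breaks[OF es' \<theta>(1,3,4)] by blast
  have eq: "ts i = ts' i" if "i \<le> length es" for i
    using ts(1)[of i] ts'(1)[of i] that len strict_mono_on_eqD[OF \<theta>(2)] by metis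
  show ?thesis
  proof (rule nth_equalityI[OF len])
    fix i assume i: "i < length es"
    define m where "m = (ts i + ts (Suc i)) / 2"
    have "m \<in> {ts i<..<ts (Suc i)}"
      using ts(2)[OF i] by (simp add: m_def)
    then obtain s s' where s: "s \<in> {0<..<1}" "q m = gparam X (es ! i) s"
        and s': "s' \<in> {0<..<1}" "q m = gparam X (es' ! i) s'"
      using ts(3)[OF i, of m] ts'(3)[of i m] i len eq[of i] eq[of "Suc i"] by auto
    have "es ! i \<in> gedges X" "es' ! i \<in> gedges X"
      using es es' i len by (auto simp: traverses_def)
    then show "es ! i = es' ! i"
      using interior_eqD(1)[of "es ! i" "es' ! i" s s'] s s' by auto
  qed
qed

text \<open>This justifies the definite description in \<open>edge_word\<close> for every path to
  which it is applied.\<close>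

lemma traverses_edge_word:
  assumes q: "graph_op_path X {0..1} q" and ends: "q 0 \<in> gverts X" "q 1 \<in> gverts X"
    and loc: "\<And>t. t \<in> {0<..<1} \<Longrightarrow> \<exists>d>0. inj_on q {u \<in> {0<..<1}. \<bar>u - t\<bar> < d}"
  shows "traverses X q (edge_word X q)"
proof -
  obtain \<theta> where \<theta>: "continuous_on {0..1} \<theta>" "strict_mono_on {0..1} \<theta>" "\<theta> 0 = 0" "\<theta> 1 \<in> \<int>"
    "\<And>t. t \<in> {0..1} \<Longrightarrow> edge_circle_map X (\<lambda>_. 1) (q t) = circ (\<theta> t)"
    using unit_lift[OF assms] by blast
  have "\<exists>!es. traverses X q es"
    using traverses_exists[OF q \<theta>] traverses_unique[OF \<theta>(1,2,3,5)] by blast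
  then show ?thesis
    unfolding edge_word_def by (rule theI')
qed

lemma edge_op_path:
  assumes e: "e \<in> gedges X"
  shows "graph_op_path X {0..1} (gparam X e)"
  unfolding graph_op_path_def
proof (intro conjI ballI allI impI param_continuous[OF e])
  fix e1 J
  assume e1: "e1 \<in> gedges X" and J: "J \<subseteq> {0..1::real}" "is_interval J \<and> gparam X e ` J \<subseteq> gparam X e1 ` {0<..<1}"
  have "(inv_into {0<..<1} (gparam X e1) \<circ> gparam X e) r = r" if r: "r \<in> J" for r
  proof -
    obtain s where s: "s \<in> {0<..<1}" "gparam X e1 s = gparam X e r"
      using J(2) r by (metis (no_types, lifting) imageE image_subset_iff)
    have "r \<in> {0..1}"
      using J r by blast
    then have "s = r"
      using interior_eqD(2)[OF e1 e s(1)] s(2) by blast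
    then show ?thesis
      using s e1 by (metis comp_apply inv_param)
  qed
  then show "mono_on J (inv_into {0<..<1} (gparam X e1) \<circ> gparam X e)"
    by (auto simp: mono_on_def)
qed

end

section \<open>A single bonding map of a presentation\<close>

locale graph_morphism = Y: digraph Y + X: digraph X
  for Y :: "('b, 'f) graph" and X :: "('a, 'e) graph" +
  fixes h :: "'b \<Rightarrow> 'a"
  assumes op_map: "graph_op_map Y X h"
    and onto: "h ` topspace (gspace Y) = topspace (gspace X)"
    and verts: "h ` gverts Y \<subseteq> gverts X"
    and locally_inj: "locally_one_to_one
      (subtopology (gspace Y) (topspace (gspace Y) - gverts Y)) h"
begin

lemma continuous: "continuous_map (gspace Y) (gspace X) h"
  using op_map by (simp add: graph_op_map_def)

lemma edge_image_op_path:
  assumes "e \<in> gedges Y"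
  shows "graph_op_path X {0..1} (h \<circ> gparam Y e)"
  using op_map Y.edge_op_path[OF assms] unfolding graph_op_map_def by (simp add: is_interval_cc)

lemma edge_image_locally_inj:
  assumes e: "e \<in> gedges Y" and t: "t \<in> {0<..<1}"
  shows "\<exists>d>0. inj_on (h \<circ> gparam Y e) {u \<in> {0<..<1}. \<bar>u - t\<bar> < d}"
proof -
  have t01: "t \<in> {0..1}"
    using t by simp
  have "gparam Y e t \<in> topspace (gspace Y)" "gparam Y e t \<notin> gverts Y"
    using Y.param_in_topspace[OF e t01] Y.param_in_verts_iff[OF e t01] t by auto
  then obtain U where U: "openin (subtopology (gspace Y) (topspace (gspace Y) - gverts Y)) U"
      "gparam Y e t \<in> U" "inj_on h U"
    using locally_inj by (auto simp: locally_one_to_one_def)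
  then obtain W where W: "openin (gspace Y) W" "U = W \<inter> (topspace (gspace Y) - gverts Y)"
    by (auto simp: openin_subtopology)
  have "openin (top_of_set {0..1}) {u \<in> {0..1}. gparam Y e u \<in> W}"
    using openin_continuous_map_preimage[OF Y.param_continuous[OF e] W(1)] by simp
  moreover have "t \<in> {u \<in> {0..1}. gparam Y e u \<in> W}"
    using t01 U(2) W(2) by simp
  ultimately obtain d where d: "d > 0" "\<forall>u \<in> {0..1}. \<bar>u - t\<bar> < d \<longrightarrow> u \<in> {u \<in> {0..1}. gparam Y e u \<in> W}"
    by (rule openin_real_near)
  have "inj_on (h \<circ> gparam Y e) {u \<in> {0<..<1}. \<bar>u - t\<bar> < d}"
  proof (rule comp_inj_on)
    show "inj_on (gparam Y e) {u \<in> {0<..<1}. \<bar>u - t\<bar> < d}"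
      using Y.param_inj[OF e] by (rule inj_on_subset) auto
    have "gparam Y e u \<in> U" if u: "u \<in> {0<..<1}" "\<bar>u - t\<bar> < d" for u
    proof -
      have u01: "u \<in> {0..1}"
        using u by simp
      then show ?thesis
        using W(2) bspec[OF d(2) u01] u Y.param_in_topspace[OF e u01] Y.param_in_verts_iff[OF e u01]
        by simp
    qed
    then have "gparam Y e ` {u \<in> {0<..<1}. \<bar>u - t\<bar> < d} \<subseteq> U"
      by blast
    then show "inj_on h (gparam Y e ` {u \<in> {0<..<1}. \<bar>u - t\<bar> < d})"
      using U(3) inj_on_subset by blast
  qed
  then show ?thesis
    using d(1) by blast
qed

lemma edge_image_traverses:
  assumes e: "e \<in> gedges Y"
  shows "traverses X (h \<circ> gparam Y e) (edge_word X (h \<circ> gparam Y e))"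
  by (rule X.traverses_edge_word[OF edge_image_op_path[OF e] _ _ edge_image_locally_inj[OF e]])
     (use verts Y.param_ends[OF e] in auto)

text \<open>The bridge from combinatorics to topology: pulling back a cochain is measuring a winding
  number, for any lift whatsoever.\<close>

lemma pull_fun_lift:
  assumes e: "e \<in> gedges Y" and "continuous_on {0..1} \<theta>"
    and "\<And>t. t \<in> {0..1} \<Longrightarrow> edge_circle_map X g (h (gparam Y e t)) = circ (\<theta> t)"
  shows "of_int (pull_fun Y X h g e) = \<theta> 1 - \<theta> 0"
proof -
  have "\<theta> 1 - \<theta> 0 = of_int (sum_list (map g (edge_word X (h \<circ> gparam Y e))))"
    by (rule X.traverses_lift[OF edge_image_traverses[OF e] assms(2)]) (simp add: assms(3))
  then show ?thesis
    using e by (simp add: pull_fun_def)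
qed

text \<open>The midpoint of \<open>e\<close> comes from a point \<open>y\<close> on some edge
  \<open>e'\<close>. The letter of the word of \<open>e'\<close> whose piece contains
  \<open>y\<close> must be \<open>e\<close>, because the midpoint lies in no other edge. Inverting
  the reparameterization of that piece gives \<open>\<rho>\<close>.\<close>

lemma lift_edge:
  assumes e: "e \<in> gedges X"
  obtains e' \<rho> where "e' \<in> gedges Y" "continuous_on {0..1} \<rho>" "strict_mono_on {0..1} \<rho>"
    "\<rho> ` {0..1} \<subseteq> {0..1}" "\<And>t. t \<in> {0..1} \<Longrightarrow> h (gparam Y e' (\<rho> t)) = gparam X e t"
proof -
  have "gparam X e (1/2) \<in> h ` topspace (gspace Y)"
    unfolding onto using X.param_in_topspace[OF e] by simp
  then obtain y where y: "y \<in> topspace (gspace Y)" "gparam X e (1/2) = h y"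
    by blast
  obtain e' t where e': "e' \<in> gedges Y" and t: "t \<in> {0..1}" "y = gparam Y e' t"
    using y(1) by (rule Y.topspace_cases)
  let ?q = "h \<circ> gparam Y e'"
  let ?es = "edge_word X ?q"
  obtain ts where es: "set ?es \<subseteq> gedges X" and ts: "ts 0 = 0" "ts (length ?es) = 1"
    "\<And>i. i < length ?es \<Longrightarrow> ts i < ts (Suc i)"
    "\<And>i. i \<le> length ?es \<Longrightarrow> ts i \<in> {0..1}"
    "\<And>i. i < length ?es \<Longrightarrow> \<exists>\<tau>. continuous_on {ts i..ts (Suc i)} \<tau> \<and>
       strict_mono_on {ts i..ts (Suc i)} \<tau> \<and> \<tau> (ts i) = 0 \<and> \<tau> (ts (Suc i)) = 1 \<and>
       (\<forall>s \<in> {ts i..ts (Suc i)}. ?q s = gparam X (?es ! i) (\<tau> s))"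
    using X.traversesE[OF edge_image_traverses[OF e']] by blast
  \<comment> \<open>Otherwise \<open>y\<close> would be a vertex and so would its image, the
    midpoint of \<open>e\<close>. This excludes the break index \<open>0\<close> below.\<close>
  have "t \<noteq> 0"
  proof
    assume "t = 0"
    then have "gparam X e (1/2) \<in> gverts X"
      using y t verts Y.param_ends(1)[OF e'] by auto
    then show False
      using X.param_in_verts_iff[OF e, of "1/2"] by simp
  qed
  \<comment> \<open>The first break at or after \<open>t\<close> closes the piece containing
    \<open>t\<close>; that piece has index \<open>j - 1\<close>.\<close>
  define j where "j = (LEAST j. t \<le> ts j)"
  have j: "t \<le> ts j"
    unfolding j_def by (rule LeastI[of _ "length ?es"]) (use t ts(2) in simp)
  have jmin: "\<And>i. i < j \<Longrightarrow> \<not> t \<le> ts i"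
    unfolding j_def by (rule not_less_Least)
  have "j \<le> length ?es"
    unfolding j_def by (rule Least_le) (use t ts(2) in simp)
  moreover have "j \<noteq> 0"
    using j ts(1) t \<open>t \<noteq> 0\<close> by (cases "j = 0") auto
  ultimately obtain i where ji: "j = Suc i" and i: "i < length ?es"
    by (cases j) auto
  have ti: "t \<in> {ts i..ts (Suc i)}"
    using j jmin[of i] ji by auto
  obtain \<tau> where \<tau>: "continuous_on {ts i..ts (Suc i)} \<tau>" "strict_mono_on {ts i..ts (Suc i)} \<tau>"
      "\<tau> (ts i) = 0" "\<tau> (ts (Suc i)) = 1"
      "\<And>s. s \<in> {ts i..ts (Suc i)} \<Longrightarrow> ?q s = gparam X (?es ! i) (\<tau> s)"
    using ts(5)[OF i] by blast
  let ?C = "{ts i..ts (Suc i)}"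
  have mono: "mono_on ?C \<tau>"
    using \<tau>(2) by (rule strict_mono_on_imp_mono_on)
  have "\<tau> s \<in> {0..1}" if "s \<in> ?C" for s
    using mono_onD[OF mono, of "ts i" s] mono_onD[OF mono, of s "ts (Suc i)"] \<tau>(3,4) that by auto
  moreover have "\<exists>s. ts i \<le> s \<and> s \<le> ts (Suc i) \<and> \<tau> s = r" if "r \<in> {0..1}" for r
    by (rule IVT') (use \<tau> ts(3)[OF i] that in auto)
  ultimately have img: "\<tau> ` ?C = {0..1}"
    by (auto simp: image_iff Bex_def) metis
  have inj: "inj_on \<tau> ?C"
    using \<tau>(2) by (rule strict_mono_on_imp_inj_on)
  define \<rho> where "\<rho> = the_inv_into ?C \<tau>"
  have \<rho>: "\<rho> r \<in> ?C" "\<tau> (\<rho> r) = r" if "r \<in> {0..1}" for r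
    using that img the_inv_into_into[OF inj, of r ?C] f_the_inv_into_f[OF inj, of r] by (simp_all add: \<rho>_def)
  have "?es ! i = e"
    using X.interior_eqD(1)[OF e, of "?es ! i" "1/2" "\<tau> t"] es i \<tau>(5)[OF ti] y t
      \<open>\<And>s. s \<in> ?C \<Longrightarrow> \<tau> s \<in> {0..1}\<close>[OF ti] by (auto simp: subset_eq)
  show thesis
  proof (rule that[OF e'])
    show "continuous_on {0..1} \<rho>"
      using continuous_on_inv_into[OF \<tau>(1) _ inj] img by (simp add: \<rho>_def)
    show "strict_mono_on {0..1} \<rho>"
      unfolding strict_mono_on_def
    proof (intro allI impI)
      fix r s :: real assume *: "r \<in> {0..1} \<and> s \<in> {0..1} \<and> r < s"
      show "\<rho> r < \<rho> s"
      proof (rule ccontr)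
        assume "\<not> \<rho> r < \<rho> s"
        then have "\<tau> (\<rho> s) \<le> \<tau> (\<rho> r)"
          using mono_onD[OF mono] \<rho>(1) * by simp
        then show False
          using * \<rho>(2) by simp
      qed
    qed
    show "\<rho> ` {0..1} \<subseteq> {0..1}"
      using \<rho>(1) ts(4)[of i] ts(4)[of "Suc i"] i by force
    fix r :: real assume r: "r \<in> {0..1}"
    then show "h (gparam Y e' (\<rho> r)) = gparam X e r"
      using \<tau>(5)[OF \<rho>(1)[OF r]] \<rho>(2)[OF r] \<open>?es ! i = e\<close> by simp
  qed
qed

end

section \<open>Graph groups and circle maps on graphs\<close>

lemma quotient_eq_iff:
  fixes G (structure)
  assumes "comm_group G" "subgroup H G" "x \<in> carrier G" "y \<in> carrier G"
  shows "H #> x = H #> y \<longleftrightarrow> x \<otimes> inv y \<in> H"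
proof -
  interpret comm_group G by fact
  interpret H: subgroup H G by fact
  have "x \<otimes> inv y \<in> H \<longleftrightarrow> x \<in> H #> y"
    using H.rcos_module[OF is_group assms(4,3)] by simp
  also have "\<dots> \<longleftrightarrow> H #> x = H #> y"
    using repr_independence[OF _ assms(4,2)] rcos_self[OF assms(3,2)] by blast
  finally show ?thesis by simp
qed

lemma carrier_quotient: "carrier (G Mod H) = (\<lambda>x. H #>\<^bsub>G\<^esub> x) ` carrier G"
  by (auto simp: FactGroup_def RCOSETS_def)

lemma quotient_mult:
  assumes "comm_group G" "subgroup H G" "x \<in> carrier G" "y \<in> carrier G"
  shows "(H #>\<^bsub>G\<^esub> x) \<otimes>\<^bsub>G Mod H\<^esub> (H #>\<^bsub>G\<^esub> y) = H #>\<^bsub>G\<^esub> (x \<otimes>\<^bsub>G\<^esub> y)"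
  using normal.rcos_sum[OF comm_group.subgroup_imp_normal[OF assms(1,2)] assms(3,4)]
  by (simp add: FactGroup_def)

lemma quotient_comm_group:
  assumes "comm_group G" "subgroup H G"
  shows "comm_group (G Mod H)"
proof -
  interpret comm_group G by fact
  show ?thesis
  proof (rule group.group_comm_groupI)
    show "Group.group (G Mod H)"
      using normal.factorgroup_is_group[OF subgroup_imp_normal[OF assms(2)]] .
    show "x \<otimes>\<^bsub>G Mod H\<^esub> y = y \<otimes>\<^bsub>G Mod H\<^esub> x" if xy: "x \<in> carrier (G Mod H)" "y \<in> carrier (G Mod H)" for x y
    proof -
      obtain a b where ab: "a \<in> carrier G" "b \<in> carrier G" "x = H #>\<^bsub>G\<^esub> a" "y = H #>\<^bsub>G\<^esub> b"
        using xy unfolding carrier_quotient by blast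
      show ?thesis
        unfolding ab(3,4) quotient_mult[OF assms ab(1,2)] quotient_mult[OF assms ab(2,1)]
          m_comm[OF ab(1,2)] ..
    qed
  qed
qed

lemma edge_fun_comm_group: "comm_group (edge_fun_group X)"
  unfolding edge_fun_group_def
  by (rule group.group_comm_groupI) (auto simp: add.commute intro!: restrict_ext)

lemma carrier_edge_fun: "carrier (edge_fun_group X) = extensional (gedges X)"
  by (simp add: edge_fun_group_def PiE_UNIV_domain PiE_def)

lemma edge_fun_mult: "g \<otimes>\<^bsub>edge_fun_group X\<^esub> h = (\<lambda>e \<in> gedges X. g e + h e)"
  by (simp add: edge_fun_group_def)

lemma edge_fun_one: "\<one>\<^bsub>edge_fun_group X\<^esub> = (\<lambda>e \<in> gedges X. 0)"
  by (simp add: edge_fun_group_def)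

lemma edge_fun_inv:
  assumes "g \<in> carrier (edge_fun_group X)"
  shows "inv\<^bsub>edge_fun_group X\<^esub> g = (\<lambda>e \<in> gedges X. - g e)"
  using assms unfolding edge_fun_group_def by (subst inv_product_group) auto

definition coboundary :: "('a, 'e) graph \<Rightarrow> ('a \<Rightarrow> int) \<Rightarrow> 'e \<Rightarrow> int" where
  "coboundary X p = (\<lambda>e \<in> gedges X. p (gparam X e 1) - p (gparam X e 0))"

lemma coboundary_carrier: "coboundary X p \<in> carrier (edge_fun_group X)"
  by (simp add: carrier_edge_fun coboundary_def)

section \<open>Cochains modulo coboundaries as circle maps modulo exponentials\<close>

context digraph
begin

text \<open>The vertex function of \<open>v\<close> is the coboundary of minus the indicator of
  \<open>v\<close>, also in the presence of loops. Only the finitely many values of a potential at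
  vertices matter, so it may be replaced by an integral combination of indicators.\<close>

lemma vertex_subgroup_eq: "vertex_subgroup X = range (coboundary X)"
proof
  interpret G: comm_group "edge_fun_group X"
    by (rule edge_fun_comm_group)
  have vertex: "vertex_fun X v = coboundary X (\<lambda>x. if x = v then - 1 else 0)" for v
    by (auto simp: vertex_fun_def coboundary_def restrict_def)
  have gen: "subgroup (vertex_subgroup X) (edge_fun_group X)"
    unfolding vertex_subgroup_def
    by (rule G.generate_is_subgroup) (auto simp: vertex coboundary_carrier)
  have mult: "coboundary X p \<otimes>\<^bsub>edge_fun_group X\<^esub> coboundary X p' = coboundary X (\<lambda>x. p x + p' x)" for p p'
    by (auto simp: edge_fun_mult coboundary_def restrict_def)
  have inv: "inv\<^bsub>edge_fun_group X\<^esub> coboundary X p = coboundary X (\<lambda>x. - p x)" for p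
    by (subst edge_fun_inv[OF coboundary_carrier]) (auto simp: coboundary_def restrict_def)
  have "subgroup (range (coboundary X)) (edge_fun_group X)"
  proof
    show "\<one>\<^bsub>edge_fun_group X\<^esub> \<in> range (coboundary X)"
      by (rule range_eqI[of _ _ "\<lambda>_. 0"]) (simp add: edge_fun_one coboundary_def)
  qed (auto simp: coboundary_carrier mult inv)
  then show "vertex_subgroup X \<subseteq> range (coboundary X)"
    unfolding vertex_subgroup_def by (intro G.generate_subgroup_incl) (auto simp: vertex)
  have one: "coboundary X (\<lambda>_. 0) = \<one>\<^bsub>edge_fun_group X\<^esub>"
    by (simp add: edge_fun_one coboundary_def)
  have single: "coboundary X (\<lambda>x. if x = v then n else 0) \<in> vertex_subgroup X" if "v \<in> gverts X" for v n
  proof (induction n rule: int_induct[where k = 0])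
    have unit: "vertex_fun X v \<in> vertex_subgroup X"
      using that unfolding vertex_subgroup_def by (intro generate.incl) auto
    {
      case base
      show ?case
        using subgroup.one_closed[OF gen] by (simp add: one)
    next
      \<comment> \<open>The generator carries a minus sign, so raising the coefficient means
        multiplying by its inverse.\<close>
      case (step1 i)
      have "coboundary X (\<lambda>x. if x = v then i + 1 else 0) =
          coboundary X (\<lambda>x. if x = v then i else 0) \<otimes>\<^bsub>edge_fun_group X\<^esub> inv\<^bsub>edge_fun_group X\<^esub> vertex_fun X v"
        unfolding vertex inv mult by (rule arg_cong[of _ _ "coboundary X"]) auto
      then show ?case
        using step1 unit gen by (simp add: subgroup.m_closed subgroup.m_inv_closed)
    next
      case (step2 i)
      have "coboundary X (\<lambda>x. if x = v then i - 1 else 0) =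
          coboundary X (\<lambda>x. if x = v then i else 0) \<otimes>\<^bsub>edge_fun_group X\<^esub> vertex_fun X v"
        unfolding vertex mult by (rule arg_cong[of _ _ "coboundary X"]) auto
      then show ?case
        using step2 unit gen by (simp add: subgroup.m_closed)
    }
  qed
  have sub: "coboundary X (\<lambda>x. if x \<in> A then p x else 0) \<in> vertex_subgroup X" if "finite A" "A \<subseteq> gverts X" for A p
    using that
  proof (induction A rule: finite_induct)
    case empty
    then show ?case
      using subgroup.one_closed[OF gen] by (simp add: one)
  next
    case (insert a A)
    have "coboundary X (\<lambda>x. if x \<in> insert a A then p x else 0) =
        coboundary X (\<lambda>x. if x = a then p a else 0) \<otimes>\<^bsub>edge_fun_group X\<^esub> coboundary X (\<lambda>x. if x \<in> A then p x else 0)"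
      unfolding mult using insert.hyps by (intro arg_cong[of _ _ "coboundary X"]) auto
    then show ?case
      using insert single[of a "p a"] gen by (simp add: subgroup.m_closed)
  qed
  have eq: "coboundary X (\<lambda>x. if x \<in> gverts X then p x else 0) = coboundary X p" for p
    unfolding coboundary_def by (rule restrict_ext) (simp add: param_ends)
  show "range (coboundary X) \<subseteq> vertex_subgroup X"
  proof (rule image_subsetI)
    show "coboundary X p \<in> vertex_subgroup X" for p
      using sub[OF finite_verts order_refl, of p] unfolding eq .
  qed
qed

lemma subgroup_vertex_subgroup: "subgroup (vertex_subgroup X) (edge_fun_group X)"
proof -
  interpret G: comm_group "edge_fun_group X"
    by (rule edge_fun_comm_group)
  show ?thesis
    unfolding vertex_subgroup_def
    by (rule G.generate_is_subgroup) (auto simp: vertex_fun_def carrier_edge_fun)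
qed

lemma graph_class_one: "graph_class X \<one>\<^bsub>edge_fun_group X\<^esub> = \<one>\<^bsub>graph_group X\<^esub>"
proof -
  interpret G: comm_group "edge_fun_group X"
    by (rule edge_fun_comm_group)
  show ?thesis
    unfolding graph_class_def graph_group_def
    using G.coset_join2[OF G.one_closed subgroup_vertex_subgroup subgroup.one_closed[OF subgroup_vertex_subgroup]]
    by (simp add: FactGroup_def)
qed

lemma graph_group_comm_group: "comm_group (graph_group X)"
  unfolding graph_group_def by (rule quotient_comm_group[OF edge_fun_comm_group subgroup_vertex_subgroup])

lemma graph_group_carrier: "carrier (graph_group X) = graph_class X ` carrier (edge_fun_group X)"
  by (simp add: graph_group_def graph_class_def carrier_quotient)

lemma graph_group_mult:
  assumes "g \<in> carrier (edge_fun_group X)" "h \<in> carrier (edge_fun_group X)"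
  shows "graph_class X g \<otimes>\<^bsub>graph_group X\<^esub> graph_class X h = graph_class X (g \<otimes>\<^bsub>edge_fun_group X\<^esub> h)"
  unfolding graph_group_def graph_class_def
  by (rule quotient_mult[OF edge_fun_comm_group subgroup_vertex_subgroup assms])

lemma graph_class_eq_iff:
  assumes "g \<in> carrier (edge_fun_group X)" "h \<in> carrier (edge_fun_group X)"
  shows "graph_class X g = graph_class X h \<longleftrightarrow>
    (\<exists>p. \<forall>e \<in> gedges X. g e - h e = p (gparam X e 1) - p (gparam X e 0))"
proof -
  have "graph_class X g = graph_class X h \<longleftrightarrow> (\<lambda>e \<in> gedges X. g e - h e) \<in> vertex_subgroup X"
    unfolding graph_class_def
    by (subst quotient_eq_iff[OF edge_fun_comm_group subgroup_vertex_subgroup assms])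
       (simp add: edge_fun_inv[OF assms(2)] edge_fun_mult cong: restrict_cong)
  also have "\<dots> \<longleftrightarrow> (\<exists>p. (\<lambda>e \<in> gedges X. g e - h e) = coboundary X p)"
    by (auto simp: vertex_subgroup_eq)
  also have "\<dots> \<longleftrightarrow> (\<exists>p. \<forall>e \<in> gedges X. g e - h e = p (gparam X e 1) - p (gparam X e 0))"
    unfolding coboundary_def by (metis (no_types, lifting) restrict_apply' restrict_ext)
  finally show ?thesis .
qed

text \<open>Interpolating the potential linearly along every edge gives a global logarithm; the
  pieces fit because \<open>g e\<close> is the difference of the end values.\<close>

lemma edge_circle_map_coboundary:
  fixes p :: "'a \<Rightarrow> int"
  assumes "\<And>e. e \<in> gedges X \<Longrightarrow> g e = p (gparam X e 1) - p (gparam X e 0)"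
  obtains w where "continuous_map (gspace X) euclideanreal w"
    "\<forall>x \<in> topspace (gspace X). edge_circle_map X g x = circ (w x)"
    "\<forall>e \<in> gedges X. \<forall>t \<in> {0..1}. w (gparam X e t) = of_int (p (gparam X e 0)) + t * of_int (g e)"
proof -
  obtain w where w: "\<And>e t. e \<in> gedges X \<Longrightarrow> t \<in> {0..1} \<Longrightarrow>
      w (gparam X e t) = of_int (p (gparam X e 0)) + t * of_int (g e)"
    by (rule glue_edges[where F = "\<lambda>e t. of_int (p (gparam X e 0)) + t * of_int (g e)" and c = "\<lambda>v. of_int (p v)"])
       (use assms in auto)
  have "continuous_map (gspace X) euclideanreal w"
  proof (rule continuous_map_edgesI)
    fix e assume e: "e \<in> gedges X"
    have "continuous_on {0..1} (\<lambda>t. w (gparam X e t)) \<longleftrightarrow>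
        continuous_on {0..1} (\<lambda>t. of_int (p (gparam X e 0)) + t * of_int (g e) :: real)"
      using w[OF e] by (intro continuous_on_cong refl)
    then show "continuous_map (top_of_set {0..1}) euclideanreal (\<lambda>t. w (gparam X e t))"
      by (simp add: continuous_intros)
  qed
  moreover have "edge_circle_map X g x = circ (w x)" if x: "x \<in> topspace (gspace X)" for x
  proof -
    obtain e t where e: "e \<in> gedges X" "t \<in> {0..1}" "x = gparam X e t"
      using x by (rule topspace_cases)
    then show ?thesis
      using w[OF e(1,2)] edge_circle_map_param[OF e(1,2)] by (simp add: circ_add)
  qed
  ultimately show thesis
    using w by (intro that[of w]) auto
qed

text \<open>The circle map of \<open>g\<close> is \<open>1\<close> at the vertices, so the logarithm
  is integral there and serves as the potential.\<close>

lemma coboundary_if_lift: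
  assumes w: "continuous_map (gspace X) euclideanreal w"
    and lift: "\<And>x. x \<in> topspace (gspace X) \<Longrightarrow> edge_circle_map X g x = circ (w x)"
  shows "\<exists>p. \<forall>e \<in> gedges X. g e = p (gparam X e 1) - p (gparam X e 0)"
proof (intro exI ballI)
  fix e assume e: "e \<in> gedges X"
  have int: "of_int \<lfloor>w v\<rfloor> = w v" if "v \<in> gverts X" for v
  proof -
    have "circ (w v) = 1"
      using lift[of v] verts_subset that edge_circle_map_vertex[OF that] by auto
    then show ?thesis
      by (auto simp: circ_eq_1_iff elim: Ints_cases)
  qed
  have "1 * of_int (g e) - 0 * of_int (g e) = w (gparam X e 1) - w (gparam X e 0)"
  proof (rule circle_lift_unique[of "{0..1::real}"])
    show "continuous_on {0..1} (\<lambda>t. w (gparam X e t))"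
      using continuous_map_compose[OF param_continuous[OF e] w] by (simp add: o_def)
    show "circ (t * of_int (g e)) = circ (w (gparam X e t))" if "t \<in> {0..1}" for t
      using lift[OF param_in_topspace[OF e that]] edge_circle_map_param[OF e that] by simp
  qed (auto intro!: continuous_intros)
  then have "of_int (g e) = (of_int (\<lfloor>w (gparam X e 1)\<rfloor> - \<lfloor>w (gparam X e 0)\<rfloor>) :: real)"
    using param_ends[OF e] by (simp add: int)
  then show "g e = \<lfloor>w (gparam X e 1)\<rfloor> - \<lfloor>w (gparam X e 0)\<rfloor>"
    by (simp only: of_int_eq_iff)
qed

text \<open>After fixing an angle \<open>u v\<close> at each vertex, the lift along \<open>e\<close>
  that starts at the right angle misses the angle at its end by an integer \<open>g e\<close>.
  Subtracting \<open>t * g e\<close> closes the gap, and the remainders glue to \<open>w\<close>.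
  The normalization at vertices with value \<open>1\<close> is what later identifies
  \<open>g\<close> exactly and not just its class.\<close>

lemma circle_map_decompose:
  assumes \<phi>: "continuous_map (gspace X) euclidean \<phi>" "\<And>x. x \<in> topspace (gspace X) \<Longrightarrow> norm (\<phi> x) = 1"
  obtains g w where "g \<in> carrier (edge_fun_group X)" "continuous_map (gspace X) euclideanreal w"
    "\<forall>x \<in> topspace (gspace X). \<phi> x = edge_circle_map X g x * circ (w x)"
    "\<forall>v \<in> gverts X. \<phi> v = 1 \<longrightarrow> w v = 0"
proof -
  have "\<exists>u. circ u = \<phi> v \<and> (\<phi> v = 1 \<longrightarrow> u = 0)" if "v \<in> gverts X" for v
    using circ_surj[of "\<phi> v"] \<phi>(2)[of v] verts_subset that by (cases "\<phi> v = 1") auto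
  then obtain u where u: "\<And>v. v \<in> gverts X \<Longrightarrow> circ (u v) = \<phi> v"
      "\<And>v. v \<in> gverts X \<Longrightarrow> \<phi> v = 1 \<Longrightarrow> u v = 0"
    by metis
  have "\<exists>\<theta>. continuous_on {0..1} \<theta> \<and> (\<forall>t \<in> {0..1}. \<phi> (gparam X e t) = circ (\<theta> t)) \<and>
      \<theta> 0 = u (gparam X e 0)" if e: "e \<in> gedges X" for e
  proof -
    have "continuous_on {0..1} (\<lambda>t. \<phi> (gparam X e t))"
      using continuous_map_compose[OF param_continuous[OF e] \<phi>(1)] by (simp add: o_def)
    then obtain \<theta> where \<theta>: "continuous_on {0..1} \<theta>" "\<And>t. t \<in> {0..1} \<Longrightarrow> \<phi> (gparam X e t) = circ (\<theta> t)"
      using circle_lift_exists[of "{0..1}" "\<lambda>t. \<phi> (gparam X e t)"] \<phi>(2)[OF param_in_topspace[OF e]]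
      by (metis is_interval_cc)
    let ?\<theta> = "\<lambda>t. \<theta> t - (\<theta> 0 - u (gparam X e 0))"
    have "circ (\<theta> 0 - u (gparam X e 0)) = 1"
      using \<theta>(2)[of 0] u(1)[OF param_ends(1)[OF e]] by (simp add: circ_diff)
    then have "\<forall>t \<in> {0..1}. \<phi> (gparam X e t) = circ (?\<theta> t)"
      using \<theta>(2) by (simp add: circ_diff)
    moreover have "continuous_on {0..1} ?\<theta>"
      using \<theta>(1) by (intro continuous_intros)
    ultimately show ?thesis
      by (intro exI[of _ ?\<theta>]) simp
  qed
  then obtain \<Theta> where \<Theta>: "\<And>e. e \<in> gedges X \<Longrightarrow> continuous_on {0..1} (\<Theta> e)"
      "\<And>e t. e \<in> gedges X \<Longrightarrow> t \<in> {0..1} \<Longrightarrow> \<phi> (gparam X e t) = circ (\<Theta> e t)"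
      "\<And>e. e \<in> gedges X \<Longrightarrow> \<Theta> e 0 = u (gparam X e 0)"
    by metis
  \<comment> \<open>The floor merely converts a real number, integral by the next fact, into an
    \<open>int\<close>.\<close>
  define g where "g = (\<lambda>e \<in> gedges X. \<lfloor>\<Theta> e 1 - u (gparam X e 1)\<rfloor>)"
  have g: "of_int (g e) = \<Theta> e 1 - u (gparam X e 1)" if e: "e \<in> gedges X" for e
  proof -
    have "circ (\<Theta> e 1) = circ (u (gparam X e 1))"
      using \<Theta>(2)[OF e, of 1] u(1)[OF param_ends(2)[OF e]] by simp
    then show ?thesis
      using e by (auto simp: circ_eq_iff g_def elim: Ints_cases)
  qed
  obtain w where w: "\<And>e t. e \<in> gedges X \<Longrightarrow> t \<in> {0..1} \<Longrightarrow> w (gparam X e t) = \<Theta> e t - t * of_int (g e)"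
    by (rule glue_edges[where F = "\<lambda>e t. \<Theta> e t - t * of_int (g e)" and c = u]) (use \<Theta>(3) g in auto)
  have "continuous_map (gspace X) euclideanreal w"
  proof (rule continuous_map_edgesI)
    fix e assume e: "e \<in> gedges X"
    have "continuous_on {0..1} (\<lambda>t. w (gparam X e t)) \<longleftrightarrow>
        continuous_on {0..1} (\<lambda>t. \<Theta> e t - t * of_int (g e))"
      using w[OF e] by (intro continuous_on_cong refl)
    then show "continuous_map (top_of_set {0..1}) euclideanreal (\<lambda>t. w (gparam X e t))"
      using \<Theta>(1)[OF e] by (simp add: continuous_intros)
  qed
  moreover have "\<phi> x = edge_circle_map X g x * circ (w x)" if x: "x \<in> topspace (gspace X)" for x
  proof -
    obtain e t where e: "e \<in> gedges X" "t \<in> {0..1}" "x = gparam X e t"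
      using x by (rule topspace_cases)
    then show ?thesis
      using w[OF e(1,2)] edge_circle_map_param[OF e(1,2)] \<Theta>(2)[OF e(1,2)] by (simp add: circ_diff)
  qed
  moreover have "w v = 0" if v: "v \<in> gverts X" "\<phi> v = 1" for v
  proof -
    obtain e where e: "e \<in> gedges X" "gparam X e 0 = v"
      using v(1) by (rule edge_out_of)
    then show ?thesis
      using w[of e 0] \<Theta>(3)[OF e(1)] u(2)[OF v] by simp
  qed
  moreover have "g \<in> carrier (edge_fun_group X)"
    by (simp add: g_def carrier_edge_fun)
  ultimately show thesis
    by (intro that[of g w]) auto
qed

end

section \<open>Pullback of cochains against pullback of circle maps\<close>

context graph_morphism
begin

lemma pull_fun_carrier: "pull_fun Y X h g \<in> carrier (edge_fun_group Y)"
  by (simp add: pull_fun_def carrier_edge_fun)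

text \<open>Decomposing the composed map gives a cochain \<open>g'\<close> and a correction that
  vanishes at the vertices, where the composed map is \<open>1\<close>. A lift along
  \<open>e\<close> then gains exactly \<open>g' e\<close>, which by \<open>pull_fun_lift\<close> is
  the value of the pullback.\<close>

lemma edge_circle_map_pull:
  obtains w where "continuous_map (gspace Y) euclideanreal w"
    "\<forall>y \<in> topspace (gspace Y). edge_circle_map X g (h y) = edge_circle_map Y (pull_fun Y X h g) y * circ (w y)"
proof -
  have h: "h y \<in> topspace (gspace X)" if "y \<in> topspace (gspace Y)" for y
    using onto that by blast
  have "continuous_map (gspace Y) euclidean (\<lambda>y. edge_circle_map X g (h y))"
    using continuous_map_compose[OF continuous X.edge_circle_map_continuous] by (simp add: o_def)
  then obtain g' w where g': "g' \<in> carrier (edge_fun_group Y)" and w: "continuous_map (gspace Y) euclideanreal w"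
    "\<forall>y \<in> topspace (gspace Y). edge_circle_map X g (h y) = edge_circle_map Y g' y * circ (w y)"
    "\<forall>v \<in> gverts Y. edge_circle_map X g (h v) = 1 \<longrightarrow> w v = 0"
    using Y.circle_map_decompose[of "\<lambda>y. edge_circle_map X g (h y)"] X.norm_edge_circle_map[OF h] by metis
  have "of_int (pull_fun Y X h g e) = (of_int (g' e) :: real)" if e: "e \<in> gedges Y" for e
  proof -
    have "w v = 0" if "v \<in> gverts Y" for v
      using w(3) X.edge_circle_map_vertex[of "h v" g] verts that by blast
    then have "w (gparam Y e 0) = 0" "w (gparam Y e 1) = 0"
      using Y.param_ends[OF e] by auto
    moreover have "of_int (pull_fun Y X h g e) =
        (1 * of_int (g' e) + w (gparam Y e 1)) - (0 * of_int (g' e) + w (gparam Y e 0))"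
    proof (rule pull_fun_lift[OF e])
      show "continuous_on {0..1} (\<lambda>t. t * of_int (g' e) + w (gparam Y e t))"
        using continuous_map_compose[OF Y.param_continuous[OF e] w(1)]
        by (intro continuous_intros) (simp add: o_def)
      show "edge_circle_map X g (h (gparam Y e t)) = circ (t * of_int (g' e) + w (gparam Y e t))"
        if t: "t \<in> {0..1}" for t
        using w(2) Y.param_in_topspace[OF e t] Y.edge_circle_map_param[OF e t] by (simp add: circ_add)
    qed
    ultimately show ?thesis
      by simp
  qed
  then have "pull_fun Y X h g = g'"
    using g' pull_fun_carrier by (auto simp: carrier_edge_fun intro: extensionalityI)
  then show thesis
    using w that by blast
qed

lemma pull_fun_mult:
  "pull_fun Y X h (g \<otimes>\<^bsub>edge_fun_group X\<^esub> g') = pull_fun Y X h g \<otimes>\<^bsub>edge_fun_group Y\<^esub> pull_fun Y X h g'"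
  unfolding edge_fun_mult
proof (unfold pull_fun_def, rule restrict_ext)
  fix e assume e: "e \<in> gedges Y"
  let ?es = "edge_word X (h \<circ> gparam Y e)"
  have "set ?es \<subseteq> gedges X"
    using edge_image_traverses[OF e] by (simp add: traverses_def)
  then have "sum_list (map (\<lambda>e \<in> gedges X. g e + g' e) ?es) = sum_list (map (\<lambda>e. g e + g' e) ?es)"
    by (intro arg_cong[of _ _ sum_list] map_cong) (auto simp: subset_eq)
  then show "sum_list (map (\<lambda>e \<in> gedges X. g e + g' e) ?es) =
      (\<lambda>e \<in> gedges Y. sum_list (map g (edge_word X (h \<circ> gparam Y e)))) e +
      (\<lambda>e \<in> gedges Y. sum_list (map g' (edge_word X (h \<circ> gparam Y e)))) e"
    using e by (simp add: sum_list_addf)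
qed

lemma pull_fun_nonneg:
  assumes "\<And>e. e \<in> gedges X \<Longrightarrow> 0 \<le> g e" "e \<in> gedges Y"
  shows "0 \<le> pull_fun Y X h g e"
proof -
  have "set (edge_word X (h \<circ> gparam Y e)) \<subseteq> gedges X"
    using edge_image_traverses[OF assms(2)] by (simp add: traverses_def)
  then show ?thesis
    using assms by (auto simp: pull_fun_def subset_eq intro!: sum_list_nonneg)
qed

text \<open>The interpolated potential is a global logarithm; composed with \<open>h\<close> it
  provides the lift along \<open>e\<close>, and vertices go to vertices.\<close>

lemma pull_fun_coboundary:
  assumes "\<And>e. e \<in> gedges X \<Longrightarrow> g e = p (gparam X e 1) - p (gparam X e 0)" "e \<in> gedges Y"
  shows "pull_fun Y X h g e = p (h (gparam Y e 1)) - p (h (gparam Y e 0))"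
proof -
  obtain w where w: "continuous_map (gspace X) euclideanreal w"
    "\<forall>x \<in> topspace (gspace X). edge_circle_map X g x = circ (w x)"
    "\<forall>e \<in> gedges X. \<forall>t \<in> {0..1}. w (gparam X e t) = of_int (p (gparam X e 0)) + t * of_int (g e)"
    using X.edge_circle_map_coboundary[of g p] assms(1) by blast
  have wv: "w v = of_int (p v)" if v: "v \<in> gverts X" for v
  proof -
    obtain e where "e \<in> gedges X" "gparam X e 0 = v"
      using v by (rule X.edge_out_of)
    then show ?thesis
      using w(3) by force
  qed
  have "of_int (pull_fun Y X h g e) = w (h (gparam Y e 1)) - w (h (gparam Y e 0))"
  proof (rule pull_fun_lift[OF assms(2)])
    show "continuous_on {0..1} (\<lambda>t. w (h (gparam Y e t)))"
      using continuous_map_compose[OF continuous_map_compose[OF Y.param_continuous[OF assms(2)] continuous] w(1)]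
      by (simp add: o_def)
    show "edge_circle_map X g (h (gparam Y e t)) = circ (w (h (gparam Y e t)))" if "t \<in> {0..1}" for t
      using w(2) onto Y.param_in_topspace[OF assms(2) that] by blast
  qed
  also have "\<dots> = of_int (p (h (gparam Y e 1)) - p (h (gparam Y e 0)))"
    using wv verts Y.param_ends[OF assms(2)] by (simp add: image_subset_iff)
  finally show ?thesis
    by (simp only: of_int_eq_iff)
qed

text \<open>All cosets in the union that defines \<open>pull_class\<close> coincide: representatives
  differ by the coboundary of some \<open>p\<close>, and their pullbacks by that of
  \<open>p \<circ> h\<close>.\<close>

lemma pull_class_graph_class:
  assumes "g \<in> carrier (edge_fun_group X)"
  shows "pull_class Y X h (graph_class X g) = graph_class Y (pull_fun Y X h g)"
proof -
  interpret G: comm_group "edge_fun_group X"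
    by (rule edge_fun_comm_group)
  have "graph_class Y (pull_fun Y X h g') = graph_class Y (pull_fun Y X h g)" if g': "g' \<in> graph_class X g" for g'
  proof -
    obtain p where p: "g' = coboundary X p \<otimes>\<^bsub>edge_fun_group X\<^esub> g"
      using g' by (auto simp: graph_class_def r_coset_def X.vertex_subgroup_eq)
    have "pull_fun Y X h g' e - pull_fun Y X h g e = p (h (gparam Y e 1)) - p (h (gparam Y e 0))"
      if e: "e \<in> gedges Y" for e
    proof -
      have "pull_fun Y X h g' e = pull_fun Y X h (coboundary X p) e + pull_fun Y X h g e"
        unfolding p pull_fun_mult using e by (simp add: edge_fun_mult)
      moreover have "pull_fun Y X h (coboundary X p) e = p (h (gparam Y e 1)) - p (h (gparam Y e 0))"
        by (rule pull_fun_coboundary[OF _ e]) (simp add: coboundary_def)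
      ultimately show ?thesis
        by simp
    qed
    then show ?thesis
      unfolding Y.graph_class_eq_iff[OF pull_fun_carrier pull_fun_carrier]
      by (intro exI[of _ "p \<circ> h"]) simp
  qed
  moreover have "g \<in> graph_class X g"
    unfolding graph_class_def by (rule G.rcos_self[OF assms X.subgroup_vertex_subgroup])
  ultimately show ?thesis
    unfolding pull_class_def by blast
qed

end

section \<open>Direct limits\<close>

text \<open>Evaluates the union in the product of \<open>dirlim\<close> once its terms are known to
  be equal.\<close>

lemma UN_pairs_constant:
  assumes "\<And>a b c d. (a, b) \<in> A \<Longrightarrow> (c, d) \<in> B \<Longrightarrow> F a b c d = R" "A \<noteq> {}" "B \<noteq> {}"
  shows "(\<Union>(a, b) \<in> A. \<Union>(c, d) \<in> B. F a b c d) = R"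
proof -
  have "(\<Union>p \<in> A. \<Union>q \<in> B. F (fst p) (snd p) (fst q) (snd q)) = (\<Union>p \<in> A. \<Union>q \<in> B. R)"
    by (intro SUP_cong refl assms(1)) simp_all
  then show ?thesis
    using assms(2,3) by (simp add: split_def)
qed

locale direct_system =
  fixes G :: "nat \<Rightarrow> 'g monoid" and t :: "nat \<Rightarrow> 'g \<Rightarrow> 'g"
  assumes comm_group: "\<And>k. comm_group (G k)"
    and hom: "\<And>k. t k \<in> hom (G k) (G (Suc k))"
begin

lemma group: "Group.group (G k)"
  using comm_group comm_group.axioms(2) by blast

lemma monoid: "Group.monoid (G k)"
  using group group.is_monoid by blast

text \<open>Transition indexed by source and target level instead of the number of steps. For
  \<open>m < k\<close> the truncated subtraction makes it the identity, so the facts below assume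
  \<open>k \<le> m\<close>.\<close>

definition up :: "nat \<Rightarrow> nat \<Rightarrow> 'g \<Rightarrow> 'g" where
  "up k m = transition t k (m - k)"

lemma up_self [simp]: "up k k x = x"
  by (simp add: up_def)

lemma transition_hom: "transition t k n \<in> hom (G k) (G (k + n))"
proof (induction n)
  case 0
  then show ?case by (simp add: hom_def)
next
  case (Suc n)
  then show ?case
    using hom_compose[OF Suc hom] by (simp only: transition.simps add_Suc_right)
qed

lemma transition_add: "transition t k (m + n) x = transition t (k + m) n (transition t k m x)"
  by (induction n) (simp_all add: add.assoc)

lemma up_hom: "k \<le> m \<Longrightarrow> up k m \<in> hom (G k) (G m)"
  using transition_hom[of k "m - k"] by (simp add: up_def)

lemma up_closed: "k \<le> m \<Longrightarrow> x \<in> carrier (G k) \<Longrightarrow> up k m x \<in> carrier (G m)"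
  using up_hom by (rule hom_in_carrier)

lemma up_mult:
  assumes "k \<le> m" "x \<in> carrier (G k)" "y \<in> carrier (G k)"
  shows "up k m (x \<otimes>\<^bsub>G k\<^esub> y) = up k m x \<otimes>\<^bsub>G m\<^esub> up k m y"
  using hom_mult[OF up_hom[OF assms(1)]] assms(2,3) by blast

lemma up_one: "k \<le> m \<Longrightarrow> up k m \<one>\<^bsub>G k\<^esub> = \<one>\<^bsub>G m\<^esub>"
  using hom_one[OF up_hom group group] by blast

lemma up_up:
  assumes "k \<le> l" "l \<le> m"
  shows "up l m (up k l x) = up k m x"
  using transition_add[of k "l - k" "m - l" x] assms by (simp add: up_def)

lemma in_rel_iff:
  "((k, x), (l, y)) \<in> dirlim_rel G t \<longleftrightarrow> x \<in> carrier (G k) \<and> y \<in> carrier (G l) \<and>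
     (\<exists>m. k \<le> m \<and> l \<le> m \<and> up k m x = up l m y)"
  by (auto simp: dirlim_rel_def up_def)

lemma up_eq_mono:
  assumes "up k m x = up l m y" "k \<le> m" "l \<le> m" "m \<le> n"
  shows "up k n x = up l n y"
  using assms by (metis up_up)

text \<open>Two equalities at levels \<open>m\<close> and \<open>n\<close> persist to
  \<open>max m n\<close> and can be chained there; this is the transitivity behind the
  classes.\<close>

lemma class_eq_iff:
  assumes "x \<in> carrier (G k)" "y \<in> carrier (G l)"
  shows "dirlim_class G t k x = dirlim_class G t l y \<longleftrightarrow>
    (\<exists>m. k \<le> m \<and> l \<le> m \<and> up k m x = up l m y)"
proof
  assume "dirlim_class G t k x = dirlim_class G t l y"
  moreover have "(l, y) \<in> dirlim_class G t l y"
    unfolding dirlim_class_def Image_singleton_iff in_rel_iff using assms by blast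
  ultimately have "(l, y) \<in> dirlim_class G t k x"
    by simp
  then show "\<exists>m. k \<le> m \<and> l \<le> m \<and> up k m x = up l m y"
    unfolding dirlim_class_def Image_singleton_iff in_rel_iff by blast
next
  have sub: "dirlim_class G t l y \<subseteq> dirlim_class G t k x"
    if m: "k \<le> m" "l \<le> m" "up k m x = up l m y" and "x \<in> carrier (G k)" for k l m x y
  proof
    fix z assume z: "z \<in> dirlim_class G t l y"
    obtain i u where iu: "z = (i, u)"
      by fastforce
    obtain n where n: "u \<in> carrier (G i)" "l \<le> n" "i \<le> n" "up l n y = up i n u"
      using z unfolding iu dirlim_class_def Image_singleton_iff in_rel_iff by blast
    let ?N = "max m n"
    have "up k ?N x = up l ?N y"
      using up_eq_mono[OF m(3,1,2)] by simp
    also have "\<dots> = up i ?N u"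
      using up_eq_mono[OF n(4,2,3)] by simp
    finally show "z \<in> dirlim_class G t k x"
      unfolding iu dirlim_class_def Image_singleton_iff in_rel_iff
      using m(1) n(1,3) that(4) by (intro conjI exI[of _ ?N]) auto
  qed
  assume "\<exists>m. k \<le> m \<and> l \<le> m \<and> up k m x = up l m y"
  then obtain m where m: "k \<le> m" "l \<le> m" "up k m x = up l m y"
    by blast
  show "dirlim_class G t k x = dirlim_class G t l y"
    using sub[OF m assms(1)] sub[OF m(2,1) m(3)[symmetric] assms(2)] by blast
qed

lemma class_up:
  assumes "k \<le> m" "x \<in> carrier (G k)"
  shows "dirlim_class G t m (up k m x) = dirlim_class G t k x"
  using assms by (subst class_eq_iff) (auto simp: up_closed intro: exI[of _ m])

text \<open>Both products are pushed to a level \<open>N\<close> at which the two representatives of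
  each factor have become equal.\<close>

lemma mult_class_step:
  assumes "((k, x), (k', x')) \<in> dirlim_rel G t" "((l, y), (l', y')) \<in> dirlim_rel G t"
  shows "dirlim_class G t (max k' l') (up k' (max k' l') x' \<otimes>\<^bsub>G (max k' l')\<^esub> up l' (max k' l') y') =
    dirlim_class G t (max k l) (up k (max k l) x \<otimes>\<^bsub>G (max k l)\<^esub> up l (max k l) y)"
proof -
  obtain m where m: "k \<le> m" "k' \<le> m" "up k m x = up k' m x'" and x: "x \<in> carrier (G k)" "x' \<in> carrier (G k')"
    using assms(1) unfolding in_rel_iff by blast
  obtain n where n: "l \<le> n" "l' \<le> n" "up l n y = up l' n y'" and y: "y \<in> carrier (G l)" "y' \<in> carrier (G l')"
    using assms(2) unfolding in_rel_iff by blast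
  define N where "N = max m n"
  have raise: "dirlim_class G t (max i j) (up i (max i j) u \<otimes>\<^bsub>G (max i j)\<^esub> up j (max i j) v) =
      dirlim_class G t N (up i N u \<otimes>\<^bsub>G N\<^esub> up j N v)"
    if "i \<le> N" "j \<le> N" "u \<in> carrier (G i)" "v \<in> carrier (G j)" for i j u v
  proof -
    let ?M = "max i j"
    have cl: "up i ?M u \<in> carrier (G ?M)" "up j ?M v \<in> carrier (G ?M)"
      using that by (auto intro: up_closed)
    then have "up i ?M u \<otimes>\<^bsub>G ?M\<^esub> up j ?M v \<in> carrier (G ?M)"
      using monoid.m_closed[OF monoid] by blast
    moreover have "up ?M N (up i ?M u \<otimes>\<^bsub>G ?M\<^esub> up j ?M v) = up i N u \<otimes>\<^bsub>G N\<^esub> up j N v"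
      using that cl by (simp add: up_mult up_up)
    moreover have "?M \<le> N"
      using that by simp
    ultimately show ?thesis
      using class_up[of ?M N "up i ?M u \<otimes>\<^bsub>G ?M\<^esub> up j ?M v"] by simp
  qed
  have "up k N x = up k' N x'" "up l N y = up l' N y'"
    using up_eq_mono[OF m(3,1,2)] up_eq_mono[OF n(3,1,2)] by (simp_all add: N_def)
  moreover have "k \<le> N" "k' \<le> N" "l \<le> N" "l' \<le> N"
    using m n by (auto simp: N_def)
  ultimately show ?thesis
    using raise x y by simp
qed

lemma mult_class:
  assumes "x \<in> carrier (G k)" "y \<in> carrier (G l)"
  shows "dirlim_class G t k x \<otimes>\<^bsub>dirlim G t\<^esub> dirlim_class G t l y =
    dirlim_class G t (max k l) (up k (max k l) x \<otimes>\<^bsub>G (max k l)\<^esub> up l (max k l) y)"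
    (is "_ = ?R")
proof -
  have "dirlim_class G t k x \<otimes>\<^bsub>dirlim G t\<^esub> dirlim_class G t l y =
    (\<Union>(k', x') \<in> dirlim_class G t k x. \<Union>(l', y') \<in> dirlim_class G t l y.
       dirlim_class G t (max k' l') (up k' (max k' l') x' \<otimes>\<^bsub>G (max k' l')\<^esub> up l' (max k' l') y'))"
    by (simp add: dirlim_def up_def)
  also have "\<dots> = ?R"
  proof (rule UN_pairs_constant)
    fix k' x' l' y' assume "(k', x') \<in> dirlim_class G t k x" "(l', y') \<in> dirlim_class G t l y"
    then show "dirlim_class G t (max k' l') (up k' (max k' l') x' \<otimes>\<^bsub>G (max k' l')\<^esub> up l' (max k' l') y') = ?R"
      unfolding dirlim_class_def[of _ _ k] dirlim_class_def[of _ _ l] Image_singleton_iff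
      by (rule mult_class_step)
  next
    have "(k, x) \<in> dirlim_class G t k x" "(l, y) \<in> dirlim_class G t l y"
      unfolding dirlim_class_def Image_singleton_iff in_rel_iff using assms by blast+
    then show "dirlim_class G t k x \<noteq> {}" "dirlim_class G t l y \<noteq> {}"
      by blast+
  qed
  finally show ?thesis .
qed

lemma mult_class_same:
  assumes "x \<in> carrier (G k)" "y \<in> carrier (G k)"
  shows "dirlim_class G t k x \<otimes>\<^bsub>dirlim G t\<^esub> dirlim_class G t k y = dirlim_class G t k (x \<otimes>\<^bsub>G k\<^esub> y)"
  using mult_class[OF assms] by simp

lemma carrier_dirlim: "carrier (dirlim G t) = {dirlim_class G t k x | k x. x \<in> carrier (G k)}"
  by (simp add: dirlim_def)

lemma carrier_dirlimI: "x \<in> carrier (G k) \<Longrightarrow> dirlim_class G t k x \<in> carrier (dirlim G t)"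
  by (auto simp: carrier_dirlim)

lemma carrier_dirlimE:
  assumes "A \<in> carrier (dirlim G t)"
  obtains k where "\<And>m. k \<le> m \<Longrightarrow> \<exists>x \<in> carrier (G m). A = dirlim_class G t m x"
proof -
  obtain k x where "x \<in> carrier (G k)" "A = dirlim_class G t k x"
    using assms by (auto simp: carrier_dirlim)
  then have "\<exists>x \<in> carrier (G m). A = dirlim_class G t m x" if "k \<le> m" for m
    using class_up up_closed that by metis
  then show thesis
    by (rule that)
qed

lemma one_class: "\<one>\<^bsub>dirlim G t\<^esub> = dirlim_class G t k \<one>\<^bsub>G k\<^esub>"
proof -
  have "\<one>\<^bsub>dirlim G t\<^esub> = dirlim_class G t 0 \<one>\<^bsub>G 0\<^esub>"
    by (simp add: dirlim_def)
  also have "\<dots> = dirlim_class G t k \<one>\<^bsub>G k\<^esub>"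
    using class_up[of 0 k "\<one>\<^bsub>G 0\<^esub>"] monoid.one_closed[OF monoid] by (simp add: up_one)
  finally show ?thesis .
qed

lemma dirlim_comm_group: "comm_group (dirlim G t)"
proof (rule group.group_comm_groupI)
  let ?c = "dirlim_class G t"
  \<comment> \<open>The group laws are checked by representing all the elements involved at one
    common level.\<close>
  have two: "\<exists>m. \<exists>x \<in> carrier (G m). \<exists>y \<in> carrier (G m). A = ?c m x \<and> B = ?c m y"
    if A: "A \<in> carrier (dirlim G t)" and B: "B \<in> carrier (dirlim G t)" for A B
  proof -
    obtain k where k: "\<And>m. k \<le> m \<Longrightarrow> \<exists>x \<in> carrier (G m). A = ?c m x"
      using carrier_dirlimE[OF A] by blast
    obtain l where l: "\<And>m. l \<le> m \<Longrightarrow> \<exists>x \<in> carrier (G m). B = ?c m x"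
      using carrier_dirlimE[OF B] by blast
    show ?thesis
      using k[of "max k l"] l[of "max k l"] by force
  qed
  show comm: "A \<otimes>\<^bsub>dirlim G t\<^esub> B = B \<otimes>\<^bsub>dirlim G t\<^esub> A"
    if AB: "A \<in> carrier (dirlim G t)" "B \<in> carrier (dirlim G t)" for A B
  proof -
    obtain m x y where *: "x \<in> carrier (G m)" "y \<in> carrier (G m)" "A = ?c m x" "B = ?c m y"
      using two[OF AB] by blast
    show ?thesis
      unfolding *(3,4) mult_class_same[OF *(1,2)] mult_class_same[OF *(2,1)]
      using comm_groupE(4)[OF comm_group *(1,2)] by simp
  qed
  show "Group.group (dirlim G t)"
  proof (rule groupI)
    fix A B assume AB: "A \<in> carrier (dirlim G t)" "B \<in> carrier (dirlim G t)"
    obtain m x y where *: "x \<in> carrier (G m)" "y \<in> carrier (G m)" "A = ?c m x" "B = ?c m y"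
      using two[OF AB] by blast
    show "A \<otimes>\<^bsub>dirlim G t\<^esub> B \<in> carrier (dirlim G t)"
      unfolding *(3,4) mult_class_same[OF *(1,2)]
      using monoid.m_closed[OF monoid *(1,2)] by (rule carrier_dirlimI)
    fix C assume C: "C \<in> carrier (dirlim G t)"
    obtain k where k: "\<And>m. k \<le> m \<Longrightarrow> \<exists>x \<in> carrier (G m). C = ?c m x"
      using carrier_dirlimE[OF C] by blast
    define N where "N = max k m"
    have N: "k \<le> N" "m \<le> N"
      by (auto simp: N_def)
    obtain z where z: "z \<in> carrier (G N)" "C = ?c N z"
      using k[OF N(1)] by blast
    have x: "up m N x \<in> carrier (G N)" "A = ?c N (up m N x)"
      and y: "up m N y \<in> carrier (G N)" "B = ?c N (up m N y)"
      using * N(2) by (simp_all add: up_closed class_up)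
    show "A \<otimes>\<^bsub>dirlim G t\<^esub> B \<otimes>\<^bsub>dirlim G t\<^esub> C = A \<otimes>\<^bsub>dirlim G t\<^esub> (B \<otimes>\<^bsub>dirlim G t\<^esub> C)"
      unfolding x(2) y(2) z(2)
      using monoid.m_closed[OF monoid] monoid.m_assoc[OF monoid] x(1) y(1) z(1)
      by (simp add: mult_class_same)
  next
    show "\<one>\<^bsub>dirlim G t\<^esub> \<in> carrier (dirlim G t)"
      unfolding one_class[of 0] by (rule carrier_dirlimI[OF monoid.one_closed[OF monoid]])
    fix A assume "A \<in> carrier (dirlim G t)"
    then obtain k x where A: "x \<in> carrier (G k)" "A = ?c k x"
      by (auto simp: carrier_dirlim)
    show "\<one>\<^bsub>dirlim G t\<^esub> \<otimes>\<^bsub>dirlim G t\<^esub> A = A"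
      unfolding one_class[of k] A(2) mult_class_same[OF monoid.one_closed[OF monoid] A(1)]
      by (simp add: monoid.l_one[OF monoid A(1)])
    have inv: "inv\<^bsub>G k\<^esub> x \<in> carrier (G k)"
      using group.inv_closed[OF group A(1)] .
    have "?c k (inv\<^bsub>G k\<^esub> x) \<otimes>\<^bsub>dirlim G t\<^esub> A = \<one>\<^bsub>dirlim G t\<^esub>"
      unfolding one_class[of k] A(2) mult_class_same[OF inv A(1)]
      by (simp add: group.l_inv[OF group A(1)])
    then show "\<exists>B \<in> carrier (dirlim G t). B \<otimes>\<^bsub>dirlim G t\<^esub> A = \<one>\<^bsub>dirlim G t\<^esub>"
      using carrier_dirlimI[OF inv] by blast
  qed
qed

text \<open>The universal property together with a bijectivity criterion. Injectivity is needed only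
  eventually: an element killed by \<open>j k\<close> has to die at some later level.\<close>

lemma iso_from_dirlim:
  assumes H: "comm_group H" and j: "\<And>k. j k \<in> hom (G k) H"
    and compat: "\<And>k x. x \<in> carrier (G k) \<Longrightarrow> j (Suc k) (t k x) = j k x"
    and surj: "\<And>b. b \<in> carrier H \<Longrightarrow> \<exists>k. \<exists>x \<in> carrier (G k). j k x = b"
    and inj: "\<And>k x. x \<in> carrier (G k) \<Longrightarrow> j k x = \<one>\<^bsub>H\<^esub> \<Longrightarrow> \<exists>n. transition t k n x = \<one>\<^bsub>G (k + n)\<^esub>"
  obtains \<iota> where "\<iota> \<in> iso (dirlim G t) H"
    "\<forall>k. \<forall>x \<in> carrier (G k). \<iota> (dirlim_class G t k x) = j k x"
proof -
  let ?c = "dirlim_class G t"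
  have trans_closed: "transition t k n x \<in> carrier (G (k + n))" if "x \<in> carrier (G k)" for k n x
    using transition_hom that by (rule hom_in_carrier)
  have "j (k + n) (transition t k n x) = j k x" if "x \<in> carrier (G k)" for k n x
    by (induction n) (simp_all add: compat trans_closed that)
  then have j_up: "j m (up k m x) = j k x" if "k \<le> m" "x \<in> carrier (G k)" for k m x
    using that by (metis le_add_diff_inverse up_def)
  \<comment> \<open>Any representative may be chosen: equivalent ones meet at some level, and
    \<open>j\<close> is compatible with going up.\<close>
  define \<iota> where "\<iota> A = (SOME b. \<exists>k x. x \<in> carrier (G k) \<and> A = ?c k x \<and> b = j k x)" for A
  have \<iota>: "\<iota> (?c k x) = j k x" if x: "x \<in> carrier (G k)" for k x
    unfolding \<iota>_def
  proof (rule some_equality)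
    fix b assume "\<exists>l y. y \<in> carrier (G l) \<and> ?c k x = ?c l y \<and> b = j l y"
    then obtain l y where y: "y \<in> carrier (G l)" "?c k x = ?c l y" "b = j l y"
      by blast
    then obtain m where "k \<le> m" "l \<le> m" "up k m x = up l m y"
      using class_eq_iff[OF x y(1)] by blast
    then show "b = j k x"
      using j_up x y by metis
  qed (use x in blast)
  interpret D: comm_group "dirlim G t"
    by (rule dirlim_comm_group)
  interpret H: comm_group H
    by fact
  have hom: "\<iota> \<in> hom (dirlim G t) H"
  proof (rule homI)
    fix A assume "A \<in> carrier (dirlim G t)"
    then obtain k x where A: "x \<in> carrier (G k)" "A = ?c k x"
      by (auto simp: carrier_dirlim)
    then show "\<iota> A \<in> carrier H"
      using \<iota> hom_in_carrier[OF j] by simp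
  next
    fix A B assume A: "A \<in> carrier (dirlim G t)" and B: "B \<in> carrier (dirlim G t)"
    obtain k where k: "\<And>m. k \<le> m \<Longrightarrow> \<exists>x \<in> carrier (G m). A = ?c m x"
      using carrier_dirlimE[OF A] by blast
    obtain l where l: "\<And>m. l \<le> m \<Longrightarrow> \<exists>x \<in> carrier (G m). B = ?c m x"
      using carrier_dirlimE[OF B] by blast
    obtain x y where xy: "x \<in> carrier (G (max k l))" "A = ?c (max k l) x"
        "y \<in> carrier (G (max k l))" "B = ?c (max k l) y"
      using k[of "max k l"] l[of "max k l"] by force
    show "\<iota> (A \<otimes>\<^bsub>dirlim G t\<^esub> B) = \<iota> A \<otimes>\<^bsub>H\<^esub> \<iota> B"
      unfolding xy(2,4) mult_class_same[OF xy(1,3)]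
      using xy(1,3) \<iota> hom_mult[OF j xy(1,3)] monoid.m_closed[OF monoid xy(1,3)] by simp
  qed
  then interpret \<iota>: group_hom "dirlim G t" H \<iota>
    by (simp add: group_hom_def group_hom_axioms_def D.is_group H.is_group)
  have "A = \<one>\<^bsub>dirlim G t\<^esub>" if A: "A \<in> carrier (dirlim G t)" "\<iota> A = \<one>\<^bsub>H\<^esub>" for A
  proof -
    obtain k x where x: "x \<in> carrier (G k)" "A = ?c k x"
      using A(1) by (auto simp: carrier_dirlim)
    then obtain n where n: "transition t k n x = \<one>\<^bsub>G (k + n)\<^esub>"
      using inj[OF x(1)] A(2) \<iota> by auto
    have "A = ?c (k + n) (up k (k + n) x)"
      using class_up[of k "k + n" x] x by simp
    also have "\<dots> = \<one>\<^bsub>dirlim G t\<^esub>"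
      using n one_class[of "k + n"] by (simp add: up_def)
    finally show ?thesis .
  qed
  then have "inj_on \<iota> (carrier (dirlim G t))"
    by (simp add: \<iota>.inj_on_one_iff)
  moreover have "\<iota> ` carrier (dirlim G t) = carrier H"
  proof
    show "carrier H \<subseteq> \<iota> ` carrier (dirlim G t)"
    proof
      fix b assume "b \<in> carrier H"
      then obtain k x where "x \<in> carrier (G k)" "j k x = b"
        using surj by blast
      then show "b \<in> \<iota> ` carrier (dirlim G t)"
        using \<iota> carrier_dirlimI by (metis image_eqI)
    qed
  qed (use hom_in_carrier[OF hom] in blast)
  ultimately have "\<iota> \<in> iso (dirlim G t) H"
    using hom by (simp add: iso_def bij_betw_def)
  then show thesis
    using \<iota> by (intro that[of \<iota>]) auto
qed

end

section \<open>The Bruschlinsky group\<close>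

text \<open>Membership in \<open>circle_maps\<close> without extensionality, so that circle maps can
  be handled as plain functions.\<close>

definition unit_map :: "'y topology \<Rightarrow> ('y \<Rightarrow> complex) \<Rightarrow> bool" where
  "unit_map Y \<phi> \<longleftrightarrow> continuous_map Y euclidean \<phi> \<and> (\<forall>y \<in> topspace Y. norm (\<phi> y) = 1)"

lemma unit_mapD:
  "unit_map Y \<phi> \<Longrightarrow> continuous_map Y euclidean \<phi>"
  "unit_map Y \<phi> \<Longrightarrow> y \<in> topspace Y \<Longrightarrow> norm (\<phi> y) = 1"
  by (auto simp: unit_map_def)

lemma continuous_map_then:
  "continuous_map Y euclidean h \<Longrightarrow> continuous_on UNIV k \<Longrightarrow> continuous_map Y euclidean (\<lambda>y. k (h y))"
  using continuous_map_compose[of Y euclidean h euclidean k] by (simp add: o_def)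

lemma unit_map_mult: "unit_map Y \<phi> \<Longrightarrow> unit_map Y \<psi> \<Longrightarrow> unit_map Y (\<lambda>y. \<phi> y * \<psi> y)"
  by (simp add: unit_map_def continuous_map_atin norm_mult tendsto_mult)

lemma unit_map_cnj: "unit_map Y \<phi> \<Longrightarrow> unit_map Y (\<lambda>y. cnj (\<phi> y))"
  by (simp add: unit_map_def continuous_map_atin tendsto_cnj)

lemma unit_map_circ: "continuous_map Y euclideanreal w \<Longrightarrow> unit_map Y (\<lambda>y. circ (w y))"
  using continuous_map_then[of Y w circ] continuous_on_circ[OF continuous_on_id]
  by (simp add: unit_map_def)

lemma unit_map_compose: "continuous_map Z Y h \<Longrightarrow> unit_map Y \<phi> \<Longrightarrow> unit_map Z (\<lambda>z. \<phi> (h z))"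
  using continuous_map_compose[of Z Y h euclidean \<phi>] continuous_map_image_subset_topspace[of Z Y h]
  by (simp add: unit_map_def o_def image_subset_iff)

lemma unit_map_one: "unit_map Y (\<lambda>_. 1)"
  by (simp add: unit_map_def)

lemma unit_map_cong: "(\<And>y. y \<in> topspace Y \<Longrightarrow> \<phi> y = \<psi> y) \<Longrightarrow> unit_map Y \<phi> \<longleftrightarrow> unit_map Y \<psi>"
  unfolding unit_map_def by (metis continuous_map_eq)

lemma circle_maps_carrier: "carrier (circle_maps Y) = {\<phi>. \<phi> \<in> extensional (topspace Y) \<and> unit_map Y \<phi>}"
  by (auto simp: circle_maps_def unit_map_def continuous_map_in_subtopology)

lemma restrict_circle_maps: "unit_map Y \<phi> \<Longrightarrow> restrict \<phi> (topspace Y) \<in> carrier (circle_maps Y)"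
  by (simp add: circle_maps_carrier cong: unit_map_cong)

lemma circle_maps_mult: "\<phi> \<otimes>\<^bsub>circle_maps Y\<^esub> \<psi> = (\<lambda>y \<in> topspace Y. \<phi> y * \<psi> y)"
  by (simp add: circle_maps_def)

lemma circle_maps_one: "\<one>\<^bsub>circle_maps Y\<^esub> = (\<lambda>y \<in> topspace Y. 1)"
  by (simp add: circle_maps_def)

lemma cnj_mult_self: "norm z = 1 \<Longrightarrow> cnj z * z = 1"
  by (metis complex_norm_square mult.commute of_real_1 power_one)

lemma circle_maps_comm_group: "comm_group (circle_maps Y)"
proof (rule group.group_comm_groupI)
  show "Group.group (circle_maps Y)"
  proof (rule groupI)
    fix \<phi> \<psi> \<xi> assume \<phi>: "\<phi> \<in> carrier (circle_maps Y)" and \<psi>: "\<psi> \<in> carrier (circle_maps Y)"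
    show "\<phi> \<otimes>\<^bsub>circle_maps Y\<^esub> \<psi> \<in> carrier (circle_maps Y)"
      using \<phi> \<psi> unfolding circle_maps_mult
      by (intro restrict_circle_maps unit_map_mult) (simp_all add: circle_maps_carrier)
    assume \<xi>: "\<xi> \<in> carrier (circle_maps Y)"
    show "\<phi> \<otimes>\<^bsub>circle_maps Y\<^esub> \<psi> \<otimes>\<^bsub>circle_maps Y\<^esub> \<xi> = \<phi> \<otimes>\<^bsub>circle_maps Y\<^esub> (\<psi> \<otimes>\<^bsub>circle_maps Y\<^esub> \<xi>)"
      unfolding circle_maps_mult by (rule restrict_ext) (simp add: mult.assoc)
  next
    show "\<one>\<^bsub>circle_maps Y\<^esub> \<in> carrier (circle_maps Y)"
      unfolding circle_maps_one by (intro restrict_circle_maps unit_map_one)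
    fix \<phi> assume \<phi>: "\<phi> \<in> carrier (circle_maps Y)"
    then have ext: "\<phi> = restrict \<phi> (topspace Y)" and unit: "unit_map Y \<phi>"
      by (simp_all add: circle_maps_carrier extensional_restrict)
    show "\<one>\<^bsub>circle_maps Y\<^esub> \<otimes>\<^bsub>circle_maps Y\<^esub> \<phi> = \<phi>"
      unfolding circle_maps_mult circle_maps_one by (subst (2) ext) (rule restrict_ext, simp)
    have "(\<lambda>y \<in> topspace Y. cnj (\<phi> y)) \<otimes>\<^bsub>circle_maps Y\<^esub> \<phi> = \<one>\<^bsub>circle_maps Y\<^esub>"
      unfolding circle_maps_mult circle_maps_one
      by (rule restrict_ext) (simp add: cnj_mult_self unit_mapD(2)[OF unit])
    then show "\<exists>\<psi> \<in> carrier (circle_maps Y). \<psi> \<otimes>\<^bsub>circle_maps Y\<^esub> \<phi> = \<one>\<^bsub>circle_maps Y\<^esub>"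
      using restrict_circle_maps[OF unit_map_cnj[OF unit]] by blast
  qed
  show "\<phi> \<otimes>\<^bsub>circle_maps Y\<^esub> \<psi> = \<psi> \<otimes>\<^bsub>circle_maps Y\<^esub> \<phi>" for \<phi> \<psi>
    unfolding circle_maps_mult by (rule restrict_ext) (simp add: mult.commute)
qed

lemma circle_maps_inv:
  assumes "unit_map Y \<phi>"
  shows "inv\<^bsub>circle_maps Y\<^esub> (restrict \<phi> (topspace Y)) = (\<lambda>y \<in> topspace Y. cnj (\<phi> y))"
proof -
  interpret C: comm_group "circle_maps Y"
    by (rule circle_maps_comm_group)
  have "(\<lambda>y \<in> topspace Y. cnj (\<phi> y)) \<otimes>\<^bsub>circle_maps Y\<^esub> restrict \<phi> (topspace Y) = \<one>\<^bsub>circle_maps Y\<^esub>"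
    unfolding circle_maps_mult circle_maps_one
    by (rule restrict_ext) (simp add: cnj_mult_self unit_mapD(2)[OF assms])
  then show ?thesis
    by (intro C.inv_equality restrict_circle_maps unit_map_cnj assms)
qed

lemma exp_maps_eq: "exp_maps Y = {\<lambda>y \<in> topspace Y. circ (w y) | w. continuous_map Y euclideanreal w}"
  by (simp add: exp_maps_def circ_def)

lemma subgroup_exp_maps: "subgroup (exp_maps Y) (circle_maps Y)"
proof -
  interpret C: comm_group "circle_maps Y"
    by (rule circle_maps_comm_group)
  show ?thesis
  proof
    show "exp_maps Y \<subseteq> carrier (circle_maps Y)"
      by (auto simp: exp_maps_eq intro: restrict_circle_maps unit_map_circ)
    show "\<one>\<^bsub>circle_maps Y\<^esub> \<in> exp_maps Y"
      unfolding exp_maps_eq circle_maps_one by (intro CollectI exI[of _ "\<lambda>_. 0"]) simp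
  next
    fix \<phi> \<psi> assume "\<phi> \<in> exp_maps Y" "\<psi> \<in> exp_maps Y"
    then obtain w v where w: "continuous_map Y euclideanreal w" "\<phi> = (\<lambda>y \<in> topspace Y. circ (w y))"
      and v: "continuous_map Y euclideanreal v" "\<psi> = (\<lambda>y \<in> topspace Y. circ (v y))"
      unfolding exp_maps_eq by blast
    show "\<phi> \<otimes>\<^bsub>circle_maps Y\<^esub> \<psi> \<in> exp_maps Y"
      unfolding exp_maps_eq circle_maps_mult
      by (intro CollectI exI[of _ "\<lambda>y. w y + v y"])
         (simp add: w v circ_add continuous_map_add cong: restrict_cong)
    have "cnj (circ (w y)) = circ (- w y)" for y
      by (simp add: circ_def cis_cnj)
    then show "inv\<^bsub>circle_maps Y\<^esub> \<phi> \<in> exp_maps Y"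
      unfolding exp_maps_eq w(2) circle_maps_inv[OF unit_map_circ[OF w(1)]]
      by (intro CollectI exI[of _ "\<lambda>y. - w y"]) (simp add: w continuous_map_minus)
  qed
qed

lemma Br_comm_group: "comm_group (Br Y)"
  unfolding Br_def by (rule quotient_comm_group[OF circle_maps_comm_group subgroup_exp_maps])

lemma Br_carrier: "carrier (Br Y) = {Br_class Y \<phi> | \<phi>. unit_map Y \<phi>}"
proof -
  have "Br_class Y \<phi> = exp_maps Y #>\<^bsub>circle_maps Y\<^esub> \<phi>" if "\<phi> \<in> carrier (circle_maps Y)" for \<phi>
    using that by (simp add: Br_class_def circle_maps_carrier extensional_restrict)
  moreover have "Br_class Y \<phi> \<in> carrier (Br Y)" if "unit_map Y \<phi>" for \<phi>
    unfolding Br_def carrier_quotient Br_class_def using restrict_circle_maps[OF that] by blast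
  ultimately show ?thesis
    unfolding Br_def carrier_quotient by (auto simp: circle_maps_carrier)
qed

lemma Br_class_mult:
  assumes "unit_map Y \<phi>" "unit_map Y \<psi>"
  shows "Br_class Y \<phi> \<otimes>\<^bsub>Br Y\<^esub> Br_class Y \<psi> = Br_class Y (\<lambda>y. \<phi> y * \<psi> y)"
  unfolding Br_def Br_class_def
  by (subst quotient_mult[OF circle_maps_comm_group subgroup_exp_maps restrict_circle_maps restrict_circle_maps])
     (simp_all add: assms circle_maps_mult cong: restrict_cong)

lemma Br_class_eq_iff:
  assumes "unit_map Y \<phi>" "unit_map Y \<psi>"
  shows "Br_class Y \<phi> = Br_class Y \<psi> \<longleftrightarrow>
    (\<exists>w. continuous_map Y euclideanreal w \<and> (\<forall>y \<in> topspace Y. \<phi> y = \<psi> y * circ (w y)))"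
proof -
  have "Br_class Y \<phi> = Br_class Y \<psi> \<longleftrightarrow> (\<lambda>y \<in> topspace Y. \<phi> y * cnj (\<psi> y)) \<in> exp_maps Y"
    unfolding Br_class_def
    by (subst quotient_eq_iff[OF circle_maps_comm_group subgroup_exp_maps restrict_circle_maps restrict_circle_maps])
       (simp_all add: assms circle_maps_mult circle_maps_inv cong: restrict_cong)
  also have "\<dots> \<longleftrightarrow> (\<exists>w. continuous_map Y euclideanreal w \<and> (\<forall>y \<in> topspace Y. \<phi> y * cnj (\<psi> y) = circ (w y)))"
  proof -
    have "(\<lambda>y \<in> topspace Y. \<phi> y * cnj (\<psi> y)) = (\<lambda>y \<in> topspace Y. circ (w y)) \<longleftrightarrow>
        (\<forall>y \<in> topspace Y. \<phi> y * cnj (\<psi> y) = circ (w y))" for w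
      by (metis (no_types, lifting) restrict_apply' restrict_ext)
    then show ?thesis
      unfolding exp_maps_eq by blast
  qed
  also have "\<dots> \<longleftrightarrow> (\<exists>w. continuous_map Y euclideanreal w \<and> (\<forall>y \<in> topspace Y. \<phi> y = \<psi> y * circ (w y)))"
  proof -
    have "\<phi> y * cnj (\<psi> y) = circ r \<longleftrightarrow> \<phi> y = \<psi> y * circ r" if y: "y \<in> topspace Y" for y r
    proof
      have unit: "cnj (\<psi> y) * \<psi> y = 1"
        by (rule cnj_mult_self[OF unit_mapD(2)[OF assms(2) y]])
      show "\<phi> y = \<psi> y * circ r" if "\<phi> y * cnj (\<psi> y) = circ r"
        unfolding that[symmetric] using unit by (simp add: mult.left_commute mult.commute)
      show "\<phi> y * cnj (\<psi> y) = circ r" if "\<phi> y = \<psi> y * circ r"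
        unfolding that using unit by (simp add: mult.left_commute mult.commute)
    qed
    then have "(\<forall>y \<in> topspace Y. \<phi> y * cnj (\<psi> y) = circ (w y)) \<longleftrightarrow>
        (\<forall>y \<in> topspace Y. \<phi> y = \<psi> y * circ (w y))" for w
      by (intro ball_cong refl)
    then show ?thesis
      by simp
  qed
  finally show ?thesis .
qed

lemma Br_one: "\<one>\<^bsub>Br Y\<^esub> = Br_class Y (\<lambda>_. 1)"
proof -
  interpret comm_group "Br Y"
    by (rule Br_comm_group)
  have cl: "Br_class Y (\<lambda>_. 1) \<in> carrier (Br Y)"
    using unit_map_one by (auto simp: Br_carrier)
  moreover have "Br_class Y (\<lambda>_. 1) \<otimes>\<^bsub>Br Y\<^esub> Br_class Y (\<lambda>_. 1) = Br_class Y (\<lambda>_. 1)"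
    by (simp add: Br_class_mult unit_map_one)
  ultimately show ?thesis
    by (metis l_cancel_one)
qed

text \<open>If every \<open>n\<close> failed, the pairs that agree up to coordinate \<open>n\<close>
  but have values at distance at least \<open>\<epsilon>\<close> would form decreasing nonempty
  closed sets in a compact square. A common pair agrees in all coordinates, so its two points are
  equal. It is applied to the limit and to the full product.\<close>

lemma separated_uniform:
  fixes \<Phi> :: "'z \<Rightarrow> 'm::metric_space" and p :: "nat \<Rightarrow> 'z \<Rightarrow> 'a"
  assumes Z: "compact_space Z" and p: "\<And>i. continuous_map Z (Y i) (p i)" and Y: "\<And>i. Hausdorff_space (Y i)"
    and sep: "\<And>z w. z \<in> topspace Z \<Longrightarrow> w \<in> topspace Z \<Longrightarrow> (\<And>i. p i z = p i w) \<Longrightarrow> z = w"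
    and \<Phi>: "continuous_map Z euclidean \<Phi>" and "\<epsilon> > 0"
  shows "\<exists>n. \<forall>z \<in> topspace Z. \<forall>w \<in> topspace Z. (\<forall>i \<le> n. p i z = p i w) \<longrightarrow> dist (\<Phi> z) (\<Phi> w) < \<epsilon>"
proof (rule ccontr)
  assume contra: "\<not> ?thesis"
  let ?ZZ = "prod_topology Z Z"
  define C where "C n = {q \<in> topspace ?ZZ. \<epsilon> \<le> dist (\<Phi> (fst q)) (\<Phi> (snd q))} \<inter>
    (\<Inter>i\<in>{..n}. {q \<in> topspace ?ZZ. p i (fst q) = p i (snd q)})" for n :: nat
  have "closedin ?ZZ {q \<in> topspace ?ZZ. \<epsilon> \<le> dist (\<Phi> (fst q)) (\<Phi> (snd q))}"
  proof -
    have "continuous_map ?ZZ euclidean (\<lambda>q. dist (\<Phi> (fst q)) (\<Phi> (snd q)))"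
      using continuous_map_compose[OF continuous_map_fst \<Phi>, of Z] continuous_map_compose[OF continuous_map_snd \<Phi>, of Z]
      by (simp add: o_def continuous_map_atin tendsto_dist)
    then show ?thesis
      using closedin_continuous_map_preimage[of ?ZZ euclideanreal _ "{\<epsilon>..}"] by simp
  qed
  moreover have "closedin ?ZZ {q \<in> topspace ?ZZ. p i (fst q) = p i (snd q)}" for i
    using closedin_continuous_maps_eq[OF Y[of i] continuous_map_compose[OF continuous_map_fst p]
        continuous_map_compose[OF continuous_map_snd p]] by (simp add: o_def)
  ultimately have "closedin ?ZZ (C n)" for n
    unfolding C_def by (intro closedin_Int closedin_Inter) auto
  moreover have "C n \<noteq> {}" for n
  proof -
    obtain z w where "z \<in> topspace Z" "w \<in> topspace Z" "\<forall>i \<le> n. p i z = p i w" "\<not> dist (\<Phi> z) (\<Phi> w) < \<epsilon>"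
      using contra by blast
    then have "(z, w) \<in> C n"
      by (auto simp: C_def)
    then show ?thesis by blast
  qed
  moreover have "decseq C"
    by (auto simp: decseq_def C_def)
  moreover have "compact_space ?ZZ"
    using Z by (simp add: compact_space_prod_topology)
  ultimately have "(\<Inter>n. C n) \<noteq> {}"
    by (intro compact_space_imp_nest) auto
  then obtain q where q: "\<And>n. q \<in> C n"
    by blast
  have "p i (fst q) = p i (snd q)" for i
    using q[of i] by (auto simp: C_def)
  moreover have "fst q \<in> topspace Z" "snd q \<in> topspace Z" "\<epsilon> \<le> dist (\<Phi> (fst q)) (\<Phi> (snd q))"
    using q[of 0] by (auto simp: C_def)
  ultimately show False
    using sep[of "fst q" "snd q"] \<open>\<epsilon> > 0\<close> by simp
qed

section \<open>The inverse limit\<close>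

locale graph_sequence =
  fixes X :: "nat \<Rightarrow> ('a, 'e) graph" and f :: "nat \<Rightarrow> 'a \<Rightarrow> 'a"
  assumes presentation: "presentation X f"
begin

sublocale digraph "X k" for k
  using presentation by unfold_locales (simp add: presentation_def)

sublocale step: graph_morphism "X (Suc k)" "X k" "f (Suc k)" for k
  using presentation by unfold_locales (simp_all add: presentation_def)

abbreviation L :: "(nat \<Rightarrow> 'a) topology" where
  "L \<equiv> inverse_limit X f"

abbreviation P :: "(nat \<Rightarrow> 'a) topology" where
  "P \<equiv> product_topology (\<lambda>k. gspace (X k)) UNIV"

lemma topspace_L: "topspace L = {x. (\<forall>k. x k \<in> topspace (gspace (X k))) \<and> (\<forall>k. f (Suc k) (x (Suc k)) = x k)}"
  by (auto simp: inverse_limit_def)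

lemma L_coord: "x \<in> topspace L \<Longrightarrow> x k \<in> topspace (gspace (X k))"
  by (simp add: topspace_L)

lemma coord_continuous: "continuous_map L (gspace (X k)) (\<lambda>x. x k)"
  unfolding inverse_limit_def
  by (rule continuous_map_from_subtopology) (rule continuous_map_product_projection, simp)

lemma compact_P: "compact_space P" and Hausdorff_P: "Hausdorff_space P"
  using compact Hausdorff by (simp_all add: compact_space_product_topology Hausdorff_space_product_topology)

lemma closedin_L: "closedin P (topspace L)"
proof -
  have "closedin P {x \<in> topspace P. f (Suc k) (x (Suc k)) = x k}" for k
  proof (rule closedin_continuous_maps_eq[OF Hausdorff])
    show "continuous_map P (gspace (X k)) (\<lambda>x. f (Suc k) (x (Suc k)))"
      using continuous_map_compose[OF continuous_map_product_projection[of "Suc k" UNIV "\<lambda>k. gspace (X k)"] step.continuous]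
      by (simp add: o_def)
    show "continuous_map P (gspace (X k)) (\<lambda>x. x k)"
      by (rule continuous_map_product_projection) simp
  qed
  then have "closedin P (\<Inter>k. {x \<in> topspace P. f (Suc k) (x (Suc k)) = x k})"
    by (intro closedin_Inter) auto
  moreover have "(\<Inter>k. {x \<in> topspace P. f (Suc k) (x (Suc k)) = x k}) = topspace L"
    by (auto simp: inverse_limit_def)
  ultimately show ?thesis by simp
qed

text \<open>This form makes facts about the subspace of \<open>P\<close> carried by a closed set
  available, notably compactness and Tietze extension.\<close>

lemma L_eq: "L = subtopology P (topspace L)"
  unfolding inverse_limit_def topspace_subtopology by (metis subtopology_restrict)

lemma compact_L: "compact_space L"
  using closedin_compact_space[OF compact_P closedin_L] L_eq by (metis compact_space_subtopology)

lemma bonding_L: "x \<in> topspace L \<Longrightarrow> bonding f k n (x (k + n)) = x k"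
  by (induction n) (simp_all add: topspace_L)

lemma bonding_Suc_left: "bonding f k (Suc n) y = f (Suc k) (bonding f (Suc k) n y)"
  by (induction n arbitrary: y) simp_all

lemma bonding_continuous: "continuous_map (gspace (X (k + n))) (gspace (X k)) (bonding f k n)"
proof (induction n)
  case (Suc n)
  then show ?case
    using continuous_map_compose[OF step.continuous[of "k + n"] Suc]
    by (simp only: bonding.simps add_Suc_right)
qed simp

lemma bonding_verts: "bonding f k n ` gverts (X (k + n)) \<subseteq> gverts (X k)"
proof (induction n)
  case (Suc n)
  have "f (k + Suc n) ` gverts (X (k + Suc n)) \<subseteq> gverts (X (k + n))"
    using step.verts[of "k + n"] by simp
  then show ?case
    using Suc by (auto simp: image_subset_iff)
qed simp

lemma bonding_op_path:
  "is_interval I \<Longrightarrow> graph_op_path (X (k + n)) I q \<Longrightarrow> graph_op_path (X k) I (bonding f k n \<circ> q)"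
proof (induction n arbitrary: q)
  case (Suc n)
  have "graph_op_path (X (k + n)) I (f (k + Suc n) \<circ> q)"
    using step.op_map[of "k + n"] Suc.prems by (simp add: graph_op_map_def)
  from Suc.IH[OF Suc.prems(1) this] show ?case
    by (simp add: o_assoc)
qed simp

text \<open>Completes a compatible sequence that begins at level \<open>k\<close>: the entry
  \<open>y n\<close> belongs to level \<open>k + n\<close>, and lower coordinates are images of
  \<open>y 0\<close>.\<close>

definition thread :: "nat \<Rightarrow> (nat \<Rightarrow> 'a) \<Rightarrow> nat \<Rightarrow> 'a" where
  "thread k y j = (if k \<le> j then y (j - k) else bonding f j (k - j) (y 0))"

lemma thread_L:
  assumes "\<And>n. y n \<in> topspace (gspace (X (k + n)))" "\<And>n. f (Suc (k + n)) (y (Suc n)) = y n"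
  shows "thread k y \<in> topspace L"
  unfolding topspace_L
proof (intro CollectI conjI allI)
  fix j
  show "thread k y j \<in> topspace (gspace (X j))"
  proof (cases "k \<le> j")
    case True
    then show ?thesis
      using assms(1)[of "j - k"] by (simp add: thread_def)
  next
    case False
    then show ?thesis
      using assms(1)[of 0] continuous_map_image_subset_topspace[OF bonding_continuous[of j "k - j"]]
      by (auto simp: thread_def)
  qed
  show "f (Suc j) (thread k y (Suc j)) = thread k y j"
  proof (cases "k \<le> j")
    case True
    then show ?thesis
      using assms(2)[of "j - k"] by (simp add: thread_def Suc_diff_le)
  next
    case False
    then have "k - j = Suc (k - Suc j)"
      by simp
    then have "thread k y j = f (Suc j) (bonding f (Suc j) (k - Suc j) (y 0))"
      using False bonding_Suc_left by (simp only: thread_def if_False)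
    moreover have "thread k y (Suc j) = bonding f (Suc j) (k - Suc j) (y 0)"
      using False by (cases "k = Suc j") (auto simp: thread_def)
    ultimately show ?thesis by simp
  qed
qed

lemma thread_at [simp]: "thread k y (k + n) = y n" "thread k y k = y 0"
  by (simp_all add: thread_def)

text \<open>As the bonding maps are onto, preimages can be chosen level after level.\<close>

lemma coord_surj:
  assumes "v \<in> topspace (gspace (X k))"
  obtains x where "x \<in> topspace L" "x k = v"
proof -
  have "\<exists>y. y 0 = v \<and> (\<forall>n. y n \<in> topspace (gspace (X (k + n))) \<and> f (Suc (k + n)) (y (Suc n)) = y n)"
  proof -
    have "\<exists>y. \<forall>n. (y n \<in> topspace (gspace (X (k + n))) \<and> (n = 0 \<longrightarrow> y n = v)) \<and> f (Suc (k + n)) (y (Suc n)) = y n"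
    proof (rule dependent_nat_choice)
      show "\<exists>x. x \<in> topspace (gspace (X (k + 0))) \<and> (0 = 0 \<longrightarrow> x = v)"
        using assms by simp
      fix x n assume "x \<in> topspace (gspace (X (k + n))) \<and> (n = 0 \<longrightarrow> x = v)"
      then have "x \<in> f (Suc (k + n)) ` topspace (gspace (X (Suc (k + n))))"
        using step.onto[of "k + n"] by simp
      then show "\<exists>y. (y \<in> topspace (gspace (X (k + Suc n))) \<and> (Suc n = 0 \<longrightarrow> y = v)) \<and> f (Suc (k + n)) y = x"
        by auto
    qed
    then show ?thesis by blast
  qed
  then obtain y where y: "y 0 = v" "\<And>n. y n \<in> topspace (gspace (X (k + n)))" "\<And>n. f (Suc (k + n)) (y (Suc n)) = y n"
    by blast
  show thesis
    using that[OF thread_L[OF y(2,3)]] y(1) by simp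
qed

text \<open>A continuous map from a compact space onto a Hausdorff space is closed. Hence a function
  that is constant on the fibres descends continuously to \<open>X k\<close>.\<close>

lemma coord_quotient_map: "quotient_map L (gspace (X k)) (\<lambda>x. x k)"
proof (rule continuous_closed_imp_quotient_map[OF coord_continuous])
  show "closed_map L (gspace (X k)) (\<lambda>x. x k)"
    using compact_L Hausdorff_imp_kc_space[OF Hausdorff] coord_continuous by (rule continuous_imp_closed_map_gen)
  show "(\<lambda>x. x k) ` topspace L = topspace (gspace (X k))"
  proof
    show "topspace (gspace (X k)) \<subseteq> (\<lambda>x. x k) ` topspace L"
    proof
      fix v assume v: "v \<in> topspace (gspace (X k))"
      obtain x where "x \<in> topspace L" "x k = v"
        using v by (rule coord_surj)
      then show "v \<in> (\<lambda>x. x k) ` topspace L"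
        by blast
    qed
  qed (use L_coord in blast)
qed

lemma L_agree_below:
  assumes "x \<in> topspace L" "y \<in> topspace L" "x n = y n" "i \<le> n"
  shows "x i = y i"
  using bonding_L[OF assms(1), of i "n - i"] bonding_L[OF assms(2), of i "n - i"] assms(3,4) by simp

text \<open>Agreement in coordinate \<open>m\<close> entails agreement in all lower ones, so
  \<open>separated_uniform\<close> bounds the oscillation on the fibres of every high
  projection.\<close>

lemma fibre_oscillation:
  fixes u :: "(nat \<Rightarrow> 'a) \<Rightarrow> 'm::metric_space"
  assumes "continuous_map L euclidean u" "\<epsilon> > 0"
  obtains n where "\<And>m x y. n \<le> m \<Longrightarrow> x \<in> topspace L \<Longrightarrow> y \<in> topspace L \<Longrightarrow> x m = y m \<Longrightarrow> dist (u x) (u y) < \<epsilon>"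
proof -
  have "\<exists>n. \<forall>x \<in> topspace L. \<forall>y \<in> topspace L. (\<forall>i \<le> n. x i = y i) \<longrightarrow> dist (u x) (u y) < \<epsilon>"
    by (rule separated_uniform[OF compact_L coord_continuous Hausdorff _ assms]) auto
  then obtain n where n: "\<forall>x \<in> topspace L. \<forall>y \<in> topspace L. (\<forall>i \<le> n. x i = y i) \<longrightarrow> dist (u x) (u y) < \<epsilon>"
    by blast
  show thesis
  proof (rule that)
    fix m x y assume "n \<le> m" and xy: "x \<in> topspace L" "y \<in> topspace L" "x m = y m"
    then have "\<forall>i \<le> n. x i = y i"
      using L_agree_below[OF xy] by simp
    then show "dist (u x) (u y) < \<epsilon>"
      using n xy by blast
  qed
qed

lemma unit_map_coord: "unit_map L (\<lambda>x. edge_circle_map (X k) g (x k))"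
  using unit_map_compose[OF coord_continuous, of _ "edge_circle_map (X k) g"]
    edge_circle_map_continuous norm_edge_circle_map by (simp add: unit_map_def)

text \<open>A circle map on the limit extends to a complex function on the product; restricted to the
  threads that are constant beyond the \<open>n\<close>-th coordinate it descends to \<open>X n\<close>, and for large \<open>n\<close>
  it is so close to the original map that their quotient has a logarithm.\<close>

lemma circle_map_from_level:
  assumes \<phi>: "unit_map L \<phi>"
  obtains n \<psi> w where "unit_map (gspace (X n)) \<psi>" "continuous_map L euclideanreal w"
    "\<forall>x \<in> topspace L. \<phi> x = \<psi> (x n) * circ (w x)"
proof (cases "topspace L = {}")
  case True
  show thesis
    by (rule that[of 0 "\<lambda>_. 1" "\<lambda>_. 0"]) (simp_all add: True unit_map_one)
next
  case False
  then obtain b where b: "b \<in> topspace L"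
    by blast
  have normal: "normal_space P"
    using compact_Hausdorff_or_regular_imp_normal_space compact_P Hausdorff_P by blast
  have ext: "\<exists>g. continuous_map P euclideanreal g \<and> (\<forall>x \<in> topspace L. g x = h x)"
    if h: "continuous_map L euclideanreal h" for h
  proof -
    have "continuous_map (subtopology P (topspace L)) euclideanreal h"
      using h by (simp only: L_eq[symmetric])
    then show ?thesis
      by (rule Tietze_extension_realinterval[OF normal closedin_L is_interval_univ UNIV_not_empty]) auto
  qed
  have ReIm: "continuous_map L euclideanreal (\<lambda>x. Re (\<phi> x))" "continuous_map L euclideanreal (\<lambda>x. Im (\<phi> x))"
    using continuous_map_then[OF unit_mapD(1)[OF \<phi>] continuous_on_Re[OF continuous_on_id]]
      continuous_map_then[OF unit_mapD(1)[OF \<phi>] continuous_on_Im[OF continuous_on_id]] .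
  obtain g1 where g1: "continuous_map P euclideanreal g1" "\<forall>x \<in> topspace L. g1 x = Re (\<phi> x)"
    using ext[OF ReIm(1)] by (elim exE conjE)
  obtain g2 where g2: "continuous_map P euclideanreal g2" "\<forall>x \<in> topspace L. g2 x = Im (\<phi> x)"
    using ext[OF ReIm(2)] by (elim exE conjE)
  note g = g1 g2
  define \<Phi> where "\<Phi> x = Complex (g1 x) (g2 x)" for x
  have \<Phi>: "continuous_map P euclidean \<Phi>"
    using g(1,3) unfolding \<Phi>_def by (simp add: continuous_map_atin tendsto_Complex)
  have \<Phi>\<phi>: "\<Phi> x = \<phi> x" if "x \<in> topspace L" for x
    using g(2,4) that by (simp add: \<Phi>_def complex_eq_iff)
  have "\<exists>n. \<forall>z \<in> topspace P. \<forall>w \<in> topspace P. (\<forall>i \<le> n. z i = w i) \<longrightarrow> dist (\<Phi> z) (\<Phi> w) < 1"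
    by (rule separated_uniform[OF compact_P continuous_map_product_projection Hausdorff _ \<Phi>]) auto
  then obtain n where n: "\<And>z w. z \<in> topspace P \<Longrightarrow> w \<in> topspace P \<Longrightarrow> \<forall>i \<le> n. z i = w i \<Longrightarrow> dist (\<Phi> z) (\<Phi> w) < 1"
    by blast
  \<comment> \<open>Above level \<open>n\<close> the coordinates are those of a fixed thread
    \<open>b\<close>, so \<open>j y\<close> need not be a thread. This is why \<open>\<Phi>\<close>
    must live on the whole product.\<close>
  define j where "j y i = (if i \<le> n then bonding f i (n - i) y else b i)" for y i
  have j_cont: "continuous_map (gspace (X n)) P j"
    unfolding continuous_map_componentwise_UNIV
  proof
    fix i
    show "continuous_map (gspace (X n)) (gspace (X i)) (\<lambda>y. j y i)"
    proof (cases "i \<le> n")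
      case True
      then show ?thesis
        using bonding_continuous[of i "n - i"] by (simp add: j_def)
    next
      case False
      then show ?thesis
        using L_coord[OF b] by (simp add: j_def)
    qed
  qed
  define \<psi>0 where "\<psi>0 y = \<Phi> (j y)" for y
  have close: "norm (\<psi>0 (x n) - \<phi> x) < 1" if x: "x \<in> topspace L" for x
  proof -
    have "j (x n) \<in> topspace P"
      using continuous_map_image_subset_topspace[OF j_cont] L_coord[OF x] by blast
    moreover have "x \<in> topspace P"
      using x by (simp add: inverse_limit_def)
    moreover have "\<forall>i \<le> n. j (x n) i = x i"
      using bonding_L[OF x] by (metis j_def le_add_diff_inverse)
    ultimately have "dist (\<Phi> (j (x n))) (\<Phi> x) < 1"
      by (rule n)
    then show ?thesis
      using \<Phi>\<phi>[OF x] by (simp add: \<psi>0_def dist_norm)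
  qed
  have nonzero: "\<psi>0 (x n) \<noteq> 0" if x: "x \<in> topspace L" for x
    using close[OF x] unit_mapD(2)[OF \<phi> x] by auto
  have \<psi>0_cont: "continuous_map (gspace (X n)) euclidean \<psi>0"
    using continuous_map_compose[OF j_cont \<Phi>] unfolding \<psi>0_def o_def .
  define \<psi> where "\<psi> y = \<psi>0 y / of_real (norm (\<psi>0 y))" for y
  have \<psi>0_nz: "\<psi>0 y \<noteq> 0" if y: "y \<in> topspace (gspace (X n))" for y
  proof -
    obtain x where "x \<in> topspace L" "x n = y"
      using y by (rule coord_surj)
    then show ?thesis
      using nonzero by blast
  qed
  have \<psi>: "unit_map (gspace (X n)) \<psi>"
    unfolding unit_map_def
  proof
    show "continuous_map (gspace (X n)) euclidean \<psi>"
      using \<psi>0_cont \<psi>0_nz unfolding \<psi>_def continuous_map_atin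
      by (auto intro!: tendsto_intros)
    show "\<forall>y \<in> topspace (gspace (X n)). norm (\<psi> y) = 1"
      using \<psi>0_nz by (simp add: \<psi>_def norm_divide)
  qed
  \<comment> \<open>Modulus \<open>1\<close> of \<open>\<phi>\<close> and distance less than
    \<open>1\<close> to \<open>\<psi>0\<close> put \<open>q\<close> into the right half plane, where
    the principal logarithm is continuous.\<close>
  define q where "q x = \<phi> x * cnj (\<psi>0 (x n))" for x
  have Re_q: "0 < Re (q x)" if x: "x \<in> topspace L" for x
  proof -
    have "norm (1 - q x) = norm (\<phi> x * cnj (\<phi> x - \<psi>0 (x n)))"
      using cnj_mult_self[OF unit_mapD(2)[OF \<phi> x]] by (simp add: q_def right_diff_distrib mult.commute)
    also have "\<dots> < 1"
      using close[OF x] unit_mapD(2)[OF \<phi> x] by (simp add: norm_mult norm_minus_commute flip: complex_cnj_diff)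
    finally have "norm (1 - q x) < 1" .
    moreover have "Re (1 - q x) \<le> norm (1 - q x)"
      by (rule complex_Re_le_cmod)
    ultimately show ?thesis
      by simp
  qed
  define w where "w x = Im (Ln (q x)) / (2 * pi)" for x
  have w: "continuous_map L euclideanreal w"
  proof -
    have "continuous_map L euclidean (\<lambda>x. \<psi>0 (x n))"
      using continuous_map_compose[OF coord_continuous \<psi>0_cont] by (simp add: o_def)
    then have "continuous_map L euclidean q"
      using unit_mapD(1)[OF \<phi>] unfolding q_def continuous_map_atin by (simp add: tendsto_mult tendsto_cnj)
    then have "continuous_map L (top_of_set {z. 0 < Re z}) q"
      using Re_q by (auto simp: continuous_map_in_subtopology)
    moreover have "continuous_on {z. 0 < Re z} (\<lambda>z. Im (Ln z) / (2 * pi))"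
      by (intro continuous_intros) (auto simp: complex_nonpos_Reals_iff)
    ultimately show ?thesis
      using continuous_map_compose[of L _ q euclideanreal "\<lambda>z. Im (Ln z) / (2 * pi)"] unfolding o_def w_def by simp
  qed
  have "\<phi> x = \<psi> (x n) * circ (w x)" if x: "x \<in> topspace L" for x
  proof -
    have "q x \<noteq> 0"
      using Re_q[OF x] by auto
    then have "circ (w x) = q x / of_real (norm (q x))"
      by (simp add: circ_def w_def Arg_def[symmetric] cis_Arg sgn_eq flip: Arg_eq_Im_Ln)
    also have "norm (q x) = norm (\<psi>0 (x n))"
      using unit_mapD(2)[OF \<phi> x] by (simp add: q_def norm_mult)
    finally have "\<psi> (x n) * circ (w x) = \<phi> x * (cnj (\<psi>0 (x n)) * \<psi>0 (x n)) / (of_real (norm (\<psi>0 (x n))))\<^sup>2"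
      by (simp add: \<psi>_def q_def power2_eq_square mult_ac)
    also have "cnj (\<psi>0 (x n)) * \<psi>0 (x n) = (of_real (norm (\<psi>0 (x n))))\<^sup>2"
      by (metis complex_norm_square mult.commute of_real_power)
    finally show ?thesis
      using nonzero[OF x] by simp
  qed
  then show thesis
    using that[OF \<psi> w] by blast
qed

text \<open>At the finite level the circle map splits into that of a cochain and an exponential;
  both exponential corrections disappear in the class.\<close>

lemma Br_class_surj:
  assumes "unit_map L \<phi>"
  obtains n g where "g \<in> carrier (edge_fun_group (X n))"
    "Br_class L \<phi> = Br_class L (\<lambda>x. edge_circle_map (X n) g (x n))"
proof -
  obtain n \<psi> w where \<psi>: "unit_map (gspace (X n)) \<psi>" and w: "continuous_map L euclideanreal w"
    "\<forall>x \<in> topspace L. \<phi> x = \<psi> (x n) * circ (w x)"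
    using circle_map_from_level[OF assms] by blast
  obtain g v where g: "g \<in> carrier (edge_fun_group (X n))" and v: "continuous_map (gspace (X n)) euclideanreal v"
    "\<forall>x \<in> topspace (gspace (X n)). \<psi> x = edge_circle_map (X n) g x * circ (v x)"
    using circle_map_decompose[OF unit_mapD[OF \<psi>]] by metis
  have "continuous_map L euclideanreal (\<lambda>x. v (x n))"
    using continuous_map_compose[OF coord_continuous v(1)] by (simp add: o_def)
  then have "continuous_map L euclideanreal (\<lambda>x. v (x n) + w x)"
    using w(1) by (rule continuous_map_add)
  moreover have "\<phi> x = edge_circle_map (X n) g (x n) * circ (v (x n) + w x)" if "x \<in> topspace L" for x
    using w(2) v(2) L_coord[OF that] that by (simp add: circ_add)
  ultimately have "Br_class L \<phi> = Br_class L (\<lambda>x. edge_circle_map (X n) g (x n))"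
    unfolding Br_class_eq_iff[OF assms unit_map_coord] by blast
  then show thesis
    using g that by blast
qed

text \<open>The transition maps on cochains instead of classes, so that signs of values on edges
  remain visible.\<close>

primrec pull_iter :: "nat \<Rightarrow> nat \<Rightarrow> ('e \<Rightarrow> int) \<Rightarrow> ('e \<Rightarrow> int)" where
  "pull_iter k 0 g = g"
| "pull_iter k (Suc n) g = pull_fun (X (Suc (k + n))) (X (k + n)) (f (Suc (k + n))) (pull_iter k n g)"

lemma pull_iter_carrier:
  "g \<in> carrier (edge_fun_group (X k)) \<Longrightarrow> pull_iter k n g \<in> carrier (edge_fun_group (X (k + n)))"
  by (cases n) (simp_all add: step.pull_fun_carrier)

lemma transition_graph_class:
  assumes "g \<in> carrier (edge_fun_group (X k))"
  shows "transition (\<lambda>k. pull_class (X (Suc k)) (X k) (f (Suc k))) k n (graph_class (X k) g) =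
    graph_class (X (k + n)) (pull_iter k n g)"
  by (induction n) (simp_all add: step.pull_class_graph_class pull_iter_carrier[OF assms])

text \<open>The correction is a function of the coordinate \<open>x (k + n)\<close> alone, so it
  does not vary on the fibres; the oscillation arguments below rely on this.\<close>

lemma pull_iter_circle_map:
  obtains v where "continuous_map (gspace (X (k + n))) euclideanreal v"
    "\<forall>x \<in> topspace L. edge_circle_map (X k) g (x k) =
       edge_circle_map (X (k + n)) (pull_iter k n g) (x (k + n)) * circ (v (x (k + n)))"
proof -
  have "\<exists>v. continuous_map (gspace (X (k + n))) euclideanreal v \<and>
    (\<forall>x \<in> topspace L. edge_circle_map (X k) g (x k) =
       edge_circle_map (X (k + n)) (pull_iter k n g) (x (k + n)) * circ (v (x (k + n))))"
  proof (induction n)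
    case 0
    show ?case
      by (rule exI[of _ "\<lambda>_. 0"]) simp
  next
    case (Suc n)
    then obtain v where v: "continuous_map (gspace (X (k + n))) euclideanreal v"
      "\<forall>x \<in> topspace L. edge_circle_map (X k) g (x k) =
       edge_circle_map (X (k + n)) (pull_iter k n g) (x (k + n)) * circ (v (x (k + n)))"
      by blast
    obtain w where w: "continuous_map (gspace (X (Suc (k + n)))) euclideanreal w"
      "\<forall>y \<in> topspace (gspace (X (Suc (k + n)))). edge_circle_map (X (k + n)) (pull_iter k n g) (f (Suc (k + n)) y) =
         edge_circle_map (X (Suc (k + n))) (pull_iter k (Suc n) g) y * circ (w y)"
      using step.edge_circle_map_pull[of "k + n" "pull_iter k n g"] by (metis pull_iter.simps(2))
    let ?v = "\<lambda>y. w y + v (f (Suc (k + n)) y)"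
    have "continuous_map (gspace (X (k + Suc n))) euclideanreal ?v"
      using w(1) continuous_map_compose[OF step.continuous v(1)] by (simp add: o_def continuous_map_add)
    moreover have "edge_circle_map (X k) g (x k) =
       edge_circle_map (X (k + Suc n)) (pull_iter k (Suc n) g) (x (k + Suc n)) * circ (?v (x (k + Suc n)))"
      if x: "x \<in> topspace L" for x
    proof -
      have "f (Suc (k + n)) (x (Suc (k + n))) = x (k + n)"
        using x by (simp add: topspace_L)
      then show ?thesis
        using v(2) w(2) x L_coord[OF x, of "Suc (k + n)"] by (auto simp: circ_add mult.assoc)
    qed
    ultimately show ?case
      by blast
  qed
  then show thesis
    using that by blast
qed

text \<open>The logarithm is integral up to a function on \<open>X m\<close> and hence, once it oscillates little on the
  fibres, constant on them; so it descends to \<open>X m\<close>.\<close>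

lemma class_trivial_if_exp:
  assumes g: "g \<in> carrier (edge_fun_group (X k))" and w: "continuous_map L euclideanreal w"
    and lift: "\<forall>x \<in> topspace L. edge_circle_map (X k) g (x k) = circ (w x)"
  shows "\<exists>n p. \<forall>e \<in> gedges (X (k + n)).
    pull_iter k n g e = p (gparam (X (k + n)) e 1) - p (gparam (X (k + n)) e 0)"
proof -
  obtain n where n: "\<And>m x y. n \<le> m \<Longrightarrow> x \<in> topspace L \<Longrightarrow> y \<in> topspace L \<Longrightarrow> x m = y m \<Longrightarrow> dist (w x) (w y) < 1"
    using fibre_oscillation[OF w, of 1] by auto
  let ?m = "k + n"
  obtain v where v: "continuous_map (gspace (X ?m)) euclideanreal v"
    "\<forall>x \<in> topspace L. edge_circle_map (X k) g (x k) =
       edge_circle_map (X ?m) (pull_iter k n g) (x ?m) * circ (v (x ?m))"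
    by (rule pull_iter_circle_map)
  define h where "h x = w x - v (x ?m)" for x
  have h: "continuous_map L euclideanreal h"
    using w continuous_map_compose[OF coord_continuous v(1)]
    unfolding h_def by (intro continuous_map_diff) (simp_all add: o_def)
  have lift_h: "edge_circle_map (X ?m) (pull_iter k n g) (x ?m) = circ (h x)" if "x \<in> topspace L" for x
    using lift v(2) that by (auto simp: h_def circ_diff field_simps)
  have descend: "h x = h y" if xy: "x \<in> topspace L" "y \<in> topspace L" "x ?m = y ?m" for x y
  proof -
    have "circ (h x) = circ (h y)"
      using lift_h[OF xy(1)] lift_h[OF xy(2)] xy(3) by simp
    then have "h x - h y \<in> \<int>"
      by (simp add: circ_eq_iff)
    moreover have "\<bar>h x - h y\<bar> < 1"
      using n[of ?m x y] xy by (simp add: h_def dist_real_def)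
    ultimately show ?thesis
      using Ints_nonzero_abs_less1 by fastforce
  qed
  have "\<exists>h'. continuous_map (gspace (X ?m)) euclideanreal h' \<and> (\<forall>x \<in> topspace L. h' (x ?m) = h x)"
    by (rule quotient_map_lift_exists[OF coord_quotient_map[of ?m] h]) (use descend in blast)+
  then obtain h' where h': "continuous_map (gspace (X ?m)) euclideanreal h'" "\<forall>x \<in> topspace L. h' (x ?m) = h x"
    by blast
  have "edge_circle_map (X ?m) (pull_iter k n g) y = circ (h' y)" if y: "y \<in> topspace (gspace (X ?m))" for y
  proof -
    obtain x where "x \<in> topspace L" "x ?m = y"
      using y by (rule coord_surj)
    then show ?thesis
      using lift_h h'(2) by metis
  qed
  then show ?thesis
    using coboundary_if_lift[OF h'(1)] by blast
qed

end

section \<open>Charts and lifts of edges\<close>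

text \<open>Clopen sets separate the points of the space and cannot cut a connected set.\<close>

lemma dim_0_connected_constant:
  assumes "X dim_le 0" "Hausdorff_space X" "connectedin X C" "x \<in> C" "y \<in> C"
  shows "x = y"
proof (rule ccontr)
  assume "x \<noteq> y"
  have xy: "x \<in> topspace X" "y \<in> topspace X"
    using assms(3-5) connectedin_subset_topspace by blast+
  have "openin X (topspace X - {y})"
    using closedin_Hausdorff_singleton[OF assms(2) xy(2)] by (simp add: openin_diff)
  then obtain U V where V: "openin X U" "closedin X V \<and> openin X V" "x \<in> U" "U \<subseteq> V" "V \<subseteq> topspace X - {y}"
    using assms(1) xy(1) \<open>x \<noteq> y\<close>
    unfolding dimension_le_0_neighbourhood_base_of_clopen neighbourhood_base_of by (metis Diff_iff singletonD)
  then have "C \<subseteq> V \<or> disjnt C V"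
    using connectedin_clopen_cases[OF assms(3)] by blast
  then show False
    using V assms(4,5) by (auto simp: disjnt_def)
qed

context
  fixes B :: "'s matchbox"
  assumes B: "matchbox B"
begin

lemma mb_glue_self: "x \<in> topspace (mb_prespace B) \<Longrightarrow> x \<in> mb_glue B `` {x}"
  by (cases x) (auto simp: mb_glue_def)

lemma mb_proj_class:
  assumes "x \<in> topspace (mb_prespace B)"
  shows "mb_proj (mb_glue B `` {x}) = snd x"
proof -
  have "snd ` (mb_glue B `` {x}) = {snd x}"
    using mb_glue_self[OF assms] by (auto simp: mb_glue_def)
  then show ?thesis
    by (simp add: mb_proj_def)
qed

lemma mb_class_singleton:
  assumes "x \<in> topspace (mb_prespace B)" "snd x \<noteq> 0"
  shows "mb_glue B `` {x} = {x}"
  using mb_glue_self[OF assms(1)] assms(2) by (auto simp: mb_glue_def)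

lemma mb_topology_cases:
  assumes "A \<in> topspace (mb_topology B)"
  obtains x where "x \<in> topspace (mb_prespace B)" "A = mb_glue B `` {x}"
  using assms by (auto simp: mb_topology_def topspace_quotient_topology quotient_def)

lemma mb_quotient_map: "quotient_map (mb_prespace B) (mb_topology B) (\<lambda>x. mb_glue B `` {x})"
  unfolding mb_topology_def by (rule quotient_map_quotient_topology)

lemma mb_proj_continuous: "continuous_map (mb_topology B) euclideanreal mb_proj"
proof (rule continuous_compose_quotient_map[OF mb_quotient_map])
  have "continuous_map (mb_prespace B) euclideanreal snd"
    unfolding mb_prespace_def by (intro continuous_map_from_subtopology continuous_map_snd)
  then show "continuous_map (mb_prespace B) euclideanreal (mb_proj \<circ> (\<lambda>x. mb_glue B `` {x}))"
    by (rule continuous_map_eq) (simp add: mb_proj_class)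
qed

text \<open>Off height \<open>0\<close> nothing is glued, so a class is a singleton with a
  well-defined label. The quotient map restricted to this open part is still a quotient map, through
  which the label factors.\<close>

lemma mb_label_continuous:
  "continuous_map (subtopology (mb_topology B) {A \<in> topspace (mb_topology B). mb_proj A \<noteq> 0})
     (mb_space B) (\<lambda>A. fst (the_elem A))"
proof -
  let ?V = "{A \<in> topspace (mb_topology B). mb_proj A \<noteq> 0}"
  let ?U = "{x \<in> topspace (mb_prespace B). mb_glue B `` {x} \<in> ?V}"
  have "openin (mb_topology B) ?V"
    using openin_continuous_map_preimage[OF mb_proj_continuous, of "- {0}"] by (simp add: open_Compl)
  then have "quotient_map (subtopology (mb_prespace B) ?U) (subtopology (mb_topology B) ?V) (\<lambda>x. mb_glue B `` {x})"
    using quotient_map_restriction[OF mb_quotient_map refl] by blast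
  then show ?thesis
  proof (rule continuous_compose_quotient_map)
    have "continuous_map (subtopology (mb_prespace B) ?U) (mb_space B) fst"
      unfolding mb_prespace_def by (intro continuous_map_from_subtopology continuous_map_fst)
    then show "continuous_map (subtopology (mb_prespace B) ?U) (mb_space B)
        ((\<lambda>A. fst (the_elem A)) \<circ> (\<lambda>x. mb_glue B `` {x}))"
    proof (rule continuous_map_eq)
      fix x assume "x \<in> topspace (subtopology (mb_prespace B) ?U)"
      then have "x \<in> topspace (mb_prespace B)" "snd x \<noteq> 0"
        using mb_proj_class[of x] by auto
      then show "fst x = ((\<lambda>A. fst (the_elem A)) \<circ> (\<lambda>x. mb_glue B `` {x})) x"
        by (simp add: mb_class_singleton)
    qed
  qed
qed

text \<open>Away from the branching level the label moves in a connected subset of a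
  zero-dimensional space and is constant; the height then determines the point.\<close>

lemma mb_proj_injective_off_0:
  fixes J :: "real set"
  assumes J: "connected J" and \<beta>: "continuous_map (top_of_set J) (mb_topology B) \<beta>"
    and nz: "\<And>t. t \<in> J \<Longrightarrow> mb_proj (\<beta> t) \<noteq> 0"
    and st: "s \<in> J" "t \<in> J" "mb_proj (\<beta> s) = mb_proj (\<beta> t)"
  shows "\<beta> s = \<beta> t"
proof -
  let ?V = "{A \<in> topspace (mb_topology B). mb_proj A \<noteq> 0}"
  have top: "\<beta> r \<in> topspace (mb_topology B)" if "r \<in> J" for r
    using continuous_map_image_subset_topspace[OF \<beta>] that by auto
  have "continuous_map (top_of_set J) (subtopology (mb_topology B) ?V) \<beta>"
    using \<beta> top nz by (auto simp: continuous_map_in_subtopology)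
  from continuous_map_compose[OF this mb_label_continuous]
  have label: "continuous_map (top_of_set J) (mb_space B) (\<lambda>t. fst (the_elem (\<beta> t)))"
    by (simp add: o_def)
  have "connectedin (mb_space B) ((\<lambda>t. fst (the_elem (\<beta> t))) ` J)"
    using connectedin_continuous_map_image[OF label, of J] J by (simp add: connectedin_subtopology)
  moreover have "mb_space B dim_le 0" "Hausdorff_space (mb_space B)"
    using B by (auto simp: matchbox_def intro: metrizable_imp_Hausdorff_space)
  ultimately have eq: "fst (the_elem (\<beta> s)) = fst (the_elem (\<beta> t))"
    using dim_0_connected_constant st by (metis imageI)
  have "\<beta> r = {(fst (the_elem (\<beta> r)), mb_proj (\<beta> r))}" if r: "r \<in> J" for r
  proof -
    obtain x where x: "x \<in> topspace (mb_prespace B)" "\<beta> r = mb_glue B `` {x}"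
      using top[OF r] by (rule mb_topology_cases)
    then have "snd x \<noteq> 0" "mb_proj (\<beta> r) = snd x"
      using nz[OF r] mb_proj_class[OF x(1)] by simp_all
    then show ?thesis
      using mb_class_singleton[OF x(1)] x(2) by simp
  qed
  then show ?thesis
    using st eq by metis
qed

end

lemma chart_curve:
  assumes c: "is_chart Y c" and \<gamma>: "continuous_map (top_of_set J) Y \<gamma>" "\<gamma> ` J \<subseteq> chart_dom c"
  shows "continuous_map (top_of_set J) (mb_topology (chart_box c)) (chart_map c \<circ> \<gamma>)"
proof -
  have "continuous_map (top_of_set J) (subtopology Y (chart_dom c)) \<gamma>"
    using \<gamma> by (auto simp: continuous_map_in_subtopology)
  moreover have "continuous_map (subtopology Y (chart_dom c)) (mb_topology (chart_box c)) (chart_map c)"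
    using c by (simp add: is_chart_def homeomorphic_imp_continuous_map)
  ultimately show ?thesis
    by (rule continuous_map_compose)
qed

lemma chart_height_continuous:
  assumes "is_chart Y c" "continuous_map (top_of_set J) Y \<gamma>" "\<gamma> ` J \<subseteq> chart_dom c"
  shows "continuous_on J (chart_height c \<circ> \<gamma>)"
proof -
  have "matchbox (chart_box c)"
    using assms(1) by (simp add: is_chart_def)
  then have "continuous_map (top_of_set J) euclideanreal (mb_proj \<circ> (chart_map c \<circ> \<gamma>))"
    using continuous_map_compose[OF chart_curve[OF assms] mb_proj_continuous] by blast
  then show ?thesis
    by (simp add: chart_height_def o_assoc)
qed

lemma chart_height_injective_off_0:
  fixes J :: "real set"
  assumes c: "is_chart Y c" and \<gamma>: "continuous_map (top_of_set J) Y \<gamma>" "\<gamma> ` J \<subseteq> chart_dom c"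
    and J: "connected J" "\<And>t. t \<in> J \<Longrightarrow> chart_height c (\<gamma> t) \<noteq> 0"
    and st: "s \<in> J" "t \<in> J" "chart_height c (\<gamma> s) = chart_height c (\<gamma> t)"
  shows "\<gamma> s = \<gamma> t"
proof -
  have "matchbox (chart_box c)"
    using c by (simp add: is_chart_def)
  then have "(chart_map c \<circ> \<gamma>) s = (chart_map c \<circ> \<gamma>) t"
    using mb_proj_injective_off_0[OF _ J(1) chart_curve[OF c \<gamma>] _ st(1,2)] J(2) st(3)
    by (simp add: chart_height_def)
  moreover have "inj_on (chart_map c) (topspace (subtopology Y (chart_dom c)))"
    using c homeomorphic_imp_injective_map unfolding is_chart_def by blast
  moreover have "\<gamma> s \<in> topspace (subtopology Y (chart_dom c))" "\<gamma> t \<in> topspace (subtopology Y (chart_dom c))"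
    using continuous_map_image_subset_topspace[OF \<gamma>(1)] \<gamma>(2) st by auto
  ultimately show ?thesis
    by (simp add: inj_onD)
qed

lemma injective_curve_locally_one_to_one: "inj_on \<gamma> I \<Longrightarrow> locally_one_to_one (top_of_set I) \<gamma>"
  unfolding locally_one_to_one_def by (metis openin_topspace topspace_euclidean_subtopology)

text \<open>The orientation compares two charts only along curves on the unit interval. The segment
  between \<open>s\<close> and \<open>t\<close> is therefore rescaled affinely to that interval, and
  its end points are compared in the chart \<open>d\<close>.\<close>

lemma op_curve_if_increasing_in_chart:
  assumes atlas: "oriented_atlas Y \<O>" and c: "c \<in> \<O>"
    and \<gamma>: "continuous_map (top_of_set I) Y \<gamma>" "inj_on \<gamma> I" "\<gamma> ` I \<subseteq> chart_dom c"
    and mono: "mono_on I (chart_height c \<circ> \<gamma>)"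
  shows "op_curve Y \<O> I \<gamma>"
  unfolding op_curve_def curve_on_def
proof (intro conjI \<gamma>(1) injective_curve_locally_one_to_one[OF \<gamma>(2)] ballI allI impI mono_onI)
  fix d J s t
  assume d: "d \<in> \<O>" and J: "J \<subseteq> I" "is_interval J \<and> \<gamma> ` J \<subseteq> chart_dom d"
    and st: "s \<in> J" "t \<in> J" "s \<le> t"
  show "(chart_height d \<circ> \<gamma>) s \<le> (chart_height d \<circ> \<gamma>) t"
  proof (cases "s = t")
    case False
    define a where "a r = s + r * (t - s)" for r
    define \<delta> where "\<delta> = \<gamma> \<circ> a"
    have a: "a r \<in> J" if "r \<in> {0..1}" for r
    proof -
      have "0 \<le> r * (t - s)" "r * (t - s) \<le> 1 * (t - s)"
        using that st by (intro mult_nonneg_nonneg mult_right_mono; simp)+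
      then show ?thesis
        using J(2) unfolding a_def by (intro mem_is_interval_1_I[OF _ st(1,2)]) simp_all
    qed
    have a_cont: "continuous_map (top_of_set {0..1}) (top_of_set I) a"
      unfolding continuous_map_in_subtopology a_def
      using a J(1) by (auto simp: a_def intro!: continuous_intros)
    have "continuous_map (top_of_set {0..1}) (subtopology Y (chart_dom c \<inter> chart_dom d)) \<delta>"
      unfolding continuous_map_in_subtopology \<delta>_def
      using continuous_map_compose[OF a_cont \<gamma>(1)] a J \<gamma>(3) by (auto simp: image_subset_iff subset_eq)
    moreover have "inj_on \<delta> {0..1}"
      unfolding \<delta>_def
    proof (rule comp_inj_on)
      show "inj_on a {0..1}"
        using False by (auto simp: inj_on_def a_def)
      show "inj_on \<gamma> (a ` {0..1})"
        using \<gamma>(2) by (rule inj_on_subset) (use a J(1) in auto)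
    qed
    ultimately have "curve_on {0..1} (subtopology Y (chart_dom c \<inter> chart_dom d)) \<delta>"
      by (simp add: curve_on_def injective_curve_locally_one_to_one)
    then have "mono_on {0..1} (chart_height c \<circ> \<delta>) \<longleftrightarrow> mono_on {0..1} (chart_height d \<circ> \<delta>)"
      using atlas c d by (auto simp: oriented_atlas_def)
    moreover have "mono_on {0..1} (chart_height c \<circ> \<delta>)"
    proof (rule mono_onI)
      fix x y :: real assume xy: "x \<in> {0..1}" "y \<in> {0..1}" "x \<le> y"
      have "a x \<le> a y"
        using xy(3) st(3) by (simp add: a_def mult_right_mono)
      then show "(chart_height c \<circ> \<delta>) x \<le> (chart_height c \<circ> \<delta>) y"
        using mono_onD[OF mono, of "a x" "a y"] a[OF xy(1)] a[OF xy(2)] J(1) by (auto simp: \<delta>_def)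
    qed
    ultimately have "(chart_height d \<circ> \<delta>) 0 \<le> (chart_height d \<circ> \<delta>) 1"
      by (auto dest: mono_onD[of _ _ 0 1])
    then show ?thesis
      by (simp add: \<delta>_def a_def)
  qed simp
qed

text \<open>An injective continuous function takes intermediate values strictly between its end
  values. This is applied on the interval from \<open>r\<close> to \<open>u\<close> and then on that
  from \<open>s\<close> to \<open>u\<close>.\<close>

lemma continuous_injective_decreasing:
  fixes \<eta> :: "real \<Rightarrow> real"
  assumes "continuous_on {r..u} \<eta>" "inj_on \<eta> {r..u}" "\<eta> u < \<eta> r" "r \<le> s" "s \<le> t" "t \<le> u"
  shows "\<eta> t \<le> \<eta> s"
proof -
  have between: "\<eta> u \<le> \<eta> x \<and> \<eta> x \<le> \<eta> a" if "r \<le> a" "a \<le> x" "x \<le> u" "\<eta> u < \<eta> a" for a x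
  proof (cases "a = x \<or> x = u")
    case False
    have "(\<eta> a < \<eta> x \<and> \<eta> x < \<eta> u) \<or> (\<eta> u < \<eta> x \<and> \<eta> x < \<eta> a)"
      using assms(1,2) that False
      by (intro continuous_inj_imp_mono continuous_on_subset[OF assms(1)] inj_on_subset[OF assms(2)]) auto
    then show ?thesis
      using that(4) by linarith
  qed (use that in auto)
  show ?thesis
  proof (cases "s = u \<or> s = r")
    case True
    then show ?thesis
      using between[of r t] assms by auto
  next
    case False
    then have "\<eta> s \<noteq> \<eta> u"
      using inj_onD[OF assms(2), of s u] assms by auto
    then have "\<eta> u < \<eta> s"
      using between[of r s] assms by auto
    then show ?thesis
      using between[of s t] assms by auto
  qed
qed

section \<open>Orientation preserving curves over an edge\<close>

context graph_sequence
begin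

text \<open>Off height \<open>0\<close> the height in a chart is locally strictly monotone along the curve.  Where it
  decreases, the reversed curve is orientation preserving, and so is its projection, which
  however runs backwards through the edge.\<close>

lemma op_curve_if_over_edge:
  assumes atlas: "oriented_atlas L \<O>"
    and proj: "\<And>k I \<gamma>. is_interval I \<Longrightarrow> op_curve L \<O> I \<gamma> \<Longrightarrow> graph_op_path (X k) I (\<lambda>t. \<gamma> t k)"
    and I: "is_interval I" and \<gamma>: "continuous_map (top_of_set I) L \<gamma>"
    and e: "e \<in> gedges (X m)" and \<sigma>: "strict_mono_on I \<sigma>" "\<sigma> ` I \<subseteq> {0<..<1}"
    and over: "\<And>t. t \<in> I \<Longrightarrow> \<gamma> t m = gparam (X m) e (\<sigma> t)"
  shows "op_curve L \<O> I \<gamma>"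
proof -
  have inv: "inv_into {0<..<1} (gparam (X m) e) (\<gamma> t m) = \<sigma> t" if "t \<in> I" for t
    using over[OF that] inv_param[OF e, of "\<sigma> t"] \<sigma>(2) that by auto
  have inj: "inj_on \<gamma> I"
  proof (rule inj_onI)
    fix s t assume "s \<in> I" "t \<in> I" "\<gamma> s = \<gamma> t"
    then have "\<sigma> s = \<sigma> t"
      using inv by metis
    then show "s = t"
      using strict_mono_on_eqD[OF \<sigma>(1)] \<open>s \<in> I\<close> \<open>t \<in> I\<close> by metis
  qed
  show ?thesis
    unfolding op_curve_def curve_on_def
  proof (intro conjI \<gamma> injective_curve_locally_one_to_one[OF inj] ballI allI impI)
    fix c J
    assume c: "c \<in> \<O>" and J: "J \<subseteq> I" "is_interval J \<and> \<gamma> ` J \<subseteq> chart_dom c"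
    have chart: "is_chart L c"
      using atlas c by (auto simp: oriented_atlas_def matchbox_atlas_def)
    have \<gamma>J: "continuous_map (top_of_set J) L \<gamma>"
      using \<gamma> J(1) by (rule continuous_map_from_subtopology_mono)
    let ?\<eta> = "chart_height c \<circ> \<gamma>"
    have \<eta>: "continuous_on J ?\<eta>"
      by (rule chart_height_continuous[OF chart \<gamma>J]) (use J in simp)
    \<comment> \<open>The branching level \<open>0\<close>, where the height may fail to be locally
      injective, is the single exceptional value.\<close>
    show "mono_on J ?\<eta>"
    proof (rule mono_on_if_locally_nondecreasing[of "{0}", OF _ _ \<eta>])
      fix r assume r: "r \<in> J" "?\<eta> r \<notin> {0}"
      have "openin (top_of_set J) (J \<inter> ?\<eta> -` (- {0}))"
        using \<eta> by (simp add: continuous_on_open_gen open_Compl continuous_openin_preimage_gen)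
      then obtain d where d: "d > 0" "\<forall>u \<in> J. \<bar>u - r\<bar> < d \<longrightarrow> u \<in> J \<inter> ?\<eta> -` (- {0})"
        using openin_real_near[of J "J \<inter> ?\<eta> -` (- {0})" r] r by auto
      have "?\<eta> r \<le> ?\<eta> u" if u: "u \<in> J" "r \<le> u" "u < r + d" for u
      proof (rule ccontr)
        assume "\<not> ?\<eta> r \<le> ?\<eta> u"
        then have less: "?\<eta> u < ?\<eta> r" and "r < u"
          using u by (auto simp: less_le)
        have K: "{r..u} \<subseteq> J"
          using J(2) r(1) u(1) by (meson atLeastAtMost_iff mem_is_interval_1_I subsetI)
        have nz: "chart_height c (\<gamma> t) \<noteq> 0" if "t \<in> {r..u}" for t
          using d(2) K that u by auto
        have \<gamma>K: "continuous_map (top_of_set {r..u}) L \<gamma>"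
          using \<gamma>J K by (rule continuous_map_from_subtopology_mono)
        have injK: "inj_on \<gamma> {r..u}"
          using inj by (rule inj_on_subset) (use K J in auto)
        have domK: "\<gamma> ` {r..u} \<subseteq> chart_dom c"
          using K J(2) by blast
        have "inj_on ?\<eta> {r..u}"
        proof (rule inj_onI)
          fix s t assume st: "s \<in> {r..u}" "t \<in> {r..u}" "?\<eta> s = ?\<eta> t"
          have "\<gamma> s = \<gamma> t"
            by (rule chart_height_injective_off_0[OF chart \<gamma>K domK _ nz st(1,2)]) (use st(3) in auto)
          then show "s = t"
            using inj_onD[OF injK] st by blast
        qed
        then have dec: "?\<eta> t \<le> ?\<eta> s" if "r \<le> s" "s \<le> t" "t \<le> u" for s t
          using continuous_injective_decreasing[OF continuous_on_subset[OF \<eta> K] _ less that] by blast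
        define \<delta> where "\<delta> t = \<gamma> (r + u - t)" for t
        have "continuous_map (top_of_set {r..u}) (top_of_set {r..u}) (\<lambda>t. r + u - t)"
          unfolding continuous_map_in_subtopology by (auto intro!: continuous_intros)
        from continuous_map_compose[OF this \<gamma>K]
        have \<delta>: "continuous_map (top_of_set {r..u}) L \<delta>"
          by (simp add: \<delta>_def[abs_def] o_def)
        have "op_curve L \<O> {r..u} \<delta>"
        proof (rule op_curve_if_increasing_in_chart[OF atlas c \<delta>])
          show "inj_on \<delta> {r..u}"
          proof (rule inj_onI)
            fix s t assume "s \<in> {r..u}" "t \<in> {r..u}" "\<delta> s = \<delta> t"
            then show "s = t"
              using inj_onD[OF injK, of "r + u - s" "r + u - t"] by (simp add: \<delta>_def)
          qed
          show "\<delta> ` {r..u} \<subseteq> chart_dom c"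
            using domK by (auto simp: \<delta>_def)
          show "mono_on {r..u} (chart_height c \<circ> \<delta>)"
          proof (rule mono_onI)
            fix s t assume "s \<in> {r..u}" "t \<in> {r..u}" "s \<le> t"
            then show "(chart_height c \<circ> \<delta>) s \<le> (chart_height c \<circ> \<delta>) t"
              using dec[of "r + u - t" "r + u - s"] by (simp add: \<delta>_def)
          qed
        qed
        then have path: "graph_op_path (X m) {r..u} (\<lambda>t. \<delta> t m)"
          by (intro proj) (simp_all add: is_interval_cc)
        have "(\<lambda>t. \<delta> t m) ` {r..u} \<subseteq> gparam (X m) e ` {0<..<1}"
          using over \<sigma>(2) K J(1) by (auto simp: \<delta>_def subset_eq)
        then have "mono_on {r..u} (inv_into {0<..<1} (gparam (X m) e) \<circ> (\<lambda>t. \<delta> t m))"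
          using path e unfolding graph_op_path_def by (metis is_interval_cc order_refl)
        then have "inv_into {0<..<1} (gparam (X m) e) (\<delta> r m) \<le> inv_into {0<..<1} (gparam (X m) e) (\<delta> u m)"
          using \<open>r < u\<close> by (auto dest: mono_onD[of _ _ r u])
        moreover have ru: "r \<in> I" "u \<in> I"
          using u(1) r(1) J(1) by blast+
        ultimately have "\<sigma> u \<le> \<sigma> r"
          using inv[OF ru(1)] inv[OF ru(2)] by (simp add: \<delta>_def)
        moreover have "\<sigma> r < \<sigma> u"
          using strict_mono_onD[OF \<sigma>(1) ru] \<open>r < u\<close> by simp
        ultimately show False by simp
      qed
      then show "\<exists>d>0. \<forall>u \<in> J. r \<le> u \<and> u < r + d \<longrightarrow> ?\<eta> r \<le> ?\<eta> u"
        using d(1) by blast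
    qed (use J in auto)
  qed
qed

text \<open>By \<open>lift_edge\<close> each edge with a reparameterization is covered by one a
  level higher. Iterating by dependent choice gives a compatible sequence of paths, that is, a path
  of threads.\<close>

lemma lift_edge_to_limit:
  assumes e: "e \<in> gedges (X m)"
  obtains \<gamma> where "continuous_map (top_of_set {0..1}) L \<gamma>"
    "\<forall>t \<in> {0..1}. \<gamma> t m = gparam (X m) e t"
proof -
  \<comment> \<open>The clause for \<open>n = 0\<close> pins the start of the choice to
    \<open>e\<close> itself with the identity parameter, so coordinate \<open>m\<close> of the path
    is exactly the given edge.\<close>
  define good where "good n p \<longleftrightarrow> fst p \<in> gedges (X (m + n)) \<and> continuous_on {0..1} (snd p) \<and>
    snd p ` {0..1} \<subseteq> {0..1} \<and> (n = 0 \<longrightarrow> p = (e, id))" for n and p :: "'e \<times> (real \<Rightarrow> real)"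
  define above where "above n p p' \<longleftrightarrow> (\<forall>t \<in> {0..1}.
    f (Suc (m + n)) (gparam (X (Suc (m + n))) (fst p') (snd p' t)) = gparam (X (m + n)) (fst p) (snd p t))"
    for n and p p' :: "'e \<times> (real \<Rightarrow> real)"
  have "\<exists>s. \<forall>n. good n (s n) \<and> above n (s n) (s (Suc n))"
  proof (rule dependent_nat_choice)
    show "\<exists>p. good 0 p"
      using e by (intro exI[of _ "(e, id)"]) (auto simp: good_def)
    fix p n assume p: "good n p"
    then have p': "fst p \<in> gedges (X (m + n))" "continuous_on {0..1} (snd p)" "snd p ` {0..1} \<subseteq> {0..1}"
      by (auto simp: good_def)
    obtain e' \<rho> where \<rho>: "e' \<in> gedges (X (Suc (m + n)))" "continuous_on {0..1} \<rho>" "\<rho> ` {0..1} \<subseteq> {0..1}"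
      "\<And>t. t \<in> {0..1} \<Longrightarrow> f (Suc (m + n)) (gparam (X (Suc (m + n))) e' (\<rho> t)) = gparam (X (m + n)) (fst p) t"
      using step.lift_edge[OF p'(1)] by metis
    have "good (Suc n) (e', \<rho> \<circ> snd p)"
      using \<rho>(1,3) p'(3) continuous_on_compose[OF p'(2) continuous_on_subset[OF \<rho>(2) p'(3)]]
      by (auto simp: good_def image_subset_iff)
    moreover have "above n p (e', \<rho> \<circ> snd p)"
      using \<rho>(4) p'(3) by (auto simp: above_def image_subset_iff)
    ultimately show "\<exists>p'. good (Suc n) p' \<and> above n p p'"
      by blast
  qed
  then obtain s where s: "\<And>n. good n (s n)" "\<And>n. above n (s n) (s (Suc n))"
    by blast
  define y where "y n t = gparam (X (m + n)) (fst (s n)) (snd (s n) t)" for n t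
  have y_cont: "continuous_map (top_of_set {0..1}) (gspace (X (m + n))) (y n)" for n
  proof -
    have reparam: "continuous_map (top_of_set {0..1}) (top_of_set {0..1}) (snd (s n))"
      using s(1)[of n] by (auto simp: good_def continuous_map_in_subtopology)
    have "fst (s n) \<in> gedges (X (m + n))"
      using s(1)[of n] by (simp add: good_def)
    from continuous_map_compose[OF reparam param_continuous[OF this]] show ?thesis
      by (simp add: y_def[abs_def] o_def)
  qed
  define \<gamma> where "\<gamma> t = thread m (\<lambda>n. y n t)" for t
  have \<gamma>L: "\<gamma> t \<in> topspace L" if t: "t \<in> {0..1}" for t
    unfolding \<gamma>_def
  proof (rule thread_L)
    show "y n t \<in> topspace (gspace (X (m + n)))" for n
      using continuous_map_image_subset_topspace[OF y_cont, of n] t by (simp add: image_subset_iff)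
    show "f (Suc (m + n)) (y (Suc n) t) = y n t" for n
      using s(2)[of n] t by (simp add: above_def y_def)
  qed
  have "continuous_map (top_of_set {0..1}) P \<gamma>"
    unfolding continuous_map_componentwise_UNIV
  proof
    fix j
    show "continuous_map (top_of_set {0..1}) (gspace (X j)) (\<lambda>t. \<gamma> t j)"
    proof (cases "m \<le> j")
      case True
      then show ?thesis
        using y_cont[of "j - m"] by (simp add: \<gamma>_def thread_def)
    next
      case False
      then show ?thesis
        using continuous_map_compose[OF y_cont[of 0], of "gspace (X j)" "bonding f j (m - j)"]
          bonding_continuous[of j "m - j"] by (simp add: \<gamma>_def thread_def o_def)
    qed
  qed
  then have "continuous_map (top_of_set {0..1}) (subtopology P (topspace L)) \<gamma>"
    using \<gamma>L by (auto simp: continuous_map_in_subtopology)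
  then have "continuous_map (top_of_set {0..1}) L \<gamma>"
    by (simp only: L_eq[symmetric])
  moreover have "\<gamma> t m = gparam (X m) e t" for t
    using s(1)[of 0] by (simp add: \<gamma>_def y_def good_def)
  ultimately show thesis
    using that by blast
qed

end

section \<open>The group isomorphism\<close>

text \<open>Carries the order to the Bruschlinsky group, where it then remains to recognize the
  image of the cone as the winding cone.\<close>

lemma ordered_group_image:
  assumes G: "ordered_group G P" and H: "comm_group H" and h: "h \<in> iso G H"
  shows "ordered_group H (h ` P)"
proof -
  have cg: "comm_group G" and sub: "submonoid P G" and gen: "generate G P = carrier G"
    and anti: "P \<inter> (\<lambda>x. inv\<^bsub>G\<^esub> x) ` P = {\<one>\<^bsub>G\<^esub>}"
    using G by (auto simp: ordered_group_def preordered_group_def)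
  interpret G: comm_group G by fact
  interpret H: comm_group H by fact
  interpret P: submonoid P G by fact
  have bij: "bij_betw h (carrier G) (carrier H)" and hom: "h \<in> hom G H"
    using h by (auto simp: iso_def)
  interpret h: group_hom G H h
    using hom by (simp add: group_hom_def group_hom_axioms_def G.is_group H.is_group)
  have inj: "inj_on h (carrier G)" and img: "h ` carrier G = carrier H"
    using bij by (auto simp: bij_betw_def)
  have "submonoid (h ` P) H"
  proof
    show "h ` P \<subseteq> carrier H"
      using P.subset img by blast
    show "\<one>\<^bsub>H\<^esub> \<in> h ` P"
      using P.one_closed h.hom_one by (metis image_eqI)
    fix x y assume "x \<in> h ` P" "y \<in> h ` P"
    then obtain a b where ab: "a \<in> P" "b \<in> P" "x = h a" "y = h b"
      by blast
    then have "x \<otimes>\<^bsub>H\<^esub> y = h (a \<otimes>\<^bsub>G\<^esub> b)"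
      using h.hom_mult P.mem_carrier by simp
    then show "x \<otimes>\<^bsub>H\<^esub> y \<in> h ` P"
      using P.m_closed[OF ab(1,2)] by blast
  qed
  moreover have "generate H (h ` P) = carrier H"
    using h.generate_img[OF P.subset] gen img by simp
  moreover have "h ` P \<inter> (\<lambda>x. inv\<^bsub>H\<^esub> x) ` h ` P = {\<one>\<^bsub>H\<^esub>}"
  proof -
    have "(\<lambda>x. inv\<^bsub>H\<^esub> x) ` h ` P = h ` (\<lambda>x. inv\<^bsub>G\<^esub> x) ` P"
      unfolding image_image using P.mem_carrier by (intro image_cong refl) simp
    moreover have "(\<lambda>x. inv\<^bsub>G\<^esub> x) ` P \<subseteq> carrier G"
      using P.mem_carrier by auto
    ultimately have "h ` P \<inter> (\<lambda>x. inv\<^bsub>H\<^esub> x) ` h ` P = h ` (P \<inter> (\<lambda>x. inv\<^bsub>G\<^esub> x) ` P)"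
      using inj_on_image_Int[OF inj P.subset] by simp
    then show ?thesis
      unfolding anti by simp
  qed
  ultimately show ?thesis
    using H by (simp add: ordered_group_def preordered_group_def)
qed

context graph_sequence
begin

abbreviation pull :: "nat \<Rightarrow> ('e \<Rightarrow> int) set \<Rightarrow> ('e \<Rightarrow> int) set" where
  "pull \<equiv> \<lambda>k. pull_class (X (Suc k)) (X k) (f (Suc k))"

sublocale limit: direct_system "\<lambda>k. graph_group (X k)" pull
proof (rule direct_system.intro)
  show "comm_group (graph_group (X k))" for k
    by (rule graph_group_comm_group)
  fix k
  interpret E: comm_group "edge_fun_group (X k)"
    by (rule edge_fun_comm_group)
  show "pull k \<in> hom (graph_group (X k)) (graph_group (X (Suc k)))"
  proof (rule homI)
    fix A assume "A \<in> carrier (graph_group (X k))"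
    then obtain g where g: "g \<in> carrier (edge_fun_group (X k))" "A = graph_class (X k) g"
      unfolding graph_group_carrier by blast
    show "pull k A \<in> carrier (graph_group (X (Suc k)))"
      unfolding graph_group_carrier g(2) step.pull_class_graph_class[OF g(1)]
      using step.pull_fun_carrier by (rule imageI)
  next
    fix A B assume "A \<in> carrier (graph_group (X k))" "B \<in> carrier (graph_group (X k))"
    then obtain g h where g: "g \<in> carrier (edge_fun_group (X k))" "A = graph_class (X k) g"
      and h: "h \<in> carrier (edge_fun_group (X k))" "B = graph_class (X k) h"
      unfolding graph_group_carrier by blast
    show "pull k (A \<otimes>\<^bsub>graph_group (X k)\<^esub> B) = pull k A \<otimes>\<^bsub>graph_group (X (Suc k))\<^esub> pull k B"
      unfolding g(2) h(2) graph_group_mult[OF g(1) h(1)] step.pull_class_graph_class[OF g(1)]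
        step.pull_class_graph_class[OF h(1)] step.pull_class_graph_class[OF E.m_closed[OF g(1) h(1)]]
        graph_group_mult[OF step.pull_fun_carrier step.pull_fun_carrier] step.pull_fun_mult ..
  qed
qed

definition level_map :: "nat \<Rightarrow> ('e \<Rightarrow> int) \<Rightarrow> ((nat \<Rightarrow> 'a) \<Rightarrow> complex) set" where
  "level_map k g = Br_class L (\<lambda>x. edge_circle_map (X k) g (x k))"

lemma level_map_carrier: "level_map k g \<in> carrier (Br L)"
  unfolding level_map_def Br_carrier using unit_map_coord by blast

text \<open>The circle map of a coboundary is an exponential, by interpolation of the potential, and
  so has trivial class.\<close>

lemma level_map_cong:
  assumes "\<And>e. e \<in> gedges (X k) \<Longrightarrow> g e - h e = p (gparam (X k) e 1) - p (gparam (X k) e 0)"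
  shows "level_map k g = level_map k h"
proof -
  obtain w where w: "continuous_map (gspace (X k)) euclideanreal w"
    "\<forall>x \<in> topspace (gspace (X k)). edge_circle_map (X k) (\<lambda>e. g e - h e) x = circ (w x)"
    by (rule edge_circle_map_coboundary[where g = "\<lambda>e. g e - h e", OF assms])
  have "continuous_map L euclideanreal (\<lambda>x. w (x k))"
    using continuous_map_compose[OF coord_continuous w(1)] by (simp add: o_def)
  moreover have "edge_circle_map (X k) g (x k) = edge_circle_map (X k) h (x k) * circ (w (x k))"
    if "x \<in> topspace L" for x
  proof -
    have xk: "x k \<in> topspace (gspace (X k))"
      using that by (rule L_coord)
    have "edge_circle_map (X k) g (x k) =
        edge_circle_map (X k) h (x k) * edge_circle_map (X k) (\<lambda>e. g e - h e) (x k)"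
      by (rule edge_circle_map_add[OF xk]) simp
    then show ?thesis
      using w(2) xk by simp
  qed
  ultimately show ?thesis
    unfolding level_map_def Br_class_eq_iff[OF unit_map_coord unit_map_coord]
    by (intro exI[of _ "\<lambda>x. w (x k)"]) simp
qed

lemma level_map_eq_if_class_eq:
  assumes "g \<in> carrier (edge_fun_group (X k))" "h \<in> carrier (edge_fun_group (X k))"
    "graph_class (X k) g = graph_class (X k) h"
  shows "level_map k g = level_map k h"
  using assms level_map_cong[of k g h] by (auto simp: graph_class_eq_iff)

lemma level_map_mult:
  assumes "g \<in> carrier (edge_fun_group (X k))" "h \<in> carrier (edge_fun_group (X k))"
  shows "level_map k (g \<otimes>\<^bsub>edge_fun_group (X k)\<^esub> h) = level_map k g \<otimes>\<^bsub>Br L\<^esub> level_map k h"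
proof -
  have "edge_circle_map (X k) (g \<otimes>\<^bsub>edge_fun_group (X k)\<^esub> h) (x k) =
      edge_circle_map (X k) g (x k) * edge_circle_map (X k) h (x k)" if "x \<in> topspace L" for x
    by (rule edge_circle_map_add[OF L_coord[OF that]]) (simp add: edge_fun_mult)
  then show ?thesis
    unfolding level_map_def Br_class_mult[OF unit_map_coord unit_map_coord]
    by (subst Br_class_eq_iff[OF unit_map_coord unit_map_mult[OF unit_map_coord unit_map_coord]])
       (intro exI[of _ "\<lambda>_. 0"], simp)
qed

lemma level_map_pull_iter: "level_map (k + n) (pull_iter k n g) = level_map k g"
proof -
  obtain v where v: "continuous_map (gspace (X (k + n))) euclideanreal v"
    "\<forall>x \<in> topspace L. edge_circle_map (X k) g (x k) =
       edge_circle_map (X (k + n)) (pull_iter k n g) (x (k + n)) * circ (v (x (k + n)))"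
    by (rule pull_iter_circle_map)
  have "continuous_map L euclideanreal (\<lambda>x. v (x (k + n)))"
    using continuous_map_compose[OF coord_continuous v(1)] by (simp add: o_def)
  then have "level_map k g = level_map (k + n) (pull_iter k n g)"
    unfolding level_map_def Br_class_eq_iff[OF unit_map_coord unit_map_coord] using v(2)
    by (intro exI[of _ "\<lambda>x. v (x (k + n))"]) simp
  then show ?thesis ..
qed

lemma level_map_zero:
  assumes "\<And>e. e \<in> gedges (X k) \<Longrightarrow> g e = 0"
  shows "level_map k g = \<one>\<^bsub>Br L\<^esub>"
proof -
  have "edge_circle_map (X k) g (x k) = 1" if x: "x \<in> topspace L" for x
  proof -
    obtain e t where e: "e \<in> gedges (X k)" "t \<in> {0..1}" "x k = gparam (X k) e t"
      using L_coord[OF x] by (rule topspace_cases)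
    then show ?thesis
      using edge_circle_map_param[OF e(1,2), of g] assms[OF e(1)] by simp
  qed
  then show ?thesis
    unfolding level_map_def Br_one Br_class_eq_iff[OF unit_map_coord unit_map_one]
    by (intro exI[of _ "\<lambda>_. 0"]) simp
qed

text \<open>Surjectivity is \<open>Br_class_surj\<close>; a class sent to the identity has a
  logarithm on the limit and dies at a later level by \<open>class_trivial_if_exp\<close>.\<close>

lemma limit_iso:
  obtains \<iota> where "\<iota> \<in> iso (limit_group X f) (Br L)"
    "\<forall>k. \<forall>g \<in> carrier (edge_fun_group (X k)). \<iota> (limit_class X f k (graph_class (X k) g)) = level_map k g"
proof -
  \<comment> \<open>The maps must be given on cosets; by \<open>level_map_eq_if_class_eq\<close> the
    chosen representative does not matter.\<close>
  define j where "j k A = level_map k (SOME g. g \<in> carrier (edge_fun_group (X k)) \<and> A = graph_class (X k) g)" for k A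
  have j: "j k (graph_class (X k) g) = level_map k g" if g: "g \<in> carrier (edge_fun_group (X k))" for k g
  proof -
    let ?P = "\<lambda>h. h \<in> carrier (edge_fun_group (X k)) \<and> graph_class (X k) g = graph_class (X k) h"
    have "?P (SOME h. ?P h)"
      by (rule someI[of ?P g]) (use g in simp)
    then show ?thesis
      unfolding j_def using level_map_eq_if_class_eq[OF g] by metis
  qed
  have "\<exists>\<iota>. \<iota> \<in> iso (limit_group X f) (Br L) \<and>
    (\<forall>k. \<forall>A \<in> carrier (graph_group (X k)). \<iota> (limit_class X f k A) = j k A)"
  proof (rule limit.iso_from_dirlim[of "Br L" j, OF Br_comm_group])
    fix k
    interpret E: comm_group "edge_fun_group (X k)"
      by (rule edge_fun_comm_group)
    show "j k \<in> hom (graph_group (X k)) (Br L)"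
    proof (rule homI)
      fix A assume "A \<in> carrier (graph_group (X k))"
      then show "j k A \<in> carrier (Br L)"
        unfolding j_def by (simp add: level_map_carrier)
    next
      fix A B assume "A \<in> carrier (graph_group (X k))" "B \<in> carrier (graph_group (X k))"
      then obtain g h where g: "g \<in> carrier (edge_fun_group (X k))" "A = graph_class (X k) g"
        and h: "h \<in> carrier (edge_fun_group (X k))" "B = graph_class (X k) h"
        unfolding graph_group_carrier by blast
      show "j k (A \<otimes>\<^bsub>graph_group (X k)\<^esub> B) = j k A \<otimes>\<^bsub>Br L\<^esub> j k B"
        unfolding g(2) h(2) graph_group_mult[OF g(1) h(1)] j[OF g(1)] j[OF h(1)]
          j[OF E.m_closed[OF g(1) h(1)]] by (rule level_map_mult[OF g(1) h(1)])
    qed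
  next
    fix k A assume "A \<in> carrier (graph_group (X k))"
    then obtain g where g: "g \<in> carrier (edge_fun_group (X k))" "A = graph_class (X k) g"
      unfolding graph_group_carrier by blast
    show "j (Suc k) (pull k A) = j k A"
      unfolding g(2) step.pull_class_graph_class[OF g(1)] j[OF g(1)] j[OF step.pull_fun_carrier]
      using level_map_pull_iter[of k 1 g] by simp
    assume "j k A = \<one>\<^bsub>Br L\<^esub>"
    then have "Br_class L (\<lambda>x. edge_circle_map (X k) g (x k)) = Br_class L (\<lambda>_. 1)"
      unfolding g(2) j[OF g(1)] by (simp add: level_map_def Br_one)
    then obtain w where "continuous_map L euclideanreal w"
        "\<forall>x \<in> topspace L. edge_circle_map (X k) g (x k) = circ (w x)"
      unfolding Br_class_eq_iff[OF unit_map_coord unit_map_one] by auto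
    then obtain n p where p: "\<forall>e \<in> gedges (X (k + n)).
        pull_iter k n g e = p (gparam (X (k + n)) e 1) - p (gparam (X (k + n)) e 0)"
      using class_trivial_if_exp[OF g(1)] by blast
    have one: "\<one>\<^bsub>edge_fun_group (X (k + n))\<^esub> \<in> carrier (edge_fun_group (X (k + n)))"
      by (simp add: edge_fun_one carrier_edge_fun)
    have "graph_class (X (k + n)) (pull_iter k n g) = graph_class (X (k + n)) \<one>\<^bsub>edge_fun_group (X (k + n))\<^esub>"
      unfolding graph_class_eq_iff[OF pull_iter_carrier[OF g(1)] one]
      using p by (intro exI[of _ p]) (simp add: edge_fun_one)
    also have "\<dots> = \<one>\<^bsub>graph_group (X (k + n))\<^esub>"
      by (rule graph_class_one)
    finally show "\<exists>n. transition pull k n A = \<one>\<^bsub>graph_group (X (k + n))\<^esub>"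
      unfolding g(2) transition_graph_class[OF g(1)] by blast
  next
    fix b assume "b \<in> carrier (Br L)"
    then obtain \<phi> where \<phi>: "unit_map L \<phi>" "b = Br_class L \<phi>"
      by (auto simp: Br_carrier)
    obtain n g where g: "g \<in> carrier (edge_fun_group (X n))"
        "Br_class L \<phi> = Br_class L (\<lambda>x. edge_circle_map (X n) g (x n))"
      using \<phi>(1) by (rule Br_class_surj)
    have "graph_class (X n) g \<in> carrier (graph_group (X n))"
      unfolding graph_group_carrier using g(1) by (rule imageI)
    moreover have "j n (graph_class (X n) g) = b"
      unfolding \<phi>(2) g(2) j[OF g(1)] level_map_def ..
    ultimately show "\<exists>k. \<exists>A \<in> carrier (graph_group (X k)). j k A = b"
      by blast
  next
    fix \<iota> assume "\<iota> \<in> iso (limit_group X f) (Br L)"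
      "\<forall>k. \<forall>A \<in> carrier (graph_group (X k)). \<iota> (limit_class X f k A) = j k A"
    then show "\<exists>\<iota>. \<iota> \<in> iso (limit_group X f) (Br L) \<and>
      (\<forall>k. \<forall>A \<in> carrier (graph_group (X k)). \<iota> (limit_class X f k A) = j k A)"
      by blast
  qed
  then obtain \<iota> where \<iota>: "\<iota> \<in> iso (limit_group X f) (Br L)"
    "\<And>k A. A \<in> carrier (graph_group (X k)) \<Longrightarrow> \<iota> (limit_class X f k A) = j k A"
    by blast
  show thesis
  proof (rule that[OF \<iota>(1)], intro allI ballI)
    fix k g assume g: "g \<in> carrier (edge_fun_group (X k))"
    then show "\<iota> (limit_class X f k (graph_class (X k) g)) = level_map k g"
      using \<iota>(2)[of "graph_class (X k) g" k] j[OF g] by (simp add: graph_group_carrier)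
  qed
qed

end

section \<open>The winding order\<close>

text \<open>The factor \<open>\<psi>\<close> does not change the class, so it can be absorbed into
  \<open>\<phi>\<close>; conversely the trivial factor serves.\<close>

lemma Br_pos_eq: "Br_pos Y \<O> = {Br_class Y \<phi> | \<phi>. unit_map Y \<phi> \<and> non_orientation_reversing Y \<O> \<phi>}"
proof (intro equalityI subsetI)
  fix b assume "b \<in> Br_pos Y \<O>"
  then obtain \<phi> \<psi> where \<phi>: "\<phi> \<in> carrier (circle_maps Y)" "b = Br_class Y \<phi>" and \<psi>: "\<psi> \<in> exp_maps Y"
    "non_orientation_reversing Y \<O> (\<phi> \<otimes>\<^bsub>circle_maps Y\<^esub> \<psi>)"
    unfolding Br_pos_def by blast
  obtain w where w: "continuous_map Y euclideanreal w" "\<psi> = (\<lambda>y \<in> topspace Y. circ (w y))"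
    using \<psi>(1) unfolding exp_maps_eq by blast
  let ?\<phi> = "\<phi> \<otimes>\<^bsub>circle_maps Y\<^esub> \<psi>"
  have "\<psi> \<in> carrier (circle_maps Y)"
    using subgroup.mem_carrier[OF subgroup_exp_maps \<psi>(1)] .
  then have unit: "unit_map Y \<phi>" "unit_map Y ?\<phi>"
    using \<phi>(1) comm_groupE(1)[OF circle_maps_comm_group \<phi>(1)] unfolding circle_maps_carrier by blast+
  have "Br_class Y ?\<phi> = b"
    unfolding \<phi>(2) Br_class_eq_iff[OF unit(2,1)]
    using w by (intro exI[of _ w]) (simp add: circle_maps_mult)
  then show "b \<in> {Br_class Y \<phi> | \<phi>. unit_map Y \<phi> \<and> non_orientation_reversing Y \<O> \<phi>}"
    using unit(2) \<psi>(2) by blast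
next
  fix b assume "b \<in> {Br_class Y \<phi> | \<phi>. unit_map Y \<phi> \<and> non_orientation_reversing Y \<O> \<phi>}"
  then obtain \<phi> where \<phi>: "unit_map Y \<phi>" "non_orientation_reversing Y \<O> \<phi>" "b = Br_class Y \<phi>"
    by blast
  let ?\<phi> = "restrict \<phi> (topspace Y)"
  have "non_orientation_reversing Y \<O> (?\<phi> \<otimes>\<^bsub>circle_maps Y\<^esub> \<one>\<^bsub>circle_maps Y\<^esub>)"
    unfolding non_orientation_reversing_def
  proof (intro allI impI)
    fix \<gamma> assume \<gamma>: "op_curve Y \<O> UNIV \<gamma>"
    then have "\<gamma> t \<in> topspace Y" for t
      by (auto simp: op_curve_def curve_on_def continuous_map_def)
    then have "(?\<phi> \<otimes>\<^bsub>circle_maps Y\<^esub> \<one>\<^bsub>circle_maps Y\<^esub>) \<circ> \<gamma> = \<phi> \<circ> \<gamma>"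
      by (auto simp: circle_maps_mult circle_maps_one)
    then show "never_clockwise ((?\<phi> \<otimes>\<^bsub>circle_maps Y\<^esub> \<one>\<^bsub>circle_maps Y\<^esub>) \<circ> \<gamma>)"
      using \<phi>(2) \<gamma> by (simp add: non_orientation_reversing_def)
  qed
  moreover have "b = Br_class Y ?\<phi>"
    by (simp add: \<phi>(3) Br_class_def)
  ultimately show "b \<in> Br_pos Y \<O>"
    unfolding Br_pos_def using restrict_circle_maps[OF \<phi>(1)] subgroup.one_closed[OF subgroup_exp_maps] by blast
qed

text \<open>A change of unit, from radians to full turns.\<close>

lemma never_clockwise_iff:
  "never_clockwise c \<longleftrightarrow> (\<exists>\<theta>. continuous_on UNIV \<theta> \<and> mono \<theta> \<and> (\<forall>t. c t = circ (\<theta> t)))"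
proof
  assume "never_clockwise c"
  then obtain \<theta> where \<theta>: "continuous_on UNIV \<theta>" "mono \<theta>" "\<forall>t. c t = cis (\<theta> t)"
    by (auto simp: never_clockwise_def)
  then show "\<exists>\<theta>. continuous_on UNIV \<theta> \<and> mono \<theta> \<and> (\<forall>t. c t = circ (\<theta> t))"
    by (intro exI[of _ "\<lambda>t. \<theta> t / (2 * pi)"])
       (auto simp: circ_def monotone_def intro!: continuous_intros divide_right_mono)
next
  assume "\<exists>\<theta>. continuous_on UNIV \<theta> \<and> mono \<theta> \<and> (\<forall>t. c t = circ (\<theta> t))"
  then obtain \<theta> where \<theta>: "continuous_on UNIV \<theta>" "mono \<theta>" "\<forall>t. c t = circ (\<theta> t)"
    by blast
  then show "never_clockwise c"
    unfolding never_clockwise_def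
    by (intro exI[of _ "\<lambda>t. 2 * pi * \<theta> t"])
       (auto simp: circ_def monotone_def intro!: continuous_intros)
qed

text \<open>The winding order tests only curves defined on all of the real line; this
  reparameterizes the interior of an edge by such a curve.\<close>

lemma real_to_unit_interval:
  obtains s :: "real \<Rightarrow> real" where "continuous_on UNIV s" "strict_mono s" "range s = {0<..<1}"
proof
  let ?s = "\<lambda>t. 1 / 2 + arctan t / pi"
  show "continuous_on UNIV ?s"
    by (intro continuous_intros) auto
  show "strict_mono ?s"
    by (auto simp: strict_mono_def intro!: divide_strict_right_mono arctan_monotone)
  show "range ?s = {0<..<1}"
  proof (intro equalityI subsetI)
    fix r assume "r \<in> range ?s"
    then obtain t where "r = ?s t"
      by blast
    moreover have "- (1 / 2) < arctan t / pi" "arctan t / pi < 1 / 2"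
      using arctan_bounded[of t] pi_gt_zero by (auto simp: field_simps)
    ultimately show "r \<in> {0<..<1}"
      unfolding greaterThanLessThan_iff by linarith
  next
    fix r :: real assume r: "r \<in> {0<..<1}"
    have "(r - 1 / 2) * pi < 1 / 2 * pi" "- (1 / 2) * pi < (r - 1 / 2) * pi"
      using r by (intro mult_strict_right_mono; simp)+
    then have "arctan (tan ((r - 1 / 2) * pi)) = (r - 1 / 2) * pi"
      by (intro arctan_tan) auto
    then have "r = ?s (tan ((r - 1 / 2) * pi))"
      by simp
    then show "r \<in> range ?s"
      by blast
  qed
qed

text \<open>The two end values serve as exceptional levels, so only interior times have to be
  inspected.\<close>

lemma mono_on_closed_interval:
  fixes \<theta> :: "real \<Rightarrow> real"
  assumes "continuous_on {a..b} \<theta>" "mono_on {a<..<b} \<theta>"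
  shows "mono_on {a..b} \<theta>"
proof (rule mono_on_if_locally_nondecreasing[of "{\<theta> a, \<theta> b}", OF _ _ assms(1)])
  fix r assume r: "r \<in> {a..b}" "\<theta> r \<notin> {\<theta> a, \<theta> b}"
  then have "a < r" "r < b"
    by (auto simp: less_le)
  then show "\<exists>d>0. \<forall>u \<in> {a..b}. r \<le> u \<and> u < r + d \<longrightarrow> \<theta> r \<le> \<theta> u"
    using assms(2) by (intro exI[of _ "b - r"]) (auto simp: mono_on_def)
qed (auto simp: is_interval_cc)

section \<open>Nonnegative cochains\<close>

context graph_sequence
begin

lemma nonneg_never_clockwise:
  assumes g: "\<And>e. e \<in> gedges (X k) \<Longrightarrow> 0 \<le> g e"
    and q: "graph_op_path (X k) UNIV q"
  shows "never_clockwise (\<lambda>t. edge_circle_map (X k) g (q t))"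
proof -
  have "continuous_map (top_of_set UNIV) (gspace (X k)) q"
    using q by (simp add: graph_op_path_def)
  then obtain \<theta> where \<theta>: "continuous_on UNIV \<theta>" "\<And>t. edge_circle_map (X k) g (q t) = circ (\<theta> t)"
    using path_lift_exists[of UNIV k q g] by auto
  have "mono \<theta>"
    using op_path_lift_mono[OF g is_interval_univ q \<theta>(1)] \<theta>(2) by simp
  then show ?thesis
    unfolding never_clockwise_iff using \<theta> by blast
qed

text \<open>The potential attains its maximum over the image of the vertices of \<open>X l\<close>; it cannot increase
  along an edge leaving a maximal vertex, and the image of that edge is all of \<open>X k\<close>.\<close>

lemma nonneg_coboundary_eq_0:
  fixes g :: "'e \<Rightarrow> int" and p :: "'a \<Rightarrow> int"
  assumes simplicity: "simplicity_condition X f" and "1 \<le> k"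
    and p: "\<And>e. e \<in> gedges (X k) \<Longrightarrow> g e = p (gparam (X k) e 1) - p (gparam (X k) e 0)"
    and g: "\<And>e. e \<in> gedges (X k) \<Longrightarrow> 0 \<le> g e"
    and e: "e \<in> gedges (X k)"
  shows "g e = 0"
proof -
  obtain w where w: "continuous_map (gspace (X k)) euclideanreal w"
    "\<forall>x \<in> topspace (gspace (X k)). edge_circle_map (X k) g x = circ (w x)"
    "\<forall>e \<in> gedges (X k). \<forall>t \<in> {0..1}. w (gparam (X k) e t) = of_int (p (gparam (X k) e 0)) + t * of_int (g e)"
    by (rule edge_circle_map_coboundary[OF p])
  have wv: "w v = of_int (p v)" if v: "v \<in> gverts (X k)" for v
  proof -
    obtain e where "e \<in> gedges (X k)" "gparam (X k) e 0 = v"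
      using v by (rule edge_out_of)
    then show ?thesis
      using bspec[OF bspec[OF w(3)], of e 0] by simp
  qed
  obtain l where l: "k \<le> l" "\<And>e. e \<in> gedges (X l) \<Longrightarrow>
      bonding f k (l - k) ` (gparam (X l) e ` {0..1}) = topspace (gspace (X k))"
    using simplicity \<open>1 \<le> k\<close> unfolding simplicity_condition_def by (metis order_refl)
  obtain n where n: "l = k + n"
    using l(1) le_Suc_ex by blast
  let ?b = "bonding f k n"
  have "gparam (X k) e 0 \<in> topspace (gspace (X k))"
    using param_in_topspace[OF e] by simp
  then obtain x where x: "x \<in> topspace L" "x k = gparam (X k) e 0"
    by (rule coord_surj)
  obtain e0 t0 where "e0 \<in> gedges (X l)"
    using L_coord[OF x(1), of l] by (rule topspace_cases)
  then have "gverts (X l) \<noteq> {}"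
    using param_ends by blast
  \<comment> \<open>The maximum of the potential over images of vertices is obtained as a minimum of
    its negative.\<close>
  then obtain v where v: "is_arg_min (\<lambda>v. - p (?b v)) (\<lambda>v. v \<in> gverts (X l)) v"
    using ex_is_arg_min_if_finite[OF finite_verts] by blast
  then have v: "v \<in> gverts (X l)" "\<And>v'. v' \<in> gverts (X l) \<Longrightarrow> p (?b v') \<le> p (?b v)"
    by (simp_all add: is_arg_min_linorder)
  obtain e' where e': "e' \<in> gedges (X l)" "gparam (X l) e' 0 = v"
    using v(1) by (rule edge_out_of)
  define q where "q = ?b \<circ> gparam (X l) e'"
  have q: "graph_op_path (X k) {0..1} q"
    unfolding q_def using bonding_op_path[of "{0..1}" k n] edge_op_path[OF e'(1)] n by (simp add: is_interval_cc)
  then have qc: "continuous_map (top_of_set {0..1}) (gspace (X k)) q"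
    by (simp add: graph_op_path_def)
  have "mono_on {0..1} (w \<circ> q)"
  proof (rule op_path_lift_mono[OF g _ q])
    show "continuous_on {0..1} (w \<circ> q)"
      using continuous_map_compose[OF qc w(1)] by simp
    show "edge_circle_map (X k) g (q t) = circ ((w \<circ> q) t)" if "t \<in> {0..1}" for t
      using continuous_map_image_subset_topspace[OF qc] w(2) that by (simp add: image_subset_iff)
  qed (auto simp: is_interval_cc)
  moreover have "w (q 1) \<le> w (q 0)"
  proof -
    have "w (q 1) = of_int (p (?b (gparam (X l) e' 1)))" "w (q 0) = of_int (p (?b v))"
      using bonding_verts[of k n] param_ends[OF e'(1)] e'(2) v(1) n wv by (auto simp: q_def image_subset_iff)
    then show ?thesis
      using v(2)[OF param_ends(2)[OF e'(1)]] by simp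
  qed
  ultimately have const: "w (q t) = w (q 0)" if "t \<in> {0..1}" for t
    using mono_onD[of "{0..1}" "w \<circ> q" 0 t] mono_onD[of "{0..1}" "w \<circ> q" t 1] that by auto
  have "q ` {0..1} = topspace (gspace (X k))"
    using l(2)[OF e'(1)] n by (simp add: q_def image_comp)
  then have all: "w y = w (q 0)" if "y \<in> topspace (gspace (X k))" for y
    using const that by (metis imageE)
  have "of_int (p (gparam (X k) e 1)) = (of_int (p (gparam (X k) e 0)) :: real)"
    using wv[OF param_ends(1)[OF e]] wv[OF param_ends(2)[OF e]] all verts_subset param_ends[OF e]
    by (metis subsetD)
  then show ?thesis
    using p[OF e] by simp
qed

end

section \<open>Identification of the winding cone\<close>

locale oriented_limit = graph_sequence +
  fixes \<O> :: "(nat \<Rightarrow> 'a, 's) chart set"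
  assumes atlas: "oriented_atlas L \<O>"
    and proj: "\<And>k I \<gamma>. is_interval I \<Longrightarrow> op_curve L \<O> I \<gamma> \<Longrightarrow> graph_op_path (X k) I (\<lambda>t. \<gamma> t k)"
    and simplicity: "simplicity_condition X f"
begin

text \<open>Orientation preserving curves in the limit project to orientation preserving paths,
  along which the circle map of a nonnegative cochain never turns back.\<close>

lemma level_map_nonneg_in_Br_pos:
  assumes "\<And>e. e \<in> gedges (X k) \<Longrightarrow> 0 \<le> g e"
  shows "level_map k g \<in> Br_pos L \<O>"
proof -
  have "non_orientation_reversing L \<O> (\<lambda>x. edge_circle_map (X k) g (x k))"
    unfolding non_orientation_reversing_def
  proof (intro allI impI)
    fix \<gamma> assume "op_curve L \<O> UNIV \<gamma>"
    then have "graph_op_path (X k) UNIV (\<lambda>t. \<gamma> t k)"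
      by (intro proj is_interval_univ)
    from nonneg_never_clockwise[OF assms this]
    show "never_clockwise ((\<lambda>x. edge_circle_map (X k) g (x k)) \<circ> \<gamma>)"
      by (simp add: o_def)
  qed
  then show ?thesis
    unfolding Br_pos_eq level_map_def using unit_map_coord by blast
qed

text \<open>Composed with \<open>s\<close>, the lifted edge becomes a curve on the real line over
  the interior of \<open>e\<close>, hence orientation preserving. The monotone angle
  \<open>\<Theta>\<close> along it agrees with \<open>\<theta>\<close> up to a constant, and the end
  points follow by continuity.\<close>

lemma lift_along_edge_mono:
  assumes nor: "non_orientation_reversing L \<O> \<phi>" and e: "e \<in> gedges (X m)"
    and \<gamma>: "continuous_map (top_of_set {0..1}) L \<gamma>" "\<forall>t \<in> {0..1}. \<gamma> t m = gparam (X m) e t"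
    and \<theta>: "continuous_on {0..1} \<theta>" "\<And>t. t \<in> {0..1} \<Longrightarrow> \<phi> (\<gamma> t) = circ (\<theta> t)"
  shows "mono_on {0..1} \<theta>"
proof -
  obtain s :: "real \<Rightarrow> real" where s: "continuous_on UNIV s" "strict_mono s" "range s = {0<..<1}"
    by (rule real_to_unit_interval)
  have s01: "s t \<in> {0<..<1}" for t
    using s(3) by blast
  then have s01': "s t \<in> {0..1}" for t
    by (meson greaterThanLessThan_subseteq_atLeastAtMost_iff order_refl subsetD)
  have "continuous_map (top_of_set UNIV) (top_of_set {0..1}) s"
    unfolding continuous_map_in_subtopology using s(1) s01' by auto
  then have \<gamma>s: "continuous_map (top_of_set UNIV) L (\<gamma> \<circ> s)"
    using \<gamma>(1) by (rule continuous_map_compose)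
  have "op_curve L \<O> UNIV (\<gamma> \<circ> s)"
    by (rule op_curve_if_over_edge[where \<sigma> = s, OF atlas _ is_interval_univ \<gamma>s e])
       (use proj s01' \<gamma>(2) s(2,3) in auto)
  then have "never_clockwise (\<phi> \<circ> (\<gamma> \<circ> s))"
    using nor by (simp add: non_orientation_reversing_def)
  then obtain \<Theta> where \<Theta>: "continuous_on UNIV \<Theta>" "mono \<Theta>" "\<And>t. \<phi> (\<gamma> (s t)) = circ (\<Theta> t)"
    by (auto simp: never_clockwise_iff)
  have diff: "\<theta> (s t) - \<theta> (s r) = \<Theta> t - \<Theta> r" for r t
  proof (rule circle_lift_unique[of UNIV "\<lambda>t. \<theta> (s t)"])
    show "continuous_on UNIV (\<lambda>t. \<theta> (s t))"
      using \<theta>(1) s(1) s01' by (intro continuous_on_compose2[OF \<theta>(1) s(1)]) auto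
    show "circ (\<theta> (s t)) = circ (\<Theta> t)" for t
      using \<theta>(2)[OF s01'] \<Theta>(3) by simp
  qed (use \<Theta>(1) in auto)
  have "mono_on {0<..<1} \<theta>"
  proof (rule mono_onI)
    fix a b :: real assume ab: "a \<in> {0<..<1}" "b \<in> {0<..<1}" "a \<le> b"
    then obtain r t where rt: "a = s r" "b = s t"
      using s(3) by blast
    then have "r \<le> t"
      using ab(3) s(2) by (simp add: strict_mono_less_eq)
    then show "\<theta> a \<le> \<theta> b"
      using diff[of t r] monoD[OF \<Theta>(2)] rt by fastforce
  qed
  then show ?thesis
    by (rule mono_on_closed_interval[OF \<theta>(1)])
qed

text \<open>By simplicity a nonconstant nonnegative map turns by a definite angle along every edge of
  \<open>X m\<close>, whereas its logarithmic correction \<open>u\<close> hardly varies on the fibres over the vertices.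
  So adding the coboundary of the integer parts of \<open>u\<close> makes the cochain nonnegative.\<close>

lemma nonneg_representative:
  assumes \<phi>: "unit_map L \<phi>" and nor: "non_orientation_reversing L \<O> \<phi>"
  obtains k g where "g \<in> carrier (edge_fun_group (X k))" "\<forall>e \<in> gedges (X k). 0 \<le> g e"
    "Br_class L \<phi> = level_map k g"
proof (cases "\<forall>x \<in> topspace L. \<forall>y \<in> topspace L. \<phi> x = \<phi> y")
  \<comment> \<open>A constant map turns nowhere, so the quantitative argument is void; its class is
    trivial and the zero cochain represents it.\<close>
  case True
  have "\<exists>c. \<forall>x \<in> topspace L. \<phi> x = circ c"
    using True circ_surj unit_mapD(2)[OF \<phi>] by metis
  then obtain c where "\<forall>x \<in> topspace L. \<phi> x = circ c"
    by blast
  then have "Br_class L \<phi> = \<one>\<^bsub>Br L\<^esub>"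
    unfolding Br_one Br_class_eq_iff[OF \<phi> unit_map_one] by (intro exI[of _ "\<lambda>_. c"]) simp
  also have "\<dots> = level_map 0 (\<lambda>e \<in> gedges (X 0). 0)"
    by (rule level_map_zero[symmetric]) simp
  finally show thesis
    by (intro that[of "\<lambda>e \<in> gedges (X 0). 0" 0]) (simp_all add: carrier_edge_fun)
next
  case False
  then obtain x y where xy: "x \<in> topspace L" "y \<in> topspace L" "\<phi> x \<noteq> \<phi> y"
    by blast
  define D where "D = dist (\<phi> x) (\<phi> y)"
  \<comment> \<open>Along a lifted edge values within \<open>D / 4\<close> of
    \<open>\<phi> x\<close> and of \<open>\<phi> y\<close> occur, hence two values more than
    \<open>D / 2\<close> apart. A chord is at most \<open>2 * pi\<close> times the angle, so the
    angle turned exceeds \<open>r\<close>.\<close>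
  define r where "r = D / (4 * pi)"
  have "D > 0"
    using xy(3) by (simp add: D_def)
  then have "r > 0"
    by (simp add: r_def)
  obtain k0 g0 where g0: "g0 \<in> carrier (edge_fun_group (X k0))"
    "Br_class L \<phi> = Br_class L (\<lambda>x. edge_circle_map (X k0) g0 (x k0))"
    using \<phi> by (rule Br_class_surj)
  then obtain w where w: "continuous_map L euclideanreal w"
      "\<forall>x \<in> topspace L. \<phi> x = edge_circle_map (X k0) g0 (x k0) * circ (w x)"
    unfolding Br_class_eq_iff[OF \<phi> unit_map_coord] by blast
  \<comment> \<open>Two scales: \<open>k1\<close> controls \<open>\<phi>\<close> on fibres over the
    level that edges cover, \<open>k2\<close> controls its logarithmic part over the
    vertices.\<close>
  obtain k1 where k1: "\<And>m x y. k1 \<le> m \<Longrightarrow> x \<in> topspace L \<Longrightarrow> y \<in> topspace L \<Longrightarrow> x m = y m \<Longrightarrow> dist (\<phi> x) (\<phi> y) < D / 4"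
    using fibre_oscillation[OF unit_mapD(1)[OF \<phi>], of "D / 4"] \<open>D > 0\<close> by auto
  obtain k2 where k2: "\<And>m x y. k2 \<le> m \<Longrightarrow> x \<in> topspace L \<Longrightarrow> y \<in> topspace L \<Longrightarrow> x m = y m \<Longrightarrow> dist (w x) (w y) < r / 2"
    using fibre_oscillation[OF w(1), of "r / 2"] \<open>r > 0\<close> by auto
  \<comment> \<open>The simplicity condition speaks about levels from \<open>1\<close> on.\<close>
  define k where "k = max 1 k1"
  obtain l where l: "k \<le> l" "\<And>m e. l \<le> m \<Longrightarrow> e \<in> gedges (X m) \<Longrightarrow>
      bonding f k (m - k) ` (gparam (X m) e ` {0..1}) = topspace (gspace (X k))"
    using simplicity unfolding simplicity_condition_def by (metis k_def max.cobounded1)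
  define n where "n = max l k2"
  \<comment> \<open>Written as \<open>k0 + n\<close> so that the cochain can be pulled up from
    \<open>k0\<close> in \<open>n\<close> steps.\<close>
  define m where "m = k0 + n"
  have m: "l \<le> m" "k2 \<le> m" "k \<le> m"
    using l(1) by (auto simp: m_def n_def)
  define g where "g = pull_iter k0 n g0"
  have g: "g \<in> carrier (edge_fun_group (X m))"
    using pull_iter_carrier[OF g0(1)] by (simp add: g_def m_def)
  obtain v where v: "continuous_map (gspace (X m)) euclideanreal v"
    "\<forall>x \<in> topspace L. edge_circle_map (X k0) g0 (x k0) = edge_circle_map (X m) g (x m) * circ (v (x m))"
    unfolding m_def g_def by (rule pull_iter_circle_map)
  \<comment> \<open>The part coming from \<open>v\<close> is constant on the fibres over level
    \<open>m\<close>, so \<open>u\<close> oscillates there as little as \<open>w\<close>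
    does.\<close>
  define u where "u x = v (x m) + w x" for x
  have u: "continuous_map L euclideanreal u"
    using continuous_map_compose[OF coord_continuous v(1)] w(1)
    unfolding u_def by (intro continuous_map_add) (simp_all add: o_def)
  have \<phi>u: "\<phi> x = edge_circle_map (X m) g (x m) * circ (u x)" if "x \<in> topspace L" for x
    using v(2) w(2) that by (simp add: u_def circ_add mult.assoc)
  have u_osc: "\<bar>u x - u y\<bar> < r / 2" if "x \<in> topspace L" "y \<in> topspace L" "x m = y m" for x y
    using k2[OF m(2) that] that(3) by (simp add: u_def dist_real_def)
  have "\<exists>x. x \<in> topspace L \<and> x m = a" if a: "a \<in> gverts (X m)" for a
  proof -
    have "a \<in> topspace (gspace (X m))"
      using a verts_subset by blast
    then show ?thesis
      by (rule coord_surj) blast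
  qed
  \<comment> \<open>A potential is a function of vertices, whereas \<open>u\<close> lives on the
    limit: \<open>z\<close> selects one thread above each vertex.\<close>
  then obtain z where z: "\<And>a. a \<in> gverts (X m) \<Longrightarrow> z a \<in> topspace L" "\<And>a. a \<in> gverts (X m) \<Longrightarrow> z a m = a"
    by metis
  have pos: "0 < of_int (g e) + u (z (gparam (X m) e 1)) - u (z (gparam (X m) e 0))" if e: "e \<in> gedges (X m)" for e
  proof -
    obtain \<gamma> where \<gamma>: "continuous_map (top_of_set {0..1}) L \<gamma>" "\<forall>t \<in> {0..1}. \<gamma> t m = gparam (X m) e t"
      using e by (rule lift_edge_to_limit)
    have \<gamma>L: "\<gamma> t \<in> topspace L" if "t \<in> {0..1}" for t
      using continuous_map_image_subset_topspace[OF \<gamma>(1)] that by (simp add: image_subset_iff)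
    define \<theta> where "\<theta> t = t * of_int (g e) + u (\<gamma> t)" for t
    have \<theta>_cont: "continuous_on {0..1} \<theta>"
      using continuous_map_compose[OF \<gamma>(1) u] unfolding \<theta>_def by (intro continuous_intros) (simp add: o_def)
    have \<theta>: "\<phi> (\<gamma> t) = circ (\<theta> t)" if t: "t \<in> {0..1}" for t
      using \<phi>u[OF \<gamma>L[OF t]] \<gamma>(2) t edge_circle_map_param[OF e t] by (simp add: \<theta>_def circ_add)
    have mono: "mono_on {0..1} \<theta>"
      by (rule lift_along_edge_mono[OF nor e \<gamma> \<theta>_cont \<theta>])
    \<comment> \<open>The projection of the lifted edge to \<open>X k\<close> is everything, so it
      meets the coordinate of \<open>q\<close> there, and \<open>\<phi>\<close> hardly varies on
      that fibre.\<close>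
    have reach: "\<exists>t \<in> {0..1}. dist (\<phi> (\<gamma> t)) (\<phi> q) < D / 4" if q: "q \<in> topspace L" for q
    proof -
      have "q k \<in> bonding f k (m - k) ` (gparam (X m) e ` {0..1})"
        using l(2)[OF m(1) e] L_coord[OF q, of k] by simp
      then obtain t where t: "t \<in> {0..1}" "q k = bonding f k (m - k) (gparam (X m) e t)"
        by blast
      have "\<gamma> t k = bonding f k (m - k) (\<gamma> t m)"
        using bonding_L[OF \<gamma>L[OF t(1)], of k "m - k"] m(3) by simp
      also have "\<dots> = q k"
        using \<gamma>(2) t by simp
      finally show ?thesis
        using k1[of k "\<gamma> t" q] \<gamma>L[OF t(1)] q t(1) by (auto simp: k_def)
    qed
    obtain t1 where t1: "t1 \<in> {0..1}" "dist (\<phi> (\<gamma> t1)) (\<phi> x) < D / 4"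
      using reach[OF xy(1)] by blast
    obtain t2 where t2: "t2 \<in> {0..1}" "dist (\<phi> (\<gamma> t2)) (\<phi> y) < D / 4"
      using reach[OF xy(2)] by blast
    have "D \<le> dist (\<phi> (\<gamma> t1)) (\<phi> x) + dist (\<phi> (\<gamma> t1)) (\<phi> (\<gamma> t2)) + dist (\<phi> (\<gamma> t2)) (\<phi> y)"
      unfolding D_def using dist_triangle[of "\<phi> x" "\<phi> y" "\<phi> (\<gamma> t1)"]
        dist_triangle[of "\<phi> (\<gamma> t1)" "\<phi> y" "\<phi> (\<gamma> t2)"] by (simp add: dist_commute)
    then have "D / 2 < dist (\<phi> (\<gamma> t1)) (\<phi> (\<gamma> t2))"
      using t1(2) t2(2) by simp
    also have "\<dots> \<le> 2 * pi * \<bar>\<theta> t1 - \<theta> t2\<bar>"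
      using norm_circ_diff_le \<theta>[OF t1(1)] \<theta>[OF t2(1)] by (simp add: dist_norm)
    finally have "r < \<bar>\<theta> t1 - \<theta> t2\<bar>"
      by (simp add: r_def field_simps)
    \<comment> \<open>Monotonicity places both angles between the end values, so the order of
      \<open>t1\<close> and \<open>t2\<close> is irrelevant.\<close>
    moreover have "\<theta> 0 \<le> \<theta> t1" "\<theta> 0 \<le> \<theta> t2" "\<theta> t1 \<le> \<theta> 1" "\<theta> t2 \<le> \<theta> 1"
      using t1(1) t2(1) by (auto intro!: mono_onD[OF mono])
    ultimately have "r < \<theta> 1 - \<theta> 0"
      by linarith
    \<comment> \<open>Moving from the end points of the lift to the selected threads costs less than
      \<open>r / 2\<close> at each end, less than the angle gained.\<close>
    moreover have "\<bar>u (\<gamma> 1) - u (z (gparam (X m) e 1))\<bar> < r / 2" "\<bar>u (\<gamma> 0) - u (z (gparam (X m) e 0))\<bar> < r / 2"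
      using z(2)[OF param_ends(1)[OF e]] z(2)[OF param_ends(2)[OF e]] \<gamma>(2)
      by (intro u_osc \<gamma>L z(1) param_ends[OF e]; simp)+
    moreover have "\<theta> 1 - \<theta> 0 = of_int (g e) + u (\<gamma> 1) - u (\<gamma> 0)"
      by (simp add: \<theta>_def)
    ultimately show ?thesis
      by linarith
  qed
  \<comment> \<open>Taking floors in the real inequality \<open>pos\<close> keeps it, since
    \<open>g e\<close> is an integer; the real corrections become an integral coboundary.\<close>
  define g' where "g' = (\<lambda>e \<in> gedges (X m). g e + (\<lfloor>u (z (gparam (X m) e 1))\<rfloor> - \<lfloor>u (z (gparam (X m) e 0))\<rfloor>))"
  have nonneg: "0 \<le> g' e" if e: "e \<in> gedges (X m)" for e
  proof -
    have "\<lfloor>u (z (gparam (X m) e 0))\<rfloor> \<le> \<lfloor>of_int (g e) + u (z (gparam (X m) e 1))\<rfloor>"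
      by (rule floor_mono) (use pos[OF e] in simp)
    then show ?thesis
      using e by (simp add: g'_def)
  qed
  have eq: "Br_class L \<phi> = level_map m g'"
  proof -
    have "Br_class L \<phi> = level_map m g"
      using g0(2) level_map_pull_iter[of k0 n g0] by (simp add: level_map_def g_def m_def)
    also have "\<dots> = level_map m g'"
      by (rule level_map_cong[of m g g' "\<lambda>a. - \<lfloor>u (z a)\<rfloor>"]) (simp add: g'_def)
    finally show ?thesis .
  qed
  have "g' \<in> carrier (edge_fun_group (X m))"
    by (simp add: g'_def carrier_edge_fun)
  then show thesis
    using nonneg by (intro that[OF _ _ eq]) auto
qed

end

section \<open>The direct limit as an ordered group and the final isomorphism\<close>

context oriented_limit
begin

text \<open>The substance is antisymmetry. If a positive class has a positive inverse, then at a
  high level the sum of their nonnegative cochains is a coboundary, which vanishes by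
  \<open>nonneg_coboundary_eq_0\<close>; hence both summands vanish.\<close>

lemma limit_group_ordered: "ordered_group (limit_group X f) (limit_group_pos X f)"
proof -
  let ?G = "limit_group X f" and ?P = "limit_group_pos X f"
  interpret G: comm_group ?G
    by (rule limit.dirlim_comm_group)
  have class_carrier: "limit_class X f k (graph_class (X k) g) \<in> carrier ?G"
    if "g \<in> carrier (edge_fun_group (X k))" for k g
    using that by (intro limit.carrier_dirlimI) (simp add: graph_group_carrier)
  have pos_iff: "\<xi> \<in> ?P \<longleftrightarrow> (\<exists>k g. g \<in> edge_fun_pos (X k) \<and> \<xi> = limit_class X f k (graph_class (X k) g))" for \<xi>
    unfolding dirlim_pos_def graph_group_pos_def by blast
  have class_up: "limit_class X f (k + n) (graph_class (X (k + n)) (pull_iter k n g)) = limit_class X f k (graph_class (X k) g)"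
    if g: "g \<in> carrier (edge_fun_group (X k))" for k n g
    using limit.class_up[of k "k + n" "graph_class (X k) g"] g
    by (simp add: limit.up_def transition_graph_class graph_group_carrier)
  have pos_up: "pull_iter k n g \<in> edge_fun_pos (X (k + n))" if g: "g \<in> edge_fun_pos (X k)" for k n g
  proof (induction n)
    case (Suc n)
    then show ?case
      using step.pull_fun_nonneg[where k = "k + n" and g = "pull_iter k n g"] step.pull_fun_carrier
      by (simp add: edge_fun_pos_def)
  qed (use g in simp)
  have raise: "\<exists>g \<in> edge_fun_pos (X m). \<xi> = limit_class X f m (graph_class (X m) g)"
    if g: "g \<in> edge_fun_pos (X k)" "\<xi> = limit_class X f k (graph_class (X k) g)" "k \<le> m" for k m g \<xi>
  proof -
    have "g \<in> carrier (edge_fun_group (X k))"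
      using g(1) by (simp add: edge_fun_pos_def)
    then show ?thesis
      using class_up[of g k "m - k"] pos_up[OF g(1), of "m - k"] g(2,3) by auto
  qed
  \<comment> \<open>Besides a common level, a level of at least \<open>1\<close> is requested,
    because the simplicity condition starts there.\<close>
  have common: "\<exists>m \<ge> 1. \<exists>g \<in> edge_fun_pos (X m). \<exists>h \<in> edge_fun_pos (X m).
      \<xi> = limit_class X f m (graph_class (X m) g) \<and> \<zeta> = limit_class X f m (graph_class (X m) h)"
    if \<xi>: "\<xi> \<in> ?P" and \<zeta>: "\<zeta> \<in> ?P" for \<xi> \<zeta>
  proof -
    obtain k g l h where "g \<in> edge_fun_pos (X k)" "\<xi> = limit_class X f k (graph_class (X k) g)"
      "h \<in> edge_fun_pos (X l)" "\<zeta> = limit_class X f l (graph_class (X l) h)"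
      using \<xi> \<zeta> unfolding pos_iff by blast
    then show ?thesis
      using raise[of g k \<xi> "Suc (max k l)"] raise[of h l \<zeta> "Suc (max k l)"]
      by (intro exI[of _ "Suc (max k l)"]) auto
  qed
  have mult: "limit_class X f m (graph_class (X m) g) \<otimes>\<^bsub>?G\<^esub> limit_class X f m (graph_class (X m) h) =
      limit_class X f m (graph_class (X m) (g \<otimes>\<^bsub>edge_fun_group (X m)\<^esub> h))"
    if "g \<in> carrier (edge_fun_group (X m))" "h \<in> carrier (edge_fun_group (X m))" for m g h
    using that by (simp add: limit.mult_class_same graph_group_carrier graph_group_mult)
  have zero: "limit_class X f m (graph_class (X m) \<one>\<^bsub>edge_fun_group (X m)\<^esub>) = \<one>\<^bsub>?G\<^esub>" for m
    using limit.one_class[of m] by (simp add: graph_class_one)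
  have "submonoid ?P ?G"
  proof
    show "?P \<subseteq> carrier ?G"
      using class_carrier unfolding subset_iff pos_iff by (auto simp: edge_fun_pos_def)
    have "\<one>\<^bsub>edge_fun_group (X 0)\<^esub> \<in> edge_fun_pos (X 0)"
      by (simp add: edge_fun_pos_def edge_fun_one carrier_edge_fun)
    then show "\<one>\<^bsub>?G\<^esub> \<in> ?P"
      unfolding pos_iff by (intro exI[of _ 0] exI[of _ "\<one>\<^bsub>edge_fun_group (X 0)\<^esub>"] conjI zero[symmetric])
  next
    fix \<xi> \<zeta> assume "\<xi> \<in> ?P" "\<zeta> \<in> ?P"
    then obtain m g h where gh: "g \<in> edge_fun_pos (X m)" "h \<in> edge_fun_pos (X m)"
      "\<xi> = limit_class X f m (graph_class (X m) g)" "\<zeta> = limit_class X f m (graph_class (X m) h)"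
      using common[of \<xi> \<zeta>] by blast
    then have "\<xi> \<otimes>\<^bsub>?G\<^esub> \<zeta> = limit_class X f m (graph_class (X m) (g \<otimes>\<^bsub>edge_fun_group (X m)\<^esub> h))"
      by (simp add: mult edge_fun_pos_def)
    moreover have "g \<otimes>\<^bsub>edge_fun_group (X m)\<^esub> h \<in> edge_fun_pos (X m)"
      using gh(1,2) by (simp add: edge_fun_pos_def edge_fun_mult carrier_edge_fun)
    ultimately show "\<xi> \<otimes>\<^bsub>?G\<^esub> \<zeta> \<in> ?P"
      unfolding pos_iff by blast
  qed
  moreover have "generate ?G ?P = carrier ?G"
  proof
    have "?P \<subseteq> carrier ?G"
      using submonoid.subset[OF calculation] .
    then show "generate ?G ?P \<subseteq> carrier ?G"
      by (rule G.generate_incl)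
    show "carrier ?G \<subseteq> generate ?G ?P"
    proof
      fix \<xi> assume "\<xi> \<in> carrier ?G"
      then obtain k A where "A \<in> carrier (graph_group (X k))" "\<xi> = limit_class X f k A"
        unfolding limit.carrier_dirlim by blast
      then obtain g where g: "g \<in> carrier (edge_fun_group (X k))" "\<xi> = limit_class X f k (graph_class (X k) g)"
        unfolding graph_group_carrier by blast
      \<comment> \<open>Positive and negative parts of \<open>g\<close>: their difference shows that
        the cone generates.\<close>
      define a where "a = (\<lambda>e \<in> gedges (X k). max (g e) 0)"
      define b where "b = (\<lambda>e \<in> gedges (X k). max (- g e) 0)"
      have ab: "a \<in> edge_fun_pos (X k)" "b \<in> edge_fun_pos (X k)"
        by (simp_all add: a_def b_def edge_fun_pos_def carrier_edge_fun)
      then have ab': "a \<in> carrier (edge_fun_group (X k))" "b \<in> carrier (edge_fun_group (X k))"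
        by (simp_all add: edge_fun_pos_def)
      let ?a = "limit_class X f k (graph_class (X k) a)" and ?b = "limit_class X f k (graph_class (X k) b)"
      have "g \<otimes>\<^bsub>edge_fun_group (X k)\<^esub> b = a"
        unfolding edge_fun_mult a_def by (rule restrict_ext) (simp add: b_def)
      then have "\<xi> \<otimes>\<^bsub>?G\<^esub> ?b = ?a"
        unfolding g(2) mult[OF g(1) ab'(2)] by simp
      then have "\<xi> = ?a \<otimes>\<^bsub>?G\<^esub> inv\<^bsub>?G\<^esub> ?b"
        using G.inv_solve_right[OF class_carrier[OF g(1)] class_carrier[OF ab'(1)] class_carrier[OF ab'(2)]] g(2)
        by simp
      moreover have "?a \<in> ?P" "?b \<in> ?P"
        using ab unfolding pos_iff by blast+
      ultimately show "\<xi> \<in> generate ?G ?P"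
        by (simp only:) (intro generate.eng generate.incl generate.inv)
    qed
  qed
  moreover have "\<xi> = \<one>\<^bsub>?G\<^esub>" if \<xi>: "\<xi> \<in> ?P" "\<xi> \<in> (\<lambda>x. inv\<^bsub>?G\<^esub> x) ` ?P" for \<xi>
  proof -
    obtain \<zeta> where \<zeta>: "\<zeta> \<in> ?P" "\<xi> = inv\<^bsub>?G\<^esub> \<zeta>"
      using \<xi>(2) by blast
    obtain m g h where gh: "1 \<le> m" "g \<in> edge_fun_pos (X m)" "h \<in> edge_fun_pos (X m)"
      "\<xi> = limit_class X f m (graph_class (X m) g)" "\<zeta> = limit_class X f m (graph_class (X m) h)"
      using common[OF \<xi>(1) \<zeta>(1)] by blast
    have gh': "g \<in> carrier (edge_fun_group (X m))" "h \<in> carrier (edge_fun_group (X m))"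
      using gh(2,3) by (simp_all add: edge_fun_pos_def)
    let ?s = "g \<otimes>\<^bsub>edge_fun_group (X m)\<^esub> h"
    have s: "?s \<in> carrier (edge_fun_group (X m))"
      by (simp add: edge_fun_mult carrier_edge_fun)
    have one: "\<one>\<^bsub>edge_fun_group (X m)\<^esub> \<in> carrier (edge_fun_group (X m))"
      by (simp add: edge_fun_one carrier_edge_fun)
    have "\<xi> \<otimes>\<^bsub>?G\<^esub> \<zeta> = \<one>\<^bsub>?G\<^esub>"
      unfolding \<zeta>(2) using class_carrier[OF gh'(2)] gh(5) by simp
    then have "limit_class X f m (graph_class (X m) ?s) = limit_class X f m (graph_class (X m) \<one>\<^bsub>edge_fun_group (X m)\<^esub>)"
      unfolding gh(4,5) mult[OF gh'] zero .
    then obtain M where M: "m \<le> M" "limit.up m M (graph_class (X m) ?s) =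
        limit.up m M (graph_class (X m) \<one>\<^bsub>edge_fun_group (X m)\<^esub>)"
      using limit.class_eq_iff[of "graph_class (X m) ?s" m "graph_class (X m) \<one>\<^bsub>edge_fun_group (X m)\<^esub>" m] s one
      by (auto simp: graph_group_carrier)
    then obtain n where n: "M = m + n"
      using le_Suc_ex by blast
    let ?g = "pull_iter m n g" and ?h = "pull_iter m n h"
    have pull_mult: "pull_iter m n (a \<otimes>\<^bsub>edge_fun_group (X m)\<^esub> b) =
        pull_iter m n a \<otimes>\<^bsub>edge_fun_group (X (m + n))\<^esub> pull_iter m n b" for a b
      by (induction n) (simp_all add: step.pull_fun_mult)
    \<comment> \<open>An additive map sends the neutral element to an idempotent, that is, to a
      cochain equal to its own double.\<close>
    have zero_pull: "pull_iter m n \<one>\<^bsub>edge_fun_group (X m)\<^esub> e = 0" if e: "e \<in> gedges (X (m + n))" for e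
    proof -
      have "\<one>\<^bsub>edge_fun_group (X m)\<^esub> \<otimes>\<^bsub>edge_fun_group (X m)\<^esub> \<one>\<^bsub>edge_fun_group (X m)\<^esub> = \<one>\<^bsub>edge_fun_group (X m)\<^esub>"
        by (simp add: edge_fun_mult edge_fun_one cong: restrict_cong)
      from fun_cong[OF pull_mult[of "\<one>\<^bsub>edge_fun_group (X m)\<^esub>" "\<one>\<^bsub>edge_fun_group (X m)\<^esub>", unfolded this], of e]
      have "pull_iter m n \<one>\<^bsub>edge_fun_group (X m)\<^esub> e =
          pull_iter m n \<one>\<^bsub>edge_fun_group (X m)\<^esub> e + pull_iter m n \<one>\<^bsub>edge_fun_group (X m)\<^esub> e"
        unfolding edge_fun_mult[where X = "X (m + n)"] restrict_apply'[OF e] .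
      then show ?thesis
        by simp
    qed
    have "graph_class (X (m + n)) (pull_iter m n ?s) =
        graph_class (X (m + n)) (pull_iter m n \<one>\<^bsub>edge_fun_group (X m)\<^esub>)"
      using M(2) n by (simp add: limit.up_def transition_graph_class[OF s] transition_graph_class[OF one])
    then obtain p where "\<forall>e \<in> gedges (X (m + n)). pull_iter m n ?s e - pull_iter m n \<one>\<^bsub>edge_fun_group (X m)\<^esub> e =
        p (gparam (X (m + n)) e 1) - p (gparam (X (m + n)) e 0)"
      unfolding graph_class_eq_iff[OF pull_iter_carrier[OF s] pull_iter_carrier[OF one]] by blast
    then have p: "pull_iter m n ?s e = p (gparam (X (m + n)) e 1) - p (gparam (X (m + n)) e 0)"
      if "e \<in> gedges (X (m + n))" for e
      using that zero_pull by simp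
    have sum: "pull_iter m n ?s e = ?g e + ?h e" if "e \<in> gedges (X (m + n))" for e
      unfolding pull_mult edge_fun_mult[where X = "X (m + n)"] restrict_apply'[OF that] ..
    have g0: "0 \<le> ?g e" "0 \<le> ?h e" if "e \<in> gedges (X (m + n))" for e
      using pos_up[OF gh(2), of n] pos_up[OF gh(3), of n] that by (simp_all add: edge_fun_pos_def)
    have "?g e = 0" if e: "e \<in> gedges (X (m + n))" for e
    proof -
      have "pull_iter m n ?s e = 0"
        by (rule nonneg_coboundary_eq_0[OF simplicity _ p _ e]) (use gh(1) sum g0 in auto)
      then show ?thesis
        using sum[OF e] g0[OF e] by simp
    qed
    then have "?g = \<one>\<^bsub>edge_fun_group (X (m + n))\<^esub>"
      using pull_iter_carrier[OF gh'(1), of n]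
      by (intro extensionalityI[of _ "gedges (X (m + n))"]) (simp_all add: carrier_edge_fun edge_fun_one)
    then show ?thesis
      using class_up[OF gh'(1), of n] zero[of "m + n"] gh(4) by simp
  qed
  moreover have "\<one>\<^bsub>?G\<^esub> \<in> ?P \<inter> (\<lambda>x. inv\<^bsub>?G\<^esub> x) ` ?P"
    using submonoid.one_closed[OF calculation(1)] G.inv_one by (intro IntI image_eqI[of _ _ "\<one>\<^bsub>?G\<^esub>"]) simp_all
  ultimately show ?thesis
    unfolding ordered_group_def preordered_group_def using G.comm_group_axioms by blast
qed

text \<open>The two inclusions between the cones are \<open>level_map_nonneg_in_Br_pos\<close> and
  \<open>nonneg_representative\<close>.\<close>

lemma limit_ordered_iso:
  obtains \<iota> where "\<forall>k. \<forall>g \<in> carrier (edge_fun_group (X k)).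
      \<iota> (limit_class X f k (graph_class (X k) g)) = level_map k g"
    "ordered_group_iso (limit_group X f) (limit_group_pos X f) (Br L) (Br_pos L \<O>) \<iota>"
proof -
  obtain \<iota> where \<iota>: "\<iota> \<in> iso (limit_group X f) (Br L)"
    "\<forall>k. \<forall>g \<in> carrier (edge_fun_group (X k)). \<iota> (limit_class X f k (graph_class (X k) g)) = level_map k g"
    by (rule limit_iso)
  have "\<iota> ` limit_group_pos X f = Br_pos L \<O>"
  proof (intro equalityI subsetI)
    fix b assume "b \<in> \<iota> ` limit_group_pos X f"
    then obtain k g where g: "g \<in> edge_fun_pos (X k)" "b = \<iota> (limit_class X f k (graph_class (X k) g))"
      unfolding dirlim_pos_def graph_group_pos_def by blast
    then show "b \<in> Br_pos L \<O>"
      using \<iota>(2) level_map_nonneg_in_Br_pos[of k g] by (simp add: edge_fun_pos_def)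
  next
    fix b assume "b \<in> Br_pos L \<O>"
    then obtain \<phi> where \<phi>: "unit_map L \<phi>" "non_orientation_reversing L \<O> \<phi>" "b = Br_class L \<phi>"
      unfolding Br_pos_eq by blast
    obtain k g where g: "g \<in> carrier (edge_fun_group (X k))" "\<forall>e \<in> gedges (X k). 0 \<le> g e"
      "Br_class L \<phi> = level_map k g"
      by (rule nonneg_representative[OF \<phi>(1,2)])
    then have "g \<in> edge_fun_pos (X k)" "b = \<iota> (limit_class X f k (graph_class (X k) g))"
      using \<iota>(2) \<phi>(3) by (simp_all add: edge_fun_pos_def)
    then show "b \<in> \<iota> ` limit_group_pos X f"
      unfolding dirlim_pos_def graph_group_pos_def by blast
  qed
  moreover have "ordered_group (Br L) (\<iota> ` limit_group_pos X f)"
    by (rule ordered_group_image[OF limit_group_ordered Br_comm_group \<iota>(1)])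
  ultimately have "ordered_group_iso (limit_group X f) (limit_group_pos X f) (Br L) (Br_pos L \<O>) \<iota>"
    unfolding ordered_group_iso_def using limit_group_ordered \<iota>(1) by simp
  then show thesis
    by (rule that[OF \<iota>(2)])
qed

end

theorem theorem3p11:
  fixes X :: "nat \<Rightarrow> ('a, 'e) graph"
    and f :: "nat \<Rightarrow> 'a \<Rightarrow> 'a"
    and \<O> :: "(nat \<Rightarrow> 'a, 's) chart set"
  assumes "presentation X f"
    and "compact_space (inverse_limit X f)"
    and "connected_space (inverse_limit X f)"
    and "oriented_branched_matchbox_manifold (inverse_limit X f) \<O>"
    and "\<And>k I \<gamma>. is_interval I \<Longrightarrow> op_curve (inverse_limit X f) \<O> I \<gamma> \<Longrightarrow>
           graph_op_path (X k) I (\<lambda>t. \<gamma> t k)"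
    and "simplicity_condition X f"
  shows "\<exists>\<iota>. (\<forall>k. \<forall>g \<in> carrier (edge_fun_group (X k)).
            \<iota> (limit_class X f k (graph_class (X k) g)) =
              Br_class (inverse_limit X f) (\<lambda>x. edge_circle_map (X k) g (x k))) \<and>
          ordered_group_iso (limit_group X f) (limit_group_pos X f)
            (Br (inverse_limit X f)) (Br_pos (inverse_limit X f) \<O>) \<iota>"
proof -
  interpret oriented_limit X f \<O>
  proof
    show "presentation X f" "simplicity_condition X f"
      by fact+
    show "oriented_atlas (inverse_limit X f) \<O>"
      using assms(4) by (simp add: oriented_branched_matchbox_manifold_def orientation_def)
    show "graph_op_path (X k) I (\<lambda>t. \<gamma> t k)" if "is_interval I" "op_curve (inverse_limit X f) \<O> I \<gamma>" for k I \<gamma>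
      using that by (rule assms(5))
  qed
  show ?thesis
  proof (rule limit_ordered_iso)
    fix \<iota>
    assume "\<forall>k. \<forall>g \<in> carrier (edge_fun_group (X k)).
        \<iota> (limit_class X f k (graph_class (X k) g)) = level_map k g"
      and "ordered_group_iso (limit_group X f) (limit_group_pos X f) (Br L) (Br_pos L \<O>) \<iota>"
    then show ?thesis
      unfolding level_map_def by (intro exI[of _ \<iota>] conjI)
  qed
qed

end
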